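(* Let $f,g$ be two probability densities on $\mathbf R^{2d}$ and let $R$ be a density operator on $L^2(\mathbf R^d)$ satisfying $$\int_{\mathbf R^{2d}}(p^2+q^2)(f(p,q)+g(p,q))\,dpdq<\infty\quad\text{and}\quad\mathrm{trace}\big((-\hbar^2\Delta+x^2)R\big)<\infty.$$ Then $$E_\hbar(f,R)\le\mathrm{dist}_{MK,2}(f,g)+E_\hbar(g,R).$$
   Context: $\hbar>0$, $d\ge1$. A density operator is a positive trace-class operator of trace $1$ on $\mathfrak H=L^2(\mathbf R^d)$. Coupling: for a probability density $p$ on $\mathbf R^{2d}$ and a density operator $R$, $\mathcal C(p,R)$ is the set of measurable functions $Q$ defined a.e. on $\mathbf R^d\times\mathbf R^d$ with values in the nonnegative self-adjoint trace-class operators on $\mathfrak H$ such that $\mathrm{trace}\,Q(x,\xi)=p(x,\xi)$ a.e. and $\iint Q(x,\xi)\,dxd\xi=R$. Then $$E_\hbar(p,R)=\Big(\inf_{Q\in\mathcal C(p,R)}\int\mathrm{trace}(c_\hbar(x,\xi)Q(x,\xi))\,dxd\xi\Big)^{1/2}\in[0,+\infty],\quad c_\hbar(x,\xi)=\tfrac12(|x-y|^2+|\xi+i\hbar\nabla_y|^2)$$ acting on $L^2(\mathbf R^d_y)$. $\mathrm{dist}_{MK,2}(\mu,\nu)^2=\inf_\gamma\int|z-z'|^2\gamma(dz,dz')$ over probability measures $\gamma$ with marginals $\mu,\nu$ (Wasserstein distance of order two). *)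

theory Defs
  imports "HOL-Probability.Probability"
begin

section \<open>The complex Hilbert space of square-integrable functions\<close>

definition square_integrable :: "('a::euclidean_space \<Rightarrow> complex) \<Rightarrow> bool" where
  "square_integrable f \<longleftrightarrow>
     f \<in> borel_measurable lborel \<and> integrable lborel (\<lambda>x. (cmod (f x))\<^sup>2)"

lemma square_integrable_add:
  assumes "square_integrable f" "square_integrable g"
  shows "square_integrable (\<lambda>x. f x + g x)"
proof -
  have [measurable]: "f \<in> borel_measurable lborel" "g \<in> borel_measurable lborel"
    using assms by (auto simp: square_integrable_def)
  have *: "(cmod (f x + g x))\<^sup>2 \<le> 2 * (cmod (f x))\<^sup>2 + 2 * (cmod (g x))\<^sup>2" for x
  proof -
    have "(cmod (f x + g x))\<^sup>2 \<le> (cmod (f x) + cmod (g x))\<^sup>2"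
      by (intro power_mono norm_triangle_ineq) auto
    also have "\<dots> \<le> 2 * (cmod (f x))\<^sup>2 + 2 * (cmod (g x))\<^sup>2"
      using sum_squares_bound[of "cmod (f x)" "cmod (g x)"] by (simp add: power2_sum)
    finally show ?thesis .
  qed
  have "integrable lborel (\<lambda>x. (cmod (f x + g x))\<^sup>2)"
    by (rule Bochner_Integration.integrable_bound
          [where f = "\<lambda>x. 2 * (cmod (f x))\<^sup>2 + 2 * (cmod (g x))\<^sup>2"])
       (use assms * in \<open>auto simp: square_integrable_def\<close>)
  then show ?thesis by (simp add: square_integrable_def)
qed

lemma square_integrable_scale:
  assumes "square_integrable f"
  shows "square_integrable (\<lambda>x. c * f x)"
  using assms by (auto simp: square_integrable_def norm_mult power_mult_distrib)

lemma borel_measurable_cnj [measurable]: "cnj \<in> borel_measurable borel"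
  by (intro borel_measurable_continuous_onI continuous_intros)

lemma square_integrable_mult:
  assumes "square_integrable f" "square_integrable g"
  shows "integrable lborel (\<lambda>x. cnj (f x) * g x)"
proof -
  have [measurable]: "f \<in> borel_measurable lborel" "g \<in> borel_measurable lborel"
    using assms by (auto simp: square_integrable_def)
  have *: "cmod (f x) * cmod (g x) \<le> (cmod (f x))\<^sup>2 + (cmod (g x))\<^sup>2" for x
    using sum_squares_bound[of "cmod (f x)" "cmod (g x)"]
      mult_nonneg_nonneg[OF norm_ge_zero[of "f x"] norm_ge_zero[of "g x"]]
    unfolding mult.assoc by linarith
  show ?thesis
    by (rule Bochner_Integration.integrable_bound
          [where f = "\<lambda>x. (cmod (f x))\<^sup>2 + (cmod (g x))\<^sup>2"])
       (use assms * in \<open>auto simp: square_integrable_def norm_mult\<close>)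
qed

quotient_type (overloaded) 'a L2 = "'a::euclidean_space \<Rightarrow> complex" / partial:
  "\<lambda>f g. square_integrable f \<and> square_integrable g \<and> (AE x in lborel. f x = g x)"
proof (rule part_equivpI)
  show "\<exists>f::'a \<Rightarrow> complex. square_integrable f \<and> square_integrable f \<and> (AE x in lborel. f x = f x)"
    by (intro exI[of _ "\<lambda>_. 0"]) (auto simp: square_integrable_def)
  show "symp (\<lambda>f (g::'a \<Rightarrow> complex).
      square_integrable f \<and> square_integrable g \<and> (AE x in lborel. f x = g x))"
    by (auto simp: symp_def elim: AE_mp)
  show "transp (\<lambda>f (g::'a \<Rightarrow> complex).
      square_integrable f \<and> square_integrable g \<and> (AE x in lborel. f x = g x))"
    by (auto simp: transp_def)
qed

lift_definition scaleC :: "complex \<Rightarrow> 'a::euclidean_space L2 \<Rightarrow> 'a L2" (infixr \<open>*\<^sub>C\<close> 75)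
  is "\<lambda>c f x. c * f x"
  by (auto intro: square_integrable_scale)

text \<open>Antilinear in the first argument, linear in the second.\<close>

lift_definition cinner :: "'a::euclidean_space L2 \<Rightarrow> 'a L2 \<Rightarrow> complex"
  is "\<lambda>f g. LINT x|lborel. cnj (f x) * g x"
proof -
  fix f f' g g' :: "'a \<Rightarrow> complex"
  assume "square_integrable f \<and> square_integrable f' \<and> (AE x in lborel. f x = f' x)"
    and "square_integrable g \<and> square_integrable g' \<and> (AE x in lborel. g x = g' x)"
  then show "(LINT x|lborel. cnj (f x) * g x) = (LINT x|lborel. cnj (f' x) * g' x)"
    by (intro integral_cong_AE) (auto simp: square_integrable_def)
qed

instantiation L2 :: (euclidean_space) real_vector
begin

lift_definition zero_L2 :: "'a L2" is "\<lambda>_. 0"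
  by (auto simp: square_integrable_def)

lift_definition plus_L2 :: "'a L2 \<Rightarrow> 'a L2 \<Rightarrow> 'a L2" is "\<lambda>f g x. f x + g x"
  by (auto intro: square_integrable_add)

lift_definition uminus_L2 :: "'a L2 \<Rightarrow> 'a L2" is "\<lambda>f x. - f x"
  by (auto simp: square_integrable_def)

definition minus_L2 :: "'a L2 \<Rightarrow> 'a L2 \<Rightarrow> 'a L2" where "minus_L2 f g = f + - g"

definition scaleR_L2 :: "real \<Rightarrow> 'a L2 \<Rightarrow> 'a L2" where
  "scaleR_L2 r f = complex_of_real r *\<^sub>C f"

instance
proof
  fix f g h :: "'a L2" and r s :: real
  show "f + g + h = f + (g + h)"
    by transfer (auto simp: algebra_simps intro!: square_integrable_add)
  show "f + g = g + f"
    by transfer (auto simp: algebra_simps intro!: square_integrable_add)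
  show "0 + f = f" by transfer auto
  show "- f + f = 0"
    by transfer (auto simp: square_integrable_def)
  show "f - g = f + - g" by (simp add: minus_L2_def)
  show "r *\<^sub>R (f + g) = r *\<^sub>R f + r *\<^sub>R g" unfolding scaleR_L2_def
    by transfer (auto simp: distrib_left distrib_right intro!: square_integrable_add square_integrable_scale)
  show "(r + s) *\<^sub>R f = r *\<^sub>R f + s *\<^sub>R f" unfolding scaleR_L2_def
    by transfer (auto simp: distrib_left distrib_right intro!: square_integrable_add square_integrable_scale)
  show "r *\<^sub>R s *\<^sub>R f = (r * s) *\<^sub>R f" unfolding scaleR_L2_def
    by transfer (auto simp: mult.assoc intro!: square_integrable_scale)
  show "1 *\<^sub>R f = f" unfolding scaleR_L2_def by transfer auto
qed

end

lemma cinner_commute: "cinner g f = cnj (cinner f g)"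
proof transfer
  fix f g :: "'a \<Rightarrow> complex"
  have "cnj (LINT x|lborel. cnj (f x) * g x) = (LINT x|lborel. cnj (cnj (f x) * g x))"
    by (rule Bochner_Integration.integral_cnj[symmetric])
  then show "(LINT x|lborel. cnj (g x) * f x) = cnj (LINT x|lborel. cnj (f x) * g x)"
    by (simp add: mult.commute)
qed

lemma cinner_add_left: "cinner (f + g) h = cinner f h + cinner g h"
  by transfer (simp add: distrib_right square_integrable_mult)

lemma cinner_scaleC_left: "cinner (c *\<^sub>C f) g = cnj c * cinner f g"
  by transfer (simp add: mult.assoc)

lemma cinner_add_right: "cinner h (f + g) = cinner h f + cinner h g"
  by (metis cinner_add_left cinner_commute complex_cnj_add)

lemma cinner_scaleC_right: "cinner f (c *\<^sub>C g) = c * cinner f g"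
  by (metis cinner_scaleC_left cinner_commute complex_cnj_cnj complex_cnj_mult)

lemma cinner_self: "cinner f f = complex_of_real (Re (cinner f f))"
proof -
  have "Im (cinner f f) = 0"
    using arg_cong[OF cinner_commute[of f f], of Im] by simp
  then show ?thesis by (simp add: complex_eq_iff)
qed

lemma Re_cinner_self:
  assumes "square_integrable f"
  shows "(LINT x|lborel. cnj (f x) * f x) = complex_of_real (LINT x|lborel. (cmod (f x))\<^sup>2)"
proof -
  have "cnj (f x) * f x = complex_of_real ((cmod (f x))\<^sup>2)" for x
    by (metis complex_norm_square mult.commute)
  then show ?thesis by (simp only: integral_complex_of_real)
qed

lemma Re_cinner_ge_0: "0 \<le> Re (cinner f f)"
  by transfer (simp add: Re_cinner_self)

lemma Re_cinner_eq_0_iff: "Re (cinner f f) = 0 \<longleftrightarrow> f = 0"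
proof (transfer, goal_cases)
  case (1 f)
  then have f: "square_integrable f" by simp
  have "(LINT x|lborel. (cmod (f x))\<^sup>2) = 0 \<longleftrightarrow> (AE x in lborel. (cmod (f x))\<^sup>2 = 0)"
    by (rule integral_nonneg_eq_0_iff_AE) (use f in \<open>auto simp: square_integrable_def\<close>)
  with f show ?case by (simp add: Re_cinner_self) (simp add: square_integrable_def)
qed

instantiation L2 :: (euclidean_space) real_inner
begin

definition inner_L2 :: "'a L2 \<Rightarrow> 'a L2 \<Rightarrow> real" where
  "inner_L2 f g = Re (cinner f g)"

definition norm_L2 :: "'a L2 \<Rightarrow> real" where "norm_L2 f = sqrt (inner f f)"

definition sgn_L2 :: "'a L2 \<Rightarrow> 'a L2" where "sgn_L2 f = f /\<^sub>R norm f"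

definition dist_L2 :: "'a L2 \<Rightarrow> 'a L2 \<Rightarrow> real" where "dist_L2 f g = norm (f - g)"

definition uniformity_L2 :: "('a L2 \<times> 'a L2) filter" where
  "uniformity_L2 = (INF e\<in>{0<..}. principal {(f, g). dist f g < e})"

definition open_L2 :: "'a L2 set \<Rightarrow> bool" where
  "open_L2 U = (\<forall>f\<in>U. eventually (\<lambda>(f', g). f' = f \<longrightarrow> g \<in> U) uniformity)"

instance
proof
  fix f g h :: "'a L2" and r :: real
  show "dist f g = norm (f - g)" by (fact dist_L2_def)
  show "sgn f = f /\<^sub>R norm f" by (fact sgn_L2_def)
  show "inner f g = inner g f"
    using cinner_commute[of f g] by (simp add: inner_L2_def)
  show "inner (f + g) h = inner f h + inner g h"
    by (simp add: inner_L2_def cinner_add_left)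
  show "inner (r *\<^sub>R f) g = r * inner f g"
    by (simp add: inner_L2_def scaleR_L2_def cinner_scaleC_left)
  show "0 \<le> inner f f" by (simp add: inner_L2_def Re_cinner_ge_0)
  show "inner f f = 0 \<longleftrightarrow> f = 0" by (simp add: inner_L2_def Re_cinner_eq_0_iff)
  show "norm f = sqrt (inner f f)" by (fact norm_L2_def)
qed (simp_all add: uniformity_L2_def open_L2_def)

end

lemma cinner_norm: "cinner f f = complex_of_real ((norm f)\<^sup>2)"
  using cinner_self[of f] by (simp add: power2_norm_eq_inner inner_L2_def)

section \<open>Nonnegative operators, square roots and traces\<close>

definition orthonormal_basis :: "'a::euclidean_space L2 set \<Rightarrow> bool" where
  "orthonormal_basis B \<longleftrightarrow>
     (\<forall>e\<in>B. \<forall>e'\<in>B. cinner e e' = (if e = e' then 1 else 0)) \<and>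
     (\<forall>\<psi>. (\<forall>e\<in>B. cinner e \<psi> = 0) \<longrightarrow> \<psi> = 0)"

lemma orthonormal_basis_exists: "\<exists>B :: 'a::euclidean_space L2 set. orthonormal_basis B"
proof -
  define \<O> :: "'a L2 set set" where
    "\<O> = {B. \<forall>e\<in>B. \<forall>e'\<in>B. cinner e e' = (if e = e' then 1 else 0)}"
  have "\<forall>C\<in>chains \<O>. \<Union>C \<in> \<O>"
  proof
    fix C assume C: "C \<in> chains \<O>"
    show "\<Union>C \<in> \<O>" unfolding \<O>_def
    proof (clarify)
      fix e e' X Y assume "e \<in> X" "X \<in> C" "e' \<in> Y" "Y \<in> C"
      moreover have "X \<subseteq> Y \<or> Y \<subseteq> X" using C \<open>X \<in> C\<close> \<open>Y \<in> C\<close> by (auto dest: chainsD)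
      moreover have "X \<in> \<O>" "Y \<in> \<O>" using C \<open>X \<in> C\<close> \<open>Y \<in> C\<close> by (auto dest: chainsD2)
      ultimately show "cinner e e' = (if e = e' then 1 else 0)"
        unfolding \<O>_def by blast
    qed
  qed
  then obtain B where B: "B \<in> \<O>" and max: "\<And>X. X \<in> \<O> \<Longrightarrow> B \<subseteq> X \<Longrightarrow> X = B"
    by (meson Zorn_Lemma)
  have "\<psi> = 0" if orth: "\<forall>e\<in>B. cinner e \<psi> = 0" for \<psi>
  proof (rule ccontr)
    assume "\<psi> \<noteq> 0"
    define \<phi> where "\<phi> = complex_of_real (inverse (norm \<psi>)) *\<^sub>C \<psi>"
    have 1: "cinner \<phi> \<phi> = 1"
    proof -
      have "norm \<psi> \<noteq> 0" using \<open>\<psi> \<noteq> 0\<close> by simp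
      then have "inverse (norm \<psi>) * (inverse (norm \<psi>) * (norm \<psi>)\<^sup>2) = 1"
        using left_inverse[of "norm \<psi>"] unfolding power2_eq_square
        by (metis mult.assoc mult.left_commute mult_1)
      moreover have "cinner \<phi> \<phi> =
          complex_of_real (inverse (norm \<psi>) * (inverse (norm \<psi>) * (norm \<psi>)\<^sup>2))"
        unfolding \<phi>_def cinner_scaleC_left cinner_scaleC_right
        unfolding cinner_norm by simp
      ultimately show ?thesis by (simp only: of_real_1)
    qed
    have 2: "cinner e \<phi> = 0" "cinner \<phi> e = 0" if "e \<in> B" for e
      using orth that cinner_commute[of \<phi> e]
      by (auto simp: \<phi>_def cinner_scaleC_left cinner_scaleC_right)
    have "insert \<phi> B \<in> \<O>" using B 1 2 unfolding \<O>_def by auto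
    then have "\<phi> \<in> B" using max by blast
    then show False using 1 2(1)[of \<phi>] by simp
  qed
  moreover have "\<forall>e\<in>B. \<forall>e'\<in>B. cinner e e' = (if e = e' then 1 else 0)"
    using B unfolding \<O>_def by (rule CollectD)
  ultimately have "orthonormal_basis B" unfolding orthonormal_basis_def by (intro conjI allI impI)
  then show ?thesis by (rule exI)
qed

definition L2_basis :: "'a::euclidean_space L2 set" where
  "L2_basis = (SOME B. orthonormal_basis B)"

definition nonneg_operator :: "('a::euclidean_space L2 \<Rightarrow> 'a L2) \<Rightarrow> bool" where
  "nonneg_operator T \<longleftrightarrow>
     bounded_linear T \<and> (\<forall>c \<psi>. T (c *\<^sub>C \<psi>) = c *\<^sub>C T \<psi>) \<and>
     (\<forall>\<phi> \<psi>. cinner \<phi> (T \<psi>) = cinner (T \<phi>) \<psi>) \<and>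
     (\<forall>\<psi>. 0 \<le> Re (cinner \<psi> (T \<psi>)))"

text \<open>The trace of a nonnegative operator is an element of \<open>[0,\<infinity>]\<close> that does not depend on the
  orthonormal basis; the operator is of trace class iff it is finite.\<close>

definition op_trace :: "('a::euclidean_space L2 \<Rightarrow> 'a L2) \<Rightarrow> ennreal" where
  "op_trace T = (\<Sum>\<^sub>\<infinity>e\<in>L2_basis. ennreal (Re (cinner e (T e))))"

definition nonneg_trace_class :: "('a::euclidean_space L2 \<Rightarrow> 'a L2) \<Rightarrow> bool" where
  "nonneg_trace_class T \<longleftrightarrow> nonneg_operator T \<and> op_trace T < \<infinity>"

definition density_operator :: "('a::euclidean_space L2 \<Rightarrow> 'a L2) \<Rightarrow> bool" where
  "density_operator R \<longleftrightarrow> nonneg_trace_class R \<and> op_trace R = 1"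

text \<open>The nonnegative square root is unique, so the choice is immaterial.\<close>

definition op_sqrt :: "('a::euclidean_space L2 \<Rightarrow> 'a L2) \<Rightarrow> 'a L2 \<Rightarrow> 'a L2" where
  "op_sqrt T = (SOME S. nonneg_operator S \<and> S \<circ> S = T)"

section \<open>Unbounded operators and their traces against nonnegative operators\<close>

text \<open>Unbounded operators on \<open>L2\<close> are given by their graphs.\<close>

type_synonym 'a unbounded_operator = "('a L2 \<times> 'a L2) set"

text \<open>Multiplication by a real function, with its maximal domain.\<close>

lift_definition is_multiple :: "('a::euclidean_space \<Rightarrow> real) \<Rightarrow> 'a L2 \<Rightarrow> 'a L2 \<Rightarrow> bool"
  is "\<lambda>m f g. AE y in lborel. g y = complex_of_real (m y) * f y"
proof -
  fix m :: "'a \<Rightarrow> real" and f f' g g' :: "'a \<Rightarrow> complex"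
  assume "square_integrable f \<and> square_integrable f' \<and> (AE x in lborel. f x = f' x)"
    and "square_integrable g \<and> square_integrable g' \<and> (AE x in lborel. g x = g' x)"
  then have "AE y in lborel. f y = f' y \<and> g y = g' y" by auto
  then have "AE y in lborel. (g y = complex_of_real (m y) * f y) =
      (g' y = complex_of_real (m y) * f' y)"
    by eventually_elim auto
  then show "(AE y in lborel. g y = complex_of_real (m y) * f y) =
      (AE y in lborel. g' y = complex_of_real (m y) * f' y)"
    by (auto elim: AE_mp)
qed

definition mult_operator :: "('a::euclidean_space \<Rightarrow> real) \<Rightarrow> 'a unbounded_operator" where
  "mult_operator m = {(\<psi>, \<eta>). is_multiple m \<psi> \<eta>}"

text \<open>\<open>C\<^sup>1\<close> functions with compact support; \<open>D y v\<close> is the derivative at \<open>y\<close> in direction \<open>v\<close>.\<close>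

definition test_function :: "('a::euclidean_space \<Rightarrow> real) \<Rightarrow> ('a \<Rightarrow> 'a \<Rightarrow> real) \<Rightarrow> bool" where
  "test_function \<phi> D \<longleftrightarrow>
     (\<forall>y. (\<phi> has_derivative D y) (at y)) \<and> (\<forall>v. continuous_on UNIV (\<lambda>y. D y v)) \<and>
     (\<exists>K. compact K \<and> (\<forall>y. y \<notin> K \<longrightarrow> \<phi> y = 0))"

text \<open>\<open>weak_partial b \<psi> \<eta>\<close>: \<open>\<eta>\<close> is the weak (distributional) derivative of \<open>\<psi>\<close> in direction \<open>b\<close>.\<close>

lift_definition weak_partial :: "'a::euclidean_space \<Rightarrow> 'a L2 \<Rightarrow> 'a L2 \<Rightarrow> bool"
  is "\<lambda>b f g. \<forall>\<phi> D. test_function \<phi> D \<longrightarrow>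
        (LINT y|lborel. complex_of_real (D y b) * f y) =
        - (LINT y|lborel. complex_of_real (\<phi> y) * g y)"
proof -
  fix b :: 'a and f f' g g' :: "'a \<Rightarrow> complex"
  assume 1: "square_integrable f \<and> square_integrable f' \<and> (AE x in lborel. f x = f' x)"
    and 2: "square_integrable g \<and> square_integrable g' \<and> (AE x in lborel. g x = g' x)"
  have [measurable]: "f \<in> borel_measurable borel" "f' \<in> borel_measurable borel"
      "g \<in> borel_measurable borel" "g' \<in> borel_measurable borel"
    using 1 2 by (auto simp: square_integrable_def)
  have "(LINT y|lborel. complex_of_real (D y b) * f y) =
          (LINT y|lborel. complex_of_real (D y b) * f' y) \<and>
        (LINT y|lborel. complex_of_real (\<phi> y) * g y) =
          (LINT y|lborel. complex_of_real (\<phi> y) * g' y)" if "test_function \<phi> D" for \<phi> D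
  proof -
    have [measurable]: "(\<lambda>y. D y b) \<in> borel_measurable borel"
      using that by (auto simp: test_function_def intro: borel_measurable_continuous_onI)
    have "continuous_on UNIV \<phi>"
      using that has_derivative_continuous
      by (fastforce simp: test_function_def intro: continuous_at_imp_continuous_on)
    then have [measurable]: "\<phi> \<in> borel_measurable borel"
      by (rule borel_measurable_continuous_onI)
    show ?thesis
      using 1 2 by (intro conjI integral_cong_AE) auto
  qed
  then show "(\<forall>\<phi> D. test_function \<phi> D \<longrightarrow>
        (LINT y|lborel. complex_of_real (D y b) * f y) =
        - (LINT y|lborel. complex_of_real (\<phi> y) * g y)) =
     (\<forall>\<phi> D. test_function \<phi> D \<longrightarrow>
        (LINT y|lborel. complex_of_real (D y b) * f' y) =
        - (LINT y|lborel. complex_of_real (\<phi> y) * g' y))"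
    by auto
qed

text \<open>The self-adjoint operator \<open>s + i h \<partial>\<close>, where \<open>\<partial>\<close> is the partial derivative in direction \<open>b\<close>;
  its domain consists of all \<open>\<psi>\<close> whose weak derivative in direction \<open>b\<close> is in \<open>L2\<close>.\<close>

definition shifted_momentum :: "real \<Rightarrow> real \<Rightarrow> 'a::euclidean_space \<Rightarrow> 'a unbounded_operator" where
  "shifted_momentum h s b =
     {(\<psi>, complex_of_real s *\<^sub>C \<psi> + (\<i> * complex_of_real h) *\<^sub>C \<eta>) | \<psi> \<eta>. weak_partial b \<psi> \<eta>}"

text \<open>The quadratic form of \<open>A\<^sup>2\<close> for a self-adjoint operator \<open>A\<close>: it is \<open>\<parallel>A \<psi>\<parallel>\<^sup>2\<close> on the domain
  of \<open>A\<close> and \<open>\<infinity>\<close> elsewhere.\<close>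

definition square_form :: "'a::euclidean_space unbounded_operator \<Rightarrow> 'a L2 \<Rightarrow> ennreal" where
  "square_form A \<psi> = (INF \<eta>\<in>{\<eta>. (\<psi>, \<eta>) \<in> A}. ennreal ((norm \<eta>)\<^sup>2))"

text \<open>For a nonnegative self-adjoint operator \<open>A\<close> with quadratic form \<open>q\<close> (equal to \<open>\<infinity>\<close> off the
  form domain) and a nonnegative trace-class operator \<open>T\<close>, \<open>trace(A T)\<close> is understood as
  \<open>trace(T\<^sup>1\<^sup>/\<^sup>2 A T\<^sup>1\<^sup>/\<^sup>2)\<close> in \<open>[0,\<infinity>]\<close>.\<close>

definition form_trace ::
    "('a::euclidean_space L2 \<Rightarrow> ennreal) \<Rightarrow> ('a L2 \<Rightarrow> 'a L2) \<Rightarrow> ennreal" where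
  "form_trace q T = (\<Sum>\<^sub>\<infinity>e\<in>L2_basis. q (op_sqrt T e))"

text \<open>Quadratic form of the transport cost
  \<open>1/2 \<Sum>\<^sub>b ((x\<^sub>b - y\<^sub>b)\<^sup>2 + (\<xi>\<^sub>b + i h \<partial>\<^sub>b)\<^sup>2) = 1/2 (|x - y|\<^sup>2 + |\<xi> + i h \<nabla>|\<^sup>2)\<close>.\<close>

definition cost_form ::
    "real \<Rightarrow> 'a::euclidean_space \<Rightarrow> 'a \<Rightarrow> 'a L2 \<Rightarrow> ennreal" where
  "cost_form h x \<xi> \<psi> = ennreal (1 / 2) *
     (\<Sum>b\<in>Basis. square_form (mult_operator (\<lambda>y. x \<bullet> b - y \<bullet> b)) \<psi> +
                square_form (shifted_momentum h (\<xi> \<bullet> b) b) \<psi>)"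

text \<open>Quadratic form of the harmonic oscillator
  \<open>- h\<^sup>2 \<Delta> + |x|\<^sup>2 = \<Sum>\<^sub>b ((i h \<partial>\<^sub>b)\<^sup>2 + x\<^sub>b\<^sup>2)\<close>.\<close>

definition oscillator_form :: "real \<Rightarrow> 'a::euclidean_space L2 \<Rightarrow> ennreal" where
  "oscillator_form h \<psi> =
     (\<Sum>b\<in>Basis. square_form (shifted_momentum h 0 b) \<psi> +
                square_form (mult_operator (\<lambda>y. y \<bullet> b)) \<psi>)"

section \<open>Transport distances\<close>

definition ennreal_sqrt :: "ennreal \<Rightarrow> ennreal" where
  "ennreal_sqrt t = (if t = \<infinity> then \<infinity> else ennreal (sqrt (enn2real t)))"

definition probability_density :: "('b::euclidean_space \<Rightarrow> real) \<Rightarrow> bool" where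
  "probability_density p \<longleftrightarrow>
     p \<in> borel_measurable lborel \<and> (AE z in lborel. 0 \<le> p z) \<and>
     (\<integral>\<^sup>+ z. ennreal (p z) \<partial>lborel) = 1"

text \<open>Operator-valued functions are measurable and integrated in the weak sense, i.e. through their
  matrix elements. As the trace-class operators form a separable space and
  \<open>\<parallel>Q z\<parallel>\<^sub>1 = trace (Q z) = p z\<close> is integrable, this agrees with the Bochner notions for the trace
  norm. Phase-space points are pairs \<open>(x, \<xi>)\<close>.\<close>

definition qc_couplings ::
    "('a::euclidean_space \<times> 'a \<Rightarrow> real) \<Rightarrow> ('a L2 \<Rightarrow> 'a L2) \<Rightarrow> ('a \<times> 'a \<Rightarrow> 'a L2 \<Rightarrow> 'a L2) set" where
  "qc_couplings p R =
     {Q. (\<forall>\<phi> \<psi>. (\<lambda>z. cinner \<phi> (Q z \<psi>)) \<in> borel_measurable lborel) \<and>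
         (AE z in lborel. nonneg_trace_class (Q z)) \<and>
         (AE z in lborel. op_trace (Q z) = ennreal (p z)) \<and>
         (\<forall>\<phi> \<psi>. has_bochner_integral lborel (\<lambda>z. cinner \<phi> (Q z \<psi>)) (cinner \<phi> (R \<psi>)))}"

definition E_dist ::
    "real \<Rightarrow> ('a::euclidean_space \<times> 'a \<Rightarrow> real) \<Rightarrow> ('a L2 \<Rightarrow> 'a L2) \<Rightarrow> ennreal" where
  "E_dist h p R = ennreal_sqrt
     (INF Q\<in>qc_couplings p R. \<integral>\<^sup>+ (x, \<xi>). form_trace (cost_form h x \<xi>) (Q (x, \<xi>)) \<partial>lborel)"

definition transport_plans ::
    "'b::euclidean_space measure \<Rightarrow> 'b measure \<Rightarrow> ('b \<times> 'b) measure set" where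
  "transport_plans \<mu> \<nu> =
     {\<gamma>. prob_space \<gamma> \<and> sets \<gamma> = sets borel \<and> distr \<gamma> borel fst = \<mu> \<and> distr \<gamma> borel snd = \<nu>}"

definition dist_MK2 :: "'b::euclidean_space measure \<Rightarrow> 'b measure \<Rightarrow> ennreal" where
  "dist_MK2 \<mu> \<nu> = ennreal_sqrt
     (INF \<gamma>\<in>transport_plans \<mu> \<nu>. \<integral>\<^sup>+ (z, z'). ennreal ((norm (z - z'))\<^sup>2) \<partial>\<gamma>)"

end

theory Submission
  imports Defs
begin

text \<open>Suppose that a transport plan from \<open>f\<close> to \<open>g\<close> were carried by a map \<open>S\<close>, and let \<open>Q\<close> be a coupling of \<open>g\<close>
with \<open>R\<close>. Then \<open>P z = (f z / g (S z)) Q (S z)\<close> is a coupling of \<open>f\<close> with \<open>R\<close>: its trace is \<open>f z\<close>, and a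
change of variables turns its integral into that of \<open>Q\<close>. Its cost is estimated pointwise, because the
costs at two phase-space points satisfy, as quadratic forms and for every \<open>t > 0\<close>,
\<open>c z \<le> (1 + t) c z' + (1 + 1/t) \<bar>z - z'\<bar>\<^sup>2 / 2\<close> (\<open>cost_form_shift\<close>). Integration gives
\<open>E f R\<^sup>2 \<le> (1 + t) E g R\<^sup>2 + (1 + 1/t) MK\<^sup>2\<close>, and the best choice of \<open>t\<close> turns the right-hand side into
\<open>(E g R + MK)\<^sup>2\<close> (\<open>ennreal_sqrt_le_add\<close>).

For a general plan \<open>\<gamma>\<close>, phase space is cut into countably many cells of diameter at most \<open>\<delta>\<close>.
The part of \<open>\<gamma>\<close> that starts in cell \<open>i\<close> has a second marginal with a density \<open>w i\<close> relative to \<open>g\<close> (\<open>conditional_weights_exist\<close>), and on that cell one sets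
\<open>P z = (f z / m i) \<integral> w i x Q x dx\<close>, where \<open>m i\<close> is the mass of the cell. This amounts to replacing the
conditional law of the target given \<open>z\<close> by the one given the cell of \<open>z\<close>; it perturbs the squared
transport cost by at most \<open>\<delta>\<^sup>2\<close> once the factor \<open>1/2\<close> above has been spent on \<open>(a + b)\<^sup>2 \<le> 2 a\<^sup>2 + 2 b\<^sup>2\<close>
(\<open>coupling_transfer\<close>).

The analytic content is that \<open>trace (A\<^sup>2 T) = \<Sum>e. \<parallel>A T\<^sup>1\<^sup>/\<^sup>2 e\<parallel>\<^sup>2\<close>, defined through the square root of \<open>T\<close>,
behaves linearly in \<open>T\<close>, even under integrals. For a bounded operator \<open>C\<close> in place of \<open>A\<close> Parseval's
identity rewrites it as \<open>\<Sum>e. \<langle>C e, T (C e)\<rangle>\<close>, where \<open>T\<close> enters linearly (\<open>trace_sqrt_conjugation\<close>). The form of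
a closed operator is the increasing limit of forms \<open>\<parallel>C n \<psi>\<parallel>\<^sup>2\<close> with bounded \<open>C n\<close>, by Moreau's envelope
(\<open>square_form_approximation\<close>), so that monotone convergence carries the formula over
(\<open>form_trace_approximation\<close>). From it follow the measurability of \<open>z \<mapsto> trace (c z Q z)\<close> and the
inequality \<open>trace (c (\<integral> w Q)) \<le> \<integral> w trace (c Q)\<close>. All of this rests on the Hilbert space structure of \<open>L2\<close>:
completeness, a countable orthonormal basis, and square roots of bounded nonnegative operators.\<close>

section \<open>Functionals on subspaces of a Hilbert space\<close>

text \<open>The minimizing sequences of \<open>\<parallel>u\<parallel>\<^sup>2 - 2 l u\<close> over \<open>U\<close> are Cauchy by the parallelogram identity, and the first
variation at the limit \<open>\<eta>\<close> is the asserted equation. For a span \<open>U\<close> the statement yields the density of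
orthonormal expansions, and for a closed \<open>U\<close> orthogonal projections.\<close>

lemma riesz_on_subspace:
  fixes U :: "'h::{real_inner,complete_space} set" and l :: "'h \<Rightarrow> real"
  assumes U: "subspace U" and l: "bounded_linear l"
  obtains \<eta> where "\<eta> \<in> closure U" "\<And>u. u \<in> U \<Longrightarrow> inner \<eta> u = l u"
proof -
  interpret l: bounded_linear l by (fact l)
  define J where "J u = (norm u)\<^sup>2 - 2 * l u" for u
  define m where "m = Inf (J ` U)"
  obtain K where K: "\<And>u. \<bar>l u\<bar> \<le> norm u * K"
    using l.bounded by (auto simp: real_norm_def)
  have J_ge: "- K\<^sup>2 \<le> J u" for u
  proof -
    have "0 \<le> (norm u - K)\<^sup>2" by simp
    then show ?thesis using K[of u] by (simp add: J_def power2_diff abs_le_iff)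
  qed
  have m: "m \<le> J u" if "u \<in> U" for u
    unfolding m_def using that J_ge by (intro cINF_lower bdd_belowI2[of _ "-K\<^sup>2"]) auto
  have "\<exists>u\<in>U. J u < m + 1 / real (Suc n)" for n
    using cInf_lessD[of "J ` U" "m + 1 / real (Suc n)"] subspace_0[OF U] by (auto simp: m_def)
  then obtain u where uU: "\<And>n. u n \<in> U" and uJ: "\<And>n. J (u n) < m + 1 / real (Suc n)" by metis
  have mid: "(norm (v - w))\<^sup>2 = 2 * J v + 2 * J w - 4 * J ((1/2) *\<^sub>R (v + w))" for v w
    unfolding J_def power2_norm_eq_inner l.scaleR l.add
    by (simp add: inner_diff_left inner_diff_right inner_add_left inner_add_right
        inner_commute[of w v] algebra_simps)
  have near: "(norm (u i - u j))\<^sup>2 \<le> 2 / real (Suc i) + 2 / real (Suc j)" for i j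
    using mid[of "u i" "u j"] uJ[of i] uJ[of j] m[of "(1/2) *\<^sub>R (u i + u j)"] uU U
    by (simp add: subspace_add subspace_scale)
  have "Cauchy u"
  proof (rule metric_CauchyI)
    fix e :: real assume "e > 0"
    then obtain N where N: "inverse (real (Suc N)) < e\<^sup>2 / 4" using reals_Archimedean[of "e\<^sup>2 / 4"] by auto
    show "\<exists>M. \<forall>i\<ge>M. \<forall>j\<ge>M. dist (u i) (u j) < e"
    proof (intro exI allI impI)
      fix i j assume "N \<le> i" "N \<le> j"
      then have "1 / real (Suc i) \<le> inverse (real (Suc N))" "1 / real (Suc j) \<le> inverse (real (Suc N))"
        by (auto simp: field_simps)
      then have "(norm (u i - u j))\<^sup>2 < e\<^sup>2" using near[of i j] N by simp
      then show "dist (u i) (u j) < e" using \<open>e > 0\<close> by (simp add: dist_norm power2_less_imp_less)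
    qed
  qed
  then obtain \<eta> where lim: "u \<longlonglongrightarrow> \<eta>" by (auto simp: Cauchy_convergent_iff convergent_def)
  have "\<eta> \<in> closure U" using lim uU by (auto simp: closure_sequential)
  moreover have "inner \<eta> v = l v" if v: "v \<in> U" for v
  proof -
    define c where "c = inner \<eta> v - l v"
    have pos: "0 \<le> 2 * t * c + t\<^sup>2 * (norm v)\<^sup>2" for t
    proof -
      have "- (1 / real (Suc n)) \<le> 2 * t * (inner (u n) v - l v) + t\<^sup>2 * (norm v)\<^sup>2" for n
      proof -
        have "m \<le> J (u n + t *\<^sub>R v)" using uU v U by (intro m subspace_add subspace_scale)
        also have "\<dots> = J (u n) + 2 * t * (inner (u n) v - l v) + t\<^sup>2 * (norm v)\<^sup>2"
          unfolding J_def power2_norm_eq_inner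
          by (simp add: inner_add_left inner_add_right l.scaleR l.add inner_commute[of v "u n"]
              algebra_simps power2_eq_square)
        finally show ?thesis using uJ[of n] by linarith
      qed
      moreover have "(\<lambda>n. - (1 / real (Suc n))) \<longlonglongrightarrow> - 0"
        using LIMSEQ_inverse_real_of_nat by (intro tendsto_minus) (simp add: inverse_eq_divide)
      moreover have "(\<lambda>n. 2 * t * (inner (u n) v - l v) + t\<^sup>2 * (norm v)\<^sup>2)
          \<longlonglongrightarrow> 2 * t * c + t\<^sup>2 * (norm v)\<^sup>2"
        unfolding c_def by (intro tendsto_intros lim)
      ultimately have "- 0 \<le> 2 * t * c + t\<^sup>2 * (norm v)\<^sup>2"
        by (intro LIMSEQ_le[of "\<lambda>n. - (1 / real (Suc n))"]) auto
      then show ?thesis by simp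
    qed
    define N where "N = (norm v)\<^sup>2"
    have N: "0 \<le> N" by (simp add: N_def)
    \<comment> \<open>The minimum is at \<open>t = - c / N\<close>; the denominator \<open>N + 1\<close> also covers \<open>N = 0\<close>.\<close>
    define t where "t = - c / (N + 1)"
    have t: "t * (N + 1) = - c" using N by (simp add: t_def)
    have "0 \<le> (2 * t * c + t\<^sup>2 * N) * (N + 1)\<^sup>2" using pos unfolding N_def by simp
    also have "\<dots> = 2 * (t * (N + 1)) * c * (N + 1) + (t * (N + 1))\<^sup>2 * N"
      by (simp add: algebra_simps power2_eq_square)
    also have "\<dots> = - (c\<^sup>2 * (N + 2))" unfolding t by (simp add: algebra_simps power2_eq_square)
    finally have "c\<^sup>2 * (N + 2) \<le> 0" by simp
    then have "c\<^sup>2 \<le> 0" using N by (simp add: mult_le_0_iff)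
    then show ?thesis by (simp add: c_def)
  qed
  ultimately show thesis by (rule that)
qed

lemma riesz_representation:
  fixes l :: "'h::{real_inner,complete_space} \<Rightarrow> real"
  assumes "bounded_linear l"
  shows "\<exists>\<eta>. \<forall>u. inner \<eta> u = l u"
proof -
  obtain \<eta> where "\<And>u. u \<in> UNIV \<Longrightarrow> inner \<eta> u = l u"
    by (rule riesz_on_subspace[OF subspace_UNIV assms]) (rule that)
  then show ?thesis by (intro exI[of _ \<eta>]) simp
qed

section \<open>Completeness of \<open>L2\<close>\<close>

lemma square_integrable_rep_L2: "square_integrable (rep_L2 \<psi>)"
  using Quotient3_rep_reflp[OF Quotient3_L2, of \<psi>] by simp

lemma abs_rep_L2 [simp]: "abs_L2 (rep_L2 \<psi>) = \<psi>"
  by (rule Quotient3_abs_rep[OF Quotient3_L2])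

lemma rep_abs_L2: "square_integrable f \<Longrightarrow> AE x in lborel. rep_L2 (abs_L2 f) x = f x"
  using Quotient3_rep_abs[OF Quotient3_L2, of f] by auto

lemma measurable_rep_L2 [measurable]: "rep_L2 \<psi> \<in> borel_measurable borel"
  using square_integrable_rep_L2[of \<psi>] by (simp add: square_integrable_def)

lemma cinner_abs_L2:
  "square_integrable f \<Longrightarrow> square_integrable g \<Longrightarrow>
     cinner (abs_L2 f) (abs_L2 g) = (LINT x|lborel. cnj (f x) * g x)"
  by (simp add: cinner.abs_eq)

lemma norm_abs_L2:
  assumes "square_integrable f"
  shows "(norm (abs_L2 f))\<^sup>2 = (LINT x|lborel. (cmod (f x))\<^sup>2)"
  using assms cinner_norm[of "abs_L2 f"]
  by (simp add: cinner_abs_L2 Re_cinner_self flip: of_real_eq_iff[where 'a=complex])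

lemma rep_L2_minus: "AE x in lborel. rep_L2 (\<phi> - \<psi>) x = rep_L2 \<phi> x - rep_L2 \<psi> x"
proof -
  note si = square_integrable_rep_L2
  have 1: "square_integrable (\<lambda>x. rep_L2 \<phi> x + - rep_L2 \<psi> x)"
    using square_integrable_add[OF si[of \<phi>] square_integrable_scale[OF si[of \<psi>], of "-1"]] by simp
  have "- abs_L2 (rep_L2 \<psi>) = abs_L2 (\<lambda>x. - rep_L2 \<psi> x)"
    using si by (intro uminus_L2.abs_eq) auto
  moreover have "abs_L2 (rep_L2 \<phi>) + abs_L2 (\<lambda>x. - rep_L2 \<psi> x) =
      abs_L2 (\<lambda>x. rep_L2 \<phi> x + - rep_L2 \<psi> x)"
    using si square_integrable_scale[OF si[of \<psi>], of "-1"] by (intro plus_L2.abs_eq) auto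
  ultimately have "\<phi> - \<psi> = abs_L2 (\<lambda>x. rep_L2 \<phi> x + - rep_L2 \<psi> x)"
    unfolding minus_L2_def by simp
  then show ?thesis using rep_abs_L2[OF 1] by simp
qed

lemma rep_L2_plus: "AE x in lborel. rep_L2 (\<phi> + \<psi>) x = rep_L2 \<phi> x + rep_L2 \<psi> x"
  using rep_L2_minus[of "\<phi> + \<psi>" \<psi>] by eventually_elim (simp add: algebra_simps)

lemma rep_L2_scaleC: "AE x in lborel. rep_L2 (c *\<^sub>C \<psi>) x = c * rep_L2 \<psi> x"
proof -
  have "c *\<^sub>C abs_L2 (rep_L2 \<psi>) = abs_L2 (\<lambda>x. c * rep_L2 \<psi> x)"
    using square_integrable_rep_L2[of \<psi>] by (intro scaleC.abs_eq) auto
  then show ?thesis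
    using rep_abs_L2[OF square_integrable_scale[OF square_integrable_rep_L2[of \<psi>], of c]] by simp
qed

lemma rep_L2_zero: "AE x in lborel. rep_L2 0 x = 0"
  using rep_L2_minus[of 0 0] by eventually_elim simp

lemma norm_minus_abs_L2:
  assumes "square_integrable f"
  shows "ennreal ((norm (\<phi> - abs_L2 f))\<^sup>2) = (\<integral>\<^sup>+x. ennreal ((cmod (rep_L2 \<phi> x - f x))\<^sup>2) \<partial>lborel)"
proof -
  have "ennreal ((norm (\<phi> - abs_L2 f))\<^sup>2) =
      ennreal (LINT x|lborel. (cmod (rep_L2 (\<phi> - abs_L2 f) x))\<^sup>2)"
    using norm_abs_L2[OF square_integrable_rep_L2, of "\<phi> - abs_L2 f"] by simp
  also have "\<dots> = (\<integral>\<^sup>+x. ennreal ((cmod (rep_L2 (\<phi> - abs_L2 f) x))\<^sup>2) \<partial>lborel)"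
    using square_integrable_rep_L2[of "\<phi> - abs_L2 f"]
    by (intro nn_integral_eq_integral[symmetric]) (auto simp: square_integrable_def)
  also have "\<dots> = (\<integral>\<^sup>+x. ennreal ((cmod (rep_L2 \<phi> x - f x))\<^sup>2) \<partial>lborel)"
    by (intro nn_integral_cong_AE) (use rep_L2_minus[of \<phi> "abs_L2 f"] rep_abs_L2[OF assms] in eventually_elim, simp)
  finally show ?thesis .
qed

lemma norm_minus_L2:
  "ennreal ((norm (\<phi> - \<psi>))\<^sup>2) = (\<integral>\<^sup>+x. ennreal ((cmod (rep_L2 \<phi> x - rep_L2 \<psi> x))\<^sup>2) \<partial>lborel)"
  using norm_minus_abs_L2[OF square_integrable_rep_L2[of \<psi>], of \<phi>] by simp

lemma square_integrableI_nn:
  assumes [measurable]: "f \<in> borel_measurable borel"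
    and "(\<integral>\<^sup>+x. ennreal ((cmod (f x))\<^sup>2) \<partial>lborel) < \<infinity>"
  shows "square_integrable f"
  unfolding square_integrable_def
  by (intro conjI integrableI_bounded) (use assms in auto)

text \<open>Fatou's lemma, applied to \<open>\<bar>X n - X k\<bar>\<^sup>2\<close> as \<open>k \<rightarrow> \<infinity>\<close>, bounds the distance to the pointwise limit by
the Cauchy modulus.\<close>

lemma tendsto_abs_L2:
  fixes X :: "nat \<Rightarrow> 'a::euclidean_space L2"
  assumes "Cauchy X" and [measurable]: "f \<in> borel_measurable borel"
    and lim: "AE x in lborel. (\<lambda>n. rep_L2 (X n) x) \<longlonglongrightarrow> f x"
  shows "square_integrable f" "X \<longlonglongrightarrow> abs_L2 f"
proof -
  have *: "(\<integral>\<^sup>+x. ennreal ((cmod (rep_L2 (X n) x - f x))\<^sup>2) \<partial>lborel) \<le> ennreal (e\<^sup>2)"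
    if "\<And>k. k \<ge> n \<Longrightarrow> norm (X n - X k) \<le> e" for n e
  proof -
    have "(\<integral>\<^sup>+x. ennreal ((cmod (rep_L2 (X n) x - f x))\<^sup>2) \<partial>lborel) =
        (\<integral>\<^sup>+x. liminf (\<lambda>k. ennreal ((cmod (rep_L2 (X n) x - rep_L2 (X k) x))\<^sup>2)) \<partial>lborel)"
    proof (intro nn_integral_cong_AE, use lim in eventually_elim)
      case (elim x)
      then have "(\<lambda>k. ennreal ((cmod (rep_L2 (X n) x - rep_L2 (X k) x))\<^sup>2))
          \<longlonglongrightarrow> ennreal ((cmod (rep_L2 (X n) x - f x))\<^sup>2)"
        by (intro tendsto_intros tendsto_ennrealI)
      then show ?case by (intro lim_imp_Liminf[symmetric]) simp_all
    qed
    also have "\<dots> \<le> liminf (\<lambda>k. \<integral>\<^sup>+x. ennreal ((cmod (rep_L2 (X n) x - rep_L2 (X k) x))\<^sup>2) \<partial>lborel)"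
      by (intro nn_integral_liminf) measurable
    also have "\<dots> = liminf (\<lambda>k. ennreal ((norm (X n - X k))\<^sup>2))"
      by (simp only: norm_minus_L2)
    also have "\<dots> \<le> ennreal (e\<^sup>2)"
      by (rule Liminf_le)
         (auto intro!: eventually_sequentiallyI[of n] ennreal_leI power_mono that)
    finally show ?thesis .
  qed
  obtain N where N: "\<And>k. k \<ge> N \<Longrightarrow> norm (X N - X k) \<le> 1"
    using CauchyD[OF \<open>Cauchy X\<close>, of 1] by (metis order_refl less_imp_le zero_less_one)
  have "square_integrable (\<lambda>x. rep_L2 (X N) x - f x)"
    using *[OF N] by (intro square_integrableI_nn) (auto intro: le_less_trans)
  from square_integrable_add[OF square_integrable_rep_L2[of "X N"] square_integrable_scale[OF this, of "-1"]]
  show f: "square_integrable f" by simp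
  show "X \<longlonglongrightarrow> abs_L2 f"
  proof (rule LIMSEQ_I)
    fix r :: real assume "r > 0"
    then obtain M where M: "\<And>i j. i \<ge> M \<Longrightarrow> j \<ge> M \<Longrightarrow> norm (X i - X j) < r / 2"
      using CauchyD[OF \<open>Cauchy X\<close>, of "r / 2"] by auto
    have "norm (X n - abs_L2 f) < r" if "n \<ge> M" for n
    proof -
      have "ennreal ((norm (X n - abs_L2 f))\<^sup>2) \<le> ennreal ((r / 2)\<^sup>2)"
        unfolding norm_minus_abs_L2[OF f] using M that by (intro *) (auto intro!: less_imp_le)
      then have "norm (X n - abs_L2 f) \<le> r / 2"
        using \<open>r > 0\<close> by (simp add: ennreal_le_iff power2_le_iff_abs_le)
      then show ?thesis using \<open>r > 0\<close> by simp
    qed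
    then show "\<exists>no. \<forall>n\<ge>no. norm (X n - abs_L2 f) < r" by auto
  qed
qed

text \<open>The weights \<open>4^n\<close> are summable against the assumed bound \<open>(1/8)^n\<close> but force the increments at almost every point
to be \<open>O((1/2)^n)\<close>, hence summable.\<close>

lemma AE_Cauchy_rapid:
  fixes X :: "nat \<Rightarrow> 'a::euclidean_space L2"
  assumes X: "\<And>n. (norm (X (Suc n) - X n))\<^sup>2 \<le> (1/8)^n"
  shows "AE x in lborel. convergent (\<lambda>n. rep_L2 (X n) x)"
proof -
  have "(\<integral>\<^sup>+x. (\<Sum>n. ennreal (4^n * (cmod (rep_L2 (X (Suc n)) x - rep_L2 (X n) x))\<^sup>2)) \<partial>lborel) =
      (\<Sum>n. \<integral>\<^sup>+x. ennreal (4^n) * ennreal ((cmod (rep_L2 (X (Suc n)) x - rep_L2 (X n) x))\<^sup>2) \<partial>lborel)"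
    by (simp add: nn_integral_suminf ennreal_mult)
  also have "\<dots> = (\<Sum>n. ennreal (4^n) * ennreal ((norm (X (Suc n) - X n))\<^sup>2))"
    by (subst nn_integral_cmult) (simp_all add: norm_minus_L2)
  also have "\<dots> \<le> (\<Sum>n. ennreal ((1/2)^n))"
  proof (intro suminf_le)
    fix n
    have "4^n * (norm (X (Suc n) - X n))\<^sup>2 \<le> 4^n * (1/8)^n" by (intro mult_left_mono X) simp
    also have "\<dots> = (1/2)^n" by (simp flip: power_mult_distrib)
    finally show "ennreal (4^n) * ennreal ((norm (X (Suc n) - X n))\<^sup>2) \<le> ennreal ((1/2)^n)"
      by (simp flip: ennreal_mult)
  qed auto
  also have "\<dots> = ennreal (\<Sum>n. (1/2)^n)"
    by (intro suminf_ennreal2) (auto intro: summable_geometric)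
  finally have fin: "(\<integral>\<^sup>+x. (\<Sum>n. ennreal (4^n * (cmod (rep_L2 (X (Suc n)) x - rep_L2 (X n) x))\<^sup>2)) \<partial>lborel) \<noteq> \<infinity>"
    by (auto simp: top_unique)
  have "AE x in lborel. (\<Sum>n. ennreal (4^n * (cmod (rep_L2 (X (Suc n)) x - rep_L2 (X n) x))\<^sup>2)) \<noteq> \<infinity>"
    by (rule nn_integral_PInf_AE[OF _ fin]) measurable
  then show ?thesis
  proof eventually_elim
    case (elim x)
    define d where "d n = rep_L2 (X (Suc n)) x - rep_L2 (X n) x" for n
    have "summable (\<lambda>n. 4^n * (cmod (d n))\<^sup>2)"
      using elim unfolding d_def by (intro summable_suminf_not_top) auto
    from summable_imp_Bseq[OF this] obtain K where K: "K > 0" "\<And>n. 4^n * (cmod (d n))\<^sup>2 \<le> K"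
      by (auto simp: Bseq_def)
    have "norm (d n) \<le> sqrt K * (1/2)^n" for n
    proof -
      have "(2^n * cmod (d n))\<^sup>2 \<le> (sqrt K)\<^sup>2"
        using K(1) K(2)[of n] by (simp add: power_mult_distrib power_even_eq[symmetric] power_mult[symmetric] mult.commute[of n] power_mult)
      then have "2^n * cmod (d n) \<le> sqrt K" by (rule power2_le_imp_le) (use K(1) in simp)
      then show ?thesis by (simp add: field_simps power_divide)
    qed
    then have "summable d"
      by (intro summable_comparison_test'[of "\<lambda>n. sqrt K * (1/2)^n" 0 d])
         (auto intro!: summable_mult summable_geometric)
    then have "convergent (\<lambda>n. rep_L2 (X 0) x + (\<Sum>i<n. d i))"
      by (intro convergent_add convergent_const) (simp add: summable_iff_convergent)
    moreover have "rep_L2 (X 0) x + (\<Sum>i<n. d i) = rep_L2 (X n) x" for n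
      unfolding d_def by (subst sum_lessThan_telescope) simp
    ultimately show ?case by simp
  qed
qed

lemma Cauchy_rapid_subseq:
  fixes X :: "nat \<Rightarrow> 'a::real_normed_vector"
  assumes "Cauchy X" and e: "\<And>n. e n > 0"
  obtains r where "strict_mono r" "\<And>n. norm (X (r (Suc n)) - X (r n)) < e n"
proof -
  have "\<forall>n. \<exists>N. \<forall>i\<ge>N. \<forall>j\<ge>N. norm (X i - X j) < e n" using CauchyD[OF assms(1)] e by blast
  then obtain N where N: "\<And>n i j. i \<ge> N n \<Longrightarrow> j \<ge> N n \<Longrightarrow> norm (X i - X j) < e n" by metis
  define r where "r n = n + (\<Sum>i\<le>n. N i)" for n
  have "strict_mono r" by (rule strict_monoI_Suc) (simp add: r_def)
  moreover have "N n \<le> r n" for n by (simp add: r_def member_le_sum trans_le_add2)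
  moreover have "N n \<le> r (Suc n)" for n
    using \<open>N n \<le> r n\<close> strict_monoD[OF \<open>strict_mono r\<close>, of n "Suc n"] by simp
  ultimately show thesis by (intro that[of r] N)
qed

lemma L2_Cauchy_AE_subseq:
  fixes X :: "nat \<Rightarrow> 'a::euclidean_space L2"
  assumes "Cauchy X"
  obtains r f where "strict_mono r" "f \<in> borel_measurable borel"
    "AE x in lborel. (\<lambda>n. rep_L2 (X (r n)) x) \<longlonglongrightarrow> f x"
    "square_integrable f" "X \<longlonglongrightarrow> abs_L2 f"
proof -
  obtain r where r: "strict_mono r"
    and small: "\<And>n. norm (X (r (Suc n)) - X (r n)) < sqrt ((1/8)^n)"
    using Cauchy_rapid_subseq[OF assms, of "\<lambda>n. sqrt ((1/8)^n)"] by auto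
  have "(norm (X (r (Suc n)) - X (r n)))\<^sup>2 \<le> (1/8)^n" for n
    using power_mono[OF less_imp_le[OF small[of n]], of 2] by simp
  from AE_Cauchy_rapid[of "X \<circ> r", unfolded o_def, OF this]
  have conv: "AE x in lborel. convergent (\<lambda>n. rep_L2 (X (r n)) x)" .
  define f where "f x = lim (\<lambda>n. rep_L2 (X (r n)) x)" for x
  have f: "f \<in> borel_measurable borel" unfolding f_def by (rule borel_measurable_lim_metric) simp
  have lim: "AE x in lborel. (\<lambda>n. rep_L2 (X (r n)) x) \<longlonglongrightarrow> f x"
    using conv by eventually_elim (simp add: f_def convergent_LIMSEQ_iff)
  have C: "Cauchy (X \<circ> r)" by (rule Cauchy_subseq_Cauchy[OF assms r])
  note t = tendsto_abs_L2[OF C f, unfolded o_def, OF lim]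
  have "X \<longlonglongrightarrow> abs_L2 f"
    by (rule Cauchy_converges_subseq[OF assms r]) (simp add: o_def t(2))
  with r f lim t(1) show thesis by (rule that)
qed

instance L2 :: (euclidean_space) complete_space
  by standard (auto elim!: L2_Cauchy_AE_subseq simp: convergent_def)

instance L2 :: (euclidean_space) banach ..

text \<open>The passage to an almost everywhere convergent subsequence is what makes multiplication operators closed.\<close>

lemma L2_tendsto_AE_subseq:
  fixes X :: "nat \<Rightarrow> 'a::euclidean_space L2"
  assumes "X \<longlonglongrightarrow> \<psi>"
  obtains r where "strict_mono r" "AE x in lborel. (\<lambda>n. rep_L2 (X (r n)) x) \<longlonglongrightarrow> rep_L2 \<psi> x"
proof -
  obtain r f where r: "strict_mono r" and "f \<in> borel_measurable borel"
    and lim: "AE x in lborel. (\<lambda>n. rep_L2 (X (r n)) x) \<longlonglongrightarrow> f x"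
    and f: "square_integrable f" "X \<longlonglongrightarrow> abs_L2 f"
    by (rule L2_Cauchy_AE_subseq[OF LIMSEQ_imp_Cauchy[OF assms]])
  have \<psi>: "\<psi> = abs_L2 f" using LIMSEQ_unique[OF assms f(2)] .
  have "AE x in lborel. (\<lambda>n. rep_L2 (X (r n)) x) \<longlonglongrightarrow> rep_L2 \<psi> x"
    unfolding \<psi> using lim rep_abs_L2[OF f(1)] by eventually_elim simp
  with r show thesis by (rule that)
qed

section \<open>Orthonormal bases: Parseval and countability\<close>

lemma cinner_zero_right [simp]: "cinner \<phi> 0 = 0"
  using cinner_add_right[of \<phi> 0 0] by simp

lemma cinner_zero_left [simp]: "cinner 0 \<phi> = 0"
  using cinner_commute[of 0 \<phi>] by simp

lemma cinner_scaleR_right [simp]: "cinner \<phi> (r *\<^sub>R \<psi>) = r *\<^sub>R cinner \<phi> \<psi>"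
  by (simp add: scaleR_L2_def cinner_scaleC_right scaleR_conv_of_real)

lemma cinner_scaleR_left [simp]: "cinner (r *\<^sub>R \<phi>) \<psi> = r *\<^sub>R cinner \<phi> \<psi>"
  by (simp add: scaleR_L2_def cinner_scaleC_left scaleR_conv_of_real)

lemma cinner_diff_right: "cinner \<phi> (\<psi> - \<eta>) = cinner \<phi> \<psi> - cinner \<phi> \<eta>"
  using cinner_add_right[of \<phi> "\<psi> - \<eta>" \<eta>] by simp

lemma cinner_diff_left: "cinner (\<psi> - \<eta>) \<phi> = cinner \<psi> \<phi> - cinner \<eta> \<phi>"
  using cinner_add_left[of "\<psi> - \<eta>" \<eta> \<phi>] by simp

lemma cinner_sum_right: "cinner \<phi> (\<Sum>i\<in>I. f i) = (\<Sum>i\<in>I. cinner \<phi> (f i))"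
  by (induction I rule: infinite_finite_induct) (auto simp: cinner_add_right)

lemma cinner_sum_left: "cinner (\<Sum>i\<in>I. f i) \<phi> = (\<Sum>i\<in>I. cinner (f i) \<phi>)"
  by (induction I rule: infinite_finite_induct) (auto simp: cinner_add_left)

lemma Re_cinner: "Re (cinner \<phi> \<psi>) = inner \<phi> \<psi>"
  by (simp add: inner_L2_def)

lemma Im_cinner: "Im (cinner \<phi> \<psi>) = inner (\<i> *\<^sub>C \<phi>) \<psi>"
  by (simp add: inner_L2_def cinner_scaleC_left)

lemma norm_scaleC [simp]: "norm (c *\<^sub>C \<psi>) = cmod c * norm (\<psi> :: 'a::euclidean_space L2)"
proof -
  have "complex_of_real ((norm (c *\<^sub>C \<psi>))\<^sup>2) = complex_of_real ((cmod c * norm \<psi>)\<^sup>2)"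
    unfolding cinner_norm[symmetric] cinner_scaleC_left cinner_scaleC_right
    unfolding cinner_norm using complex_norm_square[of c] by (simp add: power_mult_distrib mult_ac)
  then show ?thesis by (simp only: of_real_eq_iff power2_eq_iff_nonneg norm_ge_zero mult_nonneg_nonneg)
qed

lemma cinner_bound: "cmod (cinner \<phi> \<psi>) \<le> norm \<phi> * norm \<psi>"
proof (cases "cinner \<phi> \<psi> = 0")
  case False
  define c where "c = sgn (cinner \<phi> \<psi>)"
  have "cmod (cinner \<phi> \<psi>) = Re (cinner (c *\<^sub>C \<phi>) \<psi>)"
  proof -
    have "cnj c * cinner \<phi> \<psi> = complex_of_real (cmod (cinner \<phi> \<psi>))"
      using False complex_norm_square[of "cinner \<phi> \<psi>"]
      by (simp add: c_def sgn_eq mult.commute[of "cnj _"] divide_eq_eq power2_eq_square)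
    then show ?thesis by (simp add: cinner_scaleC_left)
  qed
  also have "\<dots> \<le> norm (c *\<^sub>C \<phi>) * norm \<psi>"
    unfolding Re_cinner by (rule norm_cauchy_schwarz)
  also have "\<dots> = norm \<phi> * norm \<psi>" using False by (simp add: c_def norm_sgn)
  finally show ?thesis .
qed simp

lemma bounded_bilinear_cinner: "bounded_bilinear cinner"
  by standard (auto simp: cinner_add_left cinner_add_right intro!: exI[of _ 1] cinner_bound)

lemmas tendsto_cinner [tendsto_intros] = bounded_bilinear.tendsto[OF bounded_bilinear_cinner]

lemma cinner_ext: "(\<And>\<zeta>. cinner \<zeta> \<phi> = cinner \<zeta> \<psi>) \<Longrightarrow> \<phi> = \<psi>"
  using cinner_norm[of "\<phi> - \<psi>"] by (simp add: cinner_diff_right)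

lemma scaleC_add_left: "(c + d) *\<^sub>C \<psi> = c *\<^sub>C \<psi> + d *\<^sub>C \<psi>"
  by (rule cinner_ext) (simp add: cinner_scaleC_right cinner_add_right distrib_right)

lemma scaleC_scaleC: "c *\<^sub>C d *\<^sub>C \<psi> = (c * d) *\<^sub>C \<psi>"
  by (rule cinner_ext) (simp add: cinner_scaleC_right)

lemma scaleC_one: "1 *\<^sub>C \<psi> = \<psi>"
  by (rule cinner_ext) (simp add: cinner_scaleC_right)

lemma scaleC_zero_right: "c *\<^sub>C 0 = 0"
  by (rule cinner_ext) (simp add: cinner_scaleC_right)

lemma scaleC_add_right: "c *\<^sub>C (\<phi> + \<psi>) = c *\<^sub>C \<phi> + c *\<^sub>C \<psi>"
  by (rule cinner_ext) (simp add: cinner_scaleC_right cinner_add_right distrib_left)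

lemma bounded_linear_scaleC: "bounded_linear ((*\<^sub>C) c :: 'a::euclidean_space L2 \<Rightarrow> 'a L2)"
proof (rule bounded_linear_intro)
  show "norm (c *\<^sub>C \<psi>) \<le> norm \<psi> * cmod c" for \<psi> :: "'a L2" by simp
qed (simp_all add: scaleC_add_right scaleR_L2_def scaleC_scaleC mult.commute)

lemmas tendsto_scaleC = bounded_linear.tendsto[OF bounded_linear_scaleC]

lemma orthonormal_L2_basis: "orthonormal_basis L2_basis"
  unfolding L2_basis_def by (rule someI_ex[OF orthonormal_basis_exists])

lemma basis_orthonormal:
  "e \<in> L2_basis \<Longrightarrow> e' \<in> L2_basis \<Longrightarrow> cinner e e' = (if e = e' then 1 else 0)"
  using orthonormal_L2_basis unfolding orthonormal_basis_def by blast

lemma basis_total: "(\<And>e. e \<in> L2_basis \<Longrightarrow> cinner e \<psi> = 0) \<Longrightarrow> \<psi> = 0"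
  using orthonormal_L2_basis unfolding orthonormal_basis_def by blast

lemma dist_basis_combination:
  fixes \<psi> :: "'a::euclidean_space L2"
  assumes F: "finite F" "F \<subseteq> L2_basis"
  shows "(norm (\<psi> - (\<Sum>e\<in>F. d e *\<^sub>C e)))\<^sup>2 =
    (norm \<psi>)\<^sup>2 - (\<Sum>e\<in>F. (cmod (cinner e \<psi>))\<^sup>2) + (\<Sum>e\<in>F. (cmod (cinner e \<psi> - d e))\<^sup>2)"
proof -
  define p where "p = (\<Sum>e\<in>F. d e *\<^sub>C e)"
  have ep: "cinner e p = d e" if "e \<in> F" for e
  proof -
    have "cinner e p = (\<Sum>e'\<in>F. d e' * cinner e e')"
      by (simp add: p_def cinner_sum_right cinner_scaleC_right)
    also have "\<dots> = (\<Sum>e'\<in>F. if e = e' then d e' else 0)"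
      using F that by (intro sum.cong) (auto simp: basis_orthonormal subset_iff)
    finally show ?thesis using F that by (simp add: sum.delta)
  qed
  have p_left: "cinner p \<zeta> = (\<Sum>e\<in>F. cnj (d e) * cinner e \<zeta>)" for \<zeta>
    by (simp add: p_def cinner_sum_left cinner_scaleC_left)
  have "(norm p)\<^sup>2 = Re (cinner p p)" by (simp add: cinner_norm)
  also have "\<dots> = (\<Sum>e\<in>F. (cmod (d e))\<^sup>2)"
    unfolding p_left Re_sum by (intro sum.cong) (auto simp: ep cmod_def power2_eq_square)
  finally have pp: "(norm p)\<^sup>2 = (\<Sum>e\<in>F. (cmod (d e))\<^sup>2)" .
  have "(norm (\<psi> - p))\<^sup>2 = (norm \<psi>)\<^sup>2 - 2 * inner p \<psi> + (norm p)\<^sup>2"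
    by (simp add: power2_norm_eq_inner inner_diff_left inner_diff_right inner_commute)
  also have "inner p \<psi> = (\<Sum>e\<in>F. Re (cnj (d e) * cinner e \<psi>))"
    by (simp only: Re_cinner[symmetric] p_left Re_sum)
  finally have "(norm (\<psi> - p))\<^sup>2 = (norm \<psi>)\<^sup>2 + (\<Sum>e\<in>F. (cmod (d e))\<^sup>2 - 2 * Re (cnj (d e) * cinner e \<psi>))"
    unfolding pp by (simp add: sum_subtractf sum_distrib_left)
  also have "(\<Sum>e\<in>F. (cmod (d e))\<^sup>2 - 2 * Re (cnj (d e) * cinner e \<psi>)) =
      (\<Sum>e\<in>F. (cmod (cinner e \<psi> - d e))\<^sup>2 - (cmod (cinner e \<psi>))\<^sup>2)"
    by (intro sum.cong refl, unfold cmod_power2) (auto simp: power2_eq_square algebra_simps)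
  finally show ?thesis unfolding p_def by (simp add: sum_subtractf)
qed

lemma bessel:
  assumes "finite F" "F \<subseteq> L2_basis"
  shows "(\<Sum>e\<in>F. (cmod (cinner e \<psi>))\<^sup>2) \<le> (norm \<psi>)\<^sup>2"
proof -
  have "0 \<le> (norm \<psi>)\<^sup>2 - (\<Sum>e\<in>F. (cmod (cinner e \<psi>))\<^sup>2)"
    using dist_basis_combination[OF assms, of \<psi> "\<lambda>e. cinner e \<psi>"]
      zero_le_power2[of "norm (\<psi> - (\<Sum>e\<in>F. cinner e \<psi> *\<^sub>C e))"] by simp
  then show ?thesis by simp
qed

text \<open>The representative of \<open>inner \<psi>\<close> on the span of the basis differs from \<open>\<psi>\<close> by a vector orthogonal to
the basis, hence equals \<open>\<psi>\<close>, and it lies in the closure of the span.\<close>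

lemma basis_dense:
  fixes \<psi> :: "'a::euclidean_space L2"
  assumes "r > 0"
  obtains F d where "finite F" "F \<subseteq> L2_basis" "norm (\<psi> - (\<Sum>e\<in>F. d e *\<^sub>C e)) < r"
proof -
  define U where "U = {\<Sum>e\<in>F. d e *\<^sub>C e | F d. finite F \<and> F \<subseteq> (L2_basis :: 'a L2 set)}"
  have UI: "(\<Sum>e\<in>F. d e *\<^sub>C e) \<in> U" if "finite F" "F \<subseteq> L2_basis" for F d
    using that by (auto simp: U_def)
  have scale: "c *\<^sub>C u \<in> U" if u': "u \<in> U" for c u
  proof -
    obtain F d where F: "finite F" "F \<subseteq> L2_basis" and u: "u = (\<Sum>e\<in>F. d e *\<^sub>C e)"
      using u' by (auto simp: U_def)
    have "c *\<^sub>C u = (\<Sum>e\<in>F. (c * d e) *\<^sub>C e)"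
      unfolding u by (rule cinner_ext) (simp add: cinner_scaleC_right cinner_sum_right sum_distrib_left mult.assoc)
    then show ?thesis using UI[OF F] by simp
  qed
  have add: "u + v \<in> U" if uv: "u \<in> U" "v \<in> U" for u v
  proof -
    obtain F d G k where F: "finite F" "F \<subseteq> L2_basis" and u: "u = (\<Sum>e\<in>F. d e *\<^sub>C e)"
      and G: "finite G" "G \<subseteq> L2_basis" and v: "v = (\<Sum>e\<in>G. k e *\<^sub>C e)"
      using uv by (auto simp: U_def)
    define d' where "d' e = (if e \<in> F then d e else 0)" for e
    define k' where "k' e = (if e \<in> G then k e else 0)" for e
    have z: "0 *\<^sub>C e = 0" for e :: "'a L2" by (rule cinner_ext) (simp add: cinner_scaleC_right)
    have "u = (\<Sum>e\<in>F \<union> G. d' e *\<^sub>C e)" "v = (\<Sum>e\<in>F \<union> G. k' e *\<^sub>C e)"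
      unfolding u v d'_def k'_def using F G by (auto intro!: sum.mono_neutral_cong_left simp: z)
    moreover have "(d' e + k' e) *\<^sub>C e = d' e *\<^sub>C e + k' e *\<^sub>C e" for e
      by (rule cinner_ext) (simp add: cinner_scaleC_right cinner_add_right distrib_right)
    ultimately have "u + v = (\<Sum>e\<in>F \<union> G. (d' e + k' e) *\<^sub>C e)"
      by (simp add: sum.distrib)
    then show ?thesis using UI[of "F \<union> G"] F G by simp
  qed
  have "subspace U"
    unfolding subspace_def using UI[of "{}"] add scale by (auto simp: scaleR_L2_def)
  from riesz_on_subspace[OF this bounded_linear_inner_right[of \<psi>]]
  obtain \<eta> where \<eta>: "\<eta> \<in> closure U" and eq: "\<And>u. u \<in> U \<Longrightarrow> inner \<eta> u = inner \<psi> u"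
    by blast
  have "\<psi> - \<eta> = 0"
  proof (rule basis_total)
    fix e :: "'a L2" assume "e \<in> L2_basis"
    then have "c *\<^sub>C e \<in> U" for c using UI[of "{e}" "\<lambda>_. c"] by simp
    then have 0: "inner (c *\<^sub>C e) (\<psi> - \<eta>) = 0" for c using eq[of "c *\<^sub>C e"] by (simp add: inner_diff_right inner_commute)
    have "Re (cinner e (\<psi> - \<eta>)) = 0" using 0[of 1] by (simp add: inner_L2_def cinner_scaleC_left)
    moreover have "Im (cinner e (\<psi> - \<eta>)) = 0" using 0[of \<i>] by (simp add: Im_cinner)
    ultimately show "cinner e (\<psi> - \<eta>) = 0" by (simp add: complex_eq_iff)
  qed
  then have "\<psi> \<in> closure U" using \<eta> by simp
  then obtain u where "u \<in> U" "dist u \<psi> < r" using assms by (auto simp: closure_approachable)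
  then show thesis using that by (auto simp: U_def dist_norm norm_minus_commute)
qed

text \<open>Bessel's inequality is one half. For the other, the coefficients \<open>cinner e \<psi>\<close> give the best approximation of \<open>\<psi>\<close>
by combinations of finitely many basis vectors, and these are dense.\<close>

theorem parseval: "(\<Sum>\<^sub>\<infinity>e\<in>L2_basis. ennreal ((cmod (cinner e \<psi>))\<^sup>2)) = ennreal ((norm \<psi>)\<^sup>2)"
proof -
  let ?S = "SUP F\<in>{F. finite F \<and> F \<subseteq> L2_basis}. \<Sum>e\<in>F. ennreal ((cmod (cinner e \<psi>))\<^sup>2)"
  have "?S \<le> ennreal ((norm \<psi>)\<^sup>2)"
    by (intro SUP_least) (auto simp: sum_ennreal intro!: ennreal_leI bessel)
  moreover have "ennreal ((norm \<psi>)\<^sup>2) \<le> ?S"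
  proof (rule ennreal_le_epsilon)
    fix r :: real assume "r > 0"
    then obtain F d where F: "finite F" "F \<subseteq> L2_basis"
      and near: "norm (\<psi> - (\<Sum>e\<in>F. d e *\<^sub>C e)) < sqrt r"
      using basis_dense[of "sqrt r" \<psi>] by auto
    have "(norm \<psi>)\<^sup>2 - (\<Sum>e\<in>F. (cmod (cinner e \<psi>))\<^sup>2) \<le> (norm (\<psi> - (\<Sum>e\<in>F. d e *\<^sub>C e)))\<^sup>2"
      unfolding dist_basis_combination[OF F] by (simp add: sum_nonneg)
    also have "\<dots> \<le> (sqrt r)\<^sup>2" using near by (intro power_mono) auto
    finally have "(norm \<psi>)\<^sup>2 \<le> (\<Sum>e\<in>F. (cmod (cinner e \<psi>))\<^sup>2) + r" using \<open>r > 0\<close> by simp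
    then have "ennreal ((norm \<psi>)\<^sup>2) \<le> (\<Sum>e\<in>F. ennreal ((cmod (cinner e \<psi>))\<^sup>2)) + ennreal r"
      using \<open>r > 0\<close> by (simp add: sum_ennreal sum_nonneg flip: ennreal_plus)
    also have "\<dots> \<le> ?S + ennreal r" using F by (intro add_right_mono SUP_upper) auto
    finally show "ennreal ((norm \<psi>)\<^sup>2) \<le> ?S + ennreal r" .
  qed
  ultimately show ?thesis by (simp add: nonneg_infsum_complete antisym)
qed

text \<open>The positive and negative parts of \<open>u\<close> define two measures that agree on a generating \<open>\<pi>\<close>-system.\<close>

lemma AE_zero_if_integrals_zero:
  fixes u :: "'a::euclidean_space \<Rightarrow> real"
  assumes D: "Int_stable D" "sets borel = sigma_sets UNIV D" "\<And>A. A \<in> D \<Longrightarrow> A \<in> sets borel"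
    and A: "range A \<subseteq> D" "(\<Union>i::nat. A i) = UNIV"
    and [measurable]: "u \<in> borel_measurable borel"
    and int: "\<And>X. X \<in> D \<Longrightarrow> integrable lborel (\<lambda>x. indicator X x * u x)"
    and zero: "\<And>X. X \<in> D \<Longrightarrow> (LINT x|lborel. indicator X x * u x) = 0"
  shows "AE x in lborel. u x = 0"
proof -
  let ?P = "density lborel (\<lambda>x. ennreal (u x))" and ?N = "density lborel (\<lambda>x. ennreal (- u x))"
  have eq: "emeasure ?P X = emeasure ?N X \<and> emeasure ?P X \<noteq> \<infinity>" if "X \<in> D" for X
  proof -
    have X [measurable]: "X \<in> sets borel" using D that by auto
    have P: "emeasure ?P X = (\<integral>\<^sup>+x. ennreal (indicator X x * u x) \<partial>lborel)"
      by (subst emeasure_density) (auto intro!: nn_integral_cong split: split_indicator)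
    have N: "emeasure ?N X = (\<integral>\<^sup>+x. ennreal (- (indicator X x * u x)) \<partial>lborel)"
      by (subst emeasure_density) (auto intro!: nn_integral_cong split: split_indicator)
    have fin: "(\<integral>\<^sup>+x. ennreal (indicator X x * u x) \<partial>lborel) \<noteq> \<infinity>"
        "(\<integral>\<^sup>+x. ennreal (- (indicator X x * u x)) \<partial>lborel) \<noteq> \<infinity>"
      using int[OF that] by (auto simp: real_integrable_def)
    have "enn2real (\<integral>\<^sup>+x. ennreal (indicator X x * u x) \<partial>lborel) =
        enn2real (\<integral>\<^sup>+x. ennreal (- (indicator X x * u x)) \<partial>lborel)"
      using zero[OF that] real_lebesgue_integral_def[OF int[OF that]] by simp
    then show ?thesis unfolding P N using fin by (metis ennreal_enn2real_if infinity_ennreal_def)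
  qed
  have "?P = ?N"
  proof (rule measure_eqI_generator_eq[OF D(1) _ _ _ _ A])
    show "emeasure ?P (A i) \<noteq> \<infinity>" for i using eq[of "A i"] A(1) by auto
    show "emeasure ?P X = emeasure ?N X" if "X \<in> D" for X using eq[OF that] by blast
  qed (use D(2) in auto)
  then have "AE x in lborel. ennreal (u x) = ennreal (- u x)"
    by (intro sigma_finite_measure.density_unique[OF sigma_finite_lborel]) auto
  then show ?thesis
  proof eventually_elim
    case (elim x)
    then show ?case by (cases "u x \<ge> 0") (auto simp: ennreal_neg ennreal_eq_0_iff)
  qed
qed

lemma square_integrable_indicator:
  assumes [measurable]: "X \<in> sets borel" and "emeasure lborel X < \<infinity>"
  shows "square_integrable (\<lambda>x. complex_of_real (indicator X x))"
proof (rule square_integrableI_nn)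
  have "(\<integral>\<^sup>+x. ennreal ((cmod (complex_of_real (indicator X x)))\<^sup>2) \<partial>lborel) = (\<integral>\<^sup>+x. indicator X x \<partial>lborel)"
    by (intro nn_integral_cong) (auto split: split_indicator)
  then show "(\<integral>\<^sup>+x. ennreal ((cmod (complex_of_real (indicator X x)))\<^sup>2) \<partial>lborel) < \<infinity>"
    using assms by simp
qed measurable

text \<open>The vectors are indicators of finite intersections of basic open sets, cut by balls to make their measure finite;
these sets form a countable \<open>\<pi>\<close>-system that generates the Borel sets.\<close>

lemma countable_total_L2:
  obtains D :: "'a::euclidean_space L2 set"
  where "countable D" "\<And>\<psi>. (\<And>\<phi>. \<phi> \<in> D \<Longrightarrow> cinner \<phi> \<psi> = 0) \<Longrightarrow> \<psi> = 0"
proof -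
  obtain B :: "'a set set" where B: "countable B" "topological_basis B"
    using ex_countable_basis by auto
  define S where "S = (\<lambda>(F, n::nat). \<Inter>F \<inter> ball (0::'a) (real n)) ` ({F. finite F \<and> F \<subseteq> B} \<times> UNIV)"
  have SI: "\<Inter>F \<inter> ball 0 (real n) \<in> S" if "finite F" "F \<subseteq> B" for F n
    using that by (auto simp: S_def)
  have S_countable: "countable S"
    unfolding S_def by (intro countable_image countable_SIGMA countable_Collect_finite_subset B(1)) auto
  have open_S: "open X" if "X \<in> S" for X
    using that topological_basis_open[OF B(2)] by (auto simp: S_def intro!: open_Int open_Inter)
  have fin: "emeasure lborel X < \<infinity>" if X': "X \<in> S" for X
  proof -
    obtain F n where X: "X = \<Inter>F \<inter> ball 0 (real n)" using X' by (auto simp: S_def)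
    have "emeasure lborel X \<le> emeasure lborel (ball (0::'a) (real n))"
      unfolding X by (intro emeasure_mono) auto
    also have "\<dots> < \<infinity>" using emeasure_lborel_ball_finite by simp
    finally show ?thesis .
  qed
  have stable: "Int_stable S"
  proof (rule Int_stableI)
    fix X Y assume "X \<in> S" "Y \<in> S"
    then obtain F n G m where F: "finite F" "F \<subseteq> B" "X = \<Inter>F \<inter> ball 0 (real n)"
      and G: "finite G" "G \<subseteq> B" "Y = \<Inter>G \<inter> ball 0 (real m)"
      by (auto simp: S_def)
    have "X \<inter> Y = \<Inter>(F \<union> G) \<inter> ball 0 (real (min n m))"
      using F G by auto
    then show "X \<inter> Y \<in> S" using F G SI[of "F \<union> G" "min n m"] by simp
  qed
  have balls: "(\<Union>n. ball (0::'a) (real n)) = UNIV"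
  proof -
    have "\<exists>n. x \<in> ball 0 (real n)" for x :: 'a using reals_Archimedean2[of "norm x"] by simp
    then show ?thesis by blast
  qed
  have gen: "sets borel = sigma_sets UNIV S"
  proof
    have "sets borel = sigma_sets UNIV B"
      unfolding borel_eq_countable_basis[OF B] by (rule sets_measure_of) simp
    also have "\<dots> \<subseteq> sigma_sets UNIV S"
    proof (rule sigma_sets_mono, rule subsetI)
      fix X assume "X \<in> B"
      have "(\<Union>n::nat. X \<inter> ball 0 (real n)) \<in> sigma_sets UNIV S"
        using SI[of "{X}"] \<open>X \<in> B\<close> by (intro sigma_sets.Union sigma_sets.Basic) simp
      also have "(\<Union>n::nat. X \<inter> ball 0 (real n)) = X" using balls by blast
      finally show "X \<in> sigma_sets UNIV S" .
    qed
    finally show "sets borel \<subseteq> sigma_sets UNIV S" .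
    show "sigma_sets UNIV S \<subseteq> sets borel"
      using open_S by (intro sets.sigma_sets_subset'[of _ borel, simplified]) auto
  qed
  show thesis
  proof (rule that)
    show "countable ((\<lambda>X. abs_L2 (\<lambda>x. complex_of_real (indicator X x))) ` S)"
      using S_countable by (rule countable_image)
    fix \<psi> :: "'a L2"
    assume orth: "\<And>\<phi>. \<phi> \<in> (\<lambda>X. abs_L2 (\<lambda>x. complex_of_real (indicator X x))) ` S \<Longrightarrow> cinner \<phi> \<psi> = 0"
    have *: "integrable lborel (\<lambda>x. complex_of_real (indicator X x) * rep_L2 \<psi> x)"
      "(LINT x|lborel. complex_of_real (indicator X x) * rep_L2 \<psi> x) = 0" if X: "X \<in> S" for X
    proof -
      have si: "square_integrable (\<lambda>x. complex_of_real (indicator X x))"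
        using open_S[OF X] fin[OF X] by (intro square_integrable_indicator) auto
      show "integrable lborel (\<lambda>x. complex_of_real (indicator X x) * rep_L2 \<psi> x)"
        using square_integrable_mult[OF si square_integrable_rep_L2[of \<psi>]] by simp
      show "(LINT x|lborel. complex_of_real (indicator X x) * rep_L2 \<psi> x) = 0"
        using orth[OF imageI[OF X]] cinner_abs_L2[OF si square_integrable_rep_L2[of \<psi>]] by simp
    qed
    have re: "Re (complex_of_real (indicator X x) * z) = indicator X x * Re z"
      and im: "Im (complex_of_real (indicator X x) * z) = indicator X x * Im z" for X and x :: 'a and z
      by simp_all
    have cover: "range (\<lambda>n. ball (0::'a) (real n)) \<subseteq> S" using SI[of "{}"] by auto
    have "AE x in lborel. Re (rep_L2 \<psi> x) = 0"
    proof (rule AE_zero_if_integrals_zero[OF stable gen _ cover balls])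
      fix X assume X: "X \<in> S"
      show "integrable lborel (\<lambda>x. indicator X x * Re (rep_L2 \<psi> x))"
        using integrable_Re[OF *(1)[OF X]] by (simp only: re)
      show "(LINT x|lborel. indicator X x * Re (rep_L2 \<psi> x)) = 0"
        using integral_Re[OF *(1)[OF X]] *(2)[OF X] by (simp only: re zero_complex.sel)
    qed (use open_S in auto)
    moreover have "AE x in lborel. Im (rep_L2 \<psi> x) = 0"
    proof (rule AE_zero_if_integrals_zero[OF stable gen _ cover balls])
      fix X assume X: "X \<in> S"
      show "integrable lborel (\<lambda>x. indicator X x * Im (rep_L2 \<psi> x))"
        using integrable_Im[OF *(1)[OF X]] by (simp only: im)
      show "(LINT x|lborel. indicator X x * Im (rep_L2 \<psi> x)) = 0"
        using integral_Im[OF *(1)[OF X]] *(2)[OF X] by (simp only: im zero_complex.sel)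
    qed (use open_S in auto)
    ultimately have "AE x in lborel. (cmod (rep_L2 \<psi> x))\<^sup>2 = 0"
      by eventually_elim (simp add: complex_eq_iff)
    then have "(LINT x|lborel. (cmod (rep_L2 \<psi> x))\<^sup>2) = 0" by (simp add: integral_eq_zero_AE)
    then show "\<psi> = 0" using norm_abs_L2[OF square_integrable_rep_L2, of \<psi>] by simp
  qed
qed

text \<open>By Bessel's inequality each of countably many total vectors has a nonzero coefficient at only countably many basis
vectors, and each basis vector is seen by one of them. Countability allows sums over the basis to be exchanged
with integrals.\<close>

theorem countable_basis_L2: "countable (L2_basis :: 'a::euclidean_space L2 set)"
proof -
  obtain D :: "'a L2 set" where D: "countable D" "\<And>\<psi>. (\<And>\<phi>. \<phi> \<in> D \<Longrightarrow> cinner \<phi> \<psi> = 0) \<Longrightarrow> \<psi> = 0"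
    using countable_total_L2 by blast
  have "countable {e\<in>L2_basis. cinner e \<phi> \<noteq> 0}" for \<phi> :: "'a L2"
  proof -
    have "(\<lambda>e. (cmod (cinner e \<phi>))\<^sup>2) summable_on L2_basis"
      by (rule nonneg_bdd_above_summable_on) (auto intro!: bdd_aboveI[of _ "(norm \<phi>)\<^sup>2"] bessel)
    from summable_countable_real[OF this] show ?thesis by simp
  qed
  then have "countable (\<Union>\<phi>\<in>D. {e\<in>L2_basis. cinner e \<phi> \<noteq> 0})" using D(1) by blast
  moreover have "L2_basis \<subseteq> (\<Union>\<phi>\<in>D. {e\<in>L2_basis. cinner e \<phi> \<noteq> 0})"
  proof
    fix e :: "'a L2" assume e: "e \<in> L2_basis"
    then have "e \<noteq> 0" using basis_orthonormal[of e e] by auto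
    then obtain \<phi> where "\<phi> \<in> D" "cinner \<phi> e \<noteq> 0" using D(2) by blast
    moreover from this have "cinner e \<phi> \<noteq> 0" using cinner_commute[of e \<phi>] by auto
    ultimately show "e \<in> (\<Union>\<phi>\<in>D. {e\<in>L2_basis. cinner e \<phi> \<noteq> 0})" using e by blast
  qed
  ultimately show ?thesis by (rule countable_subset[rotated])
qed

lemma infsum_ennreal_eq_nn_integral:
  fixes f :: "'i \<Rightarrow> ennreal"
  assumes "countable I"
  shows "(\<Sum>\<^sub>\<infinity>i\<in>I. f i) = (\<integral>\<^sup>+i. f i \<partial>count_space I)"
proof (cases "finite I")
  case True
  then show ?thesis by (simp add: nn_integral_count_space_finite)
next
  case False
  note bij = bij_betw_from_nat_into[OF assms False]
  have "(\<Sum>\<^sub>\<infinity>i\<in>I. f i) = (\<Sum>\<^sub>\<infinity>n. f (from_nat_into I n))"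
    by (rule infsum_reindex_bij_betw[OF bij, symmetric])
  also have "\<dots> = (\<Sum>n. f (from_nat_into I n))"
    by (intro sums_unique has_sum_imp_sums has_sum_infsum nonneg_summable_on_complete) auto
  also have "\<dots> = (\<integral>\<^sup>+i. f i \<partial>count_space I)"
    by (simp add: nn_integral_bij_count_space[symmetric, OF bij] nn_integral_count_space_nat)
  finally show ?thesis .
qed

lemma borel_measurable_nn_integral_count_space:
  fixes f :: "'i \<Rightarrow> 'b \<Rightarrow> ennreal"
  assumes "countable I" and [measurable]: "\<And>i. i \<in> I \<Longrightarrow> f i \<in> borel_measurable M"
  shows "(\<lambda>x. \<integral>\<^sup>+i. f i x \<partial>count_space I) \<in> borel_measurable M"
proof (cases "finite I")
  case True
  then show ?thesis by (simp add: nn_integral_count_space_finite)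
next
  case False
  note bij = bij_betw_from_nat_into[OF assms(1) False]
  have "(\<integral>\<^sup>+i. f i x \<partial>count_space I) = (\<Sum>n. f (from_nat_into I n) x)" for x
    by (simp add: nn_integral_bij_count_space[symmetric, OF bij] nn_integral_count_space_nat)
  moreover have "f (from_nat_into I n) \<in> borel_measurable M" for n
    using False by (intro assms(2) from_nat_into) auto
  ultimately show ?thesis by simp
qed

section \<open>Nonnegative operators, their square roots and traces\<close>

text \<open>A symmetric map is linear because the inner product is nondegenerate.\<close>

lemma nonneg_operatorI:
  assumes herm: "\<And>\<phi> \<psi>. cinner \<phi> (T \<psi>) = cinner (T \<phi>) \<psi>"
    and nonneg: "\<And>\<psi>. 0 \<le> Re (cinner \<psi> (T \<psi>))"
    and bound: "\<And>\<psi>. norm (T \<psi>) \<le> norm \<psi> * K"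
  shows "nonneg_operator T"
proof -
  have scaleC: "T (c *\<^sub>C \<psi>) = c *\<^sub>C T \<psi>" for c \<psi>
    by (rule cinner_ext) (simp add: herm cinner_scaleC_right)
  have "T (\<phi> + \<psi>) = T \<phi> + T \<psi>" for \<phi> \<psi>
    by (rule cinner_ext) (simp add: herm cinner_add_right)
  then have "bounded_linear T"
    by (rule bounded_linear_intro[OF _ _ bound]) (simp add: scaleR_L2_def scaleC)
  then show ?thesis using assms scaleC by (auto simp: nonneg_operator_def)
qed

lemma nonneg_operatorD:
  assumes "nonneg_operator T"
  shows "bounded_linear T" "T (c *\<^sub>C \<psi>) = c *\<^sub>C T \<psi>"
    "cinner \<phi> (T \<psi>) = cinner (T \<phi>) \<psi>" "0 \<le> Re (cinner \<psi> (T \<psi>))"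
  using assms by (auto simp: nonneg_operator_def)

lemma nonneg_operator_scale:
  assumes "nonneg_operator T" "0 \<le> r"
  shows "nonneg_operator (\<lambda>\<psi>. r *\<^sub>R T \<psi>)"
proof -
  note T = nonneg_operatorD[OF assms(1)]
  obtain K where K: "\<And>\<psi>. norm (T \<psi>) \<le> norm \<psi> * K"
    using bounded_linear.bounded[OF T(1)] by auto
  show ?thesis
  proof (rule nonneg_operatorI)
    show "norm (r *\<^sub>R T \<psi>) \<le> norm \<psi> * (r * K)" for \<psi>
      using mult_left_mono[OF K[of \<psi>], of r] assms(2) by (simp add: mult_ac)
  qed (use T(3,4) assms(2) in auto)
qed

text \<open>The Cauchy--Schwarz inequality for the semidefinite form \<open>\<langle>\<phi>, T \<psi>\<rangle>\<close>, applied to \<open>\<psi>\<close> and \<open>T \<psi>\<close>.\<close>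

lemma nonneg_operator_norm_bound:
  assumes T: "nonneg_operator T" and K: "\<And>\<psi>. norm (T \<psi>) \<le> K * norm \<psi>"
  shows "(norm (T \<psi>))\<^sup>2 \<le> K * inner \<psi> (T \<psi>)"
proof (cases "T \<psi> = 0")
  case False
  interpret T: bounded_linear T using nonneg_operatorD[OF T] by blast
  define a where "a = inner \<psi> (T \<psi>)"
  define b where "b = inner (T \<psi>) (T (T \<psi>))"
  define n where "n = (norm (T \<psi>))\<^sup>2"
  have n: "n > 0" using False by (simp add: n_def)
  have "b \<le> norm (T \<psi>) * norm (T (T \<psi>))" unfolding b_def by (rule norm_cauchy_schwarz)
  also have "\<dots> \<le> norm (T \<psi>) * (K * norm (T \<psi>))" by (intro mult_left_mono K) simp
  finally have b: "b \<le> K * n" by (simp add: n_def power2_eq_square mult_ac)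
  have sym: "inner (T \<phi>) \<eta> = inner \<phi> (T \<eta>)" for \<phi> \<eta>
    using nonneg_operatorD(3)[OF T, of \<phi> \<eta>] by (simp add: inner_L2_def)
  have pos: "0 \<le> a - 2 * t * n + t\<^sup>2 * b" for t
  proof -
    have "0 \<le> inner (\<psi> - t *\<^sub>R T \<psi>) (T (\<psi> - t *\<^sub>R T \<psi>))"
      using nonneg_operatorD(4)[OF T] by (simp add: inner_L2_def)
    also have "\<dots> = a - 2 * t * n + t\<^sup>2 * b"
      unfolding a_def b_def n_def power2_norm_eq_inner
      by (simp add: T.diff T.scaleR inner_diff_left inner_diff_right sym[of \<psi> "T \<psi>"] sym[symmetric]
          power2_eq_square algebra_simps)
    finally show ?thesis .
  qed
  have "0 < K * n"
  proof (rule ccontr)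
    assume "\<not> 0 < K * n"
    then have "K * norm \<psi> \<le> 0" using n by (simp add: zero_less_mult_iff mult_le_0_iff)
    then have "norm (T \<psi>) \<le> 0" using K[of \<psi>] by linarith
    then show False using False by simp
  qed
  then have Kp: "K > 0" using n by (simp add: zero_less_mult_iff)
  have "0 \<le> a - 2 * (1 / K) * n + (1 / K)\<^sup>2 * b" by (rule pos)
  also have "\<dots> \<le> a - 2 * (1 / K) * n + (1 / K)\<^sup>2 * (K * n)"
    by (intro add_left_mono mult_left_mono b) simp
  also have "\<dots> = a - n / K" using Kp by (simp add: field_simps power2_eq_square)
  finally have "n \<le> K * a" using Kp by (simp add: field_simps)
  then show ?thesis by (simp add: n_def a_def)
qed (use nonneg_operatorD(4)[OF T, of \<psi>] in simp)

text \<open>If \<open>0 \<le> T \<le> 1\<close> and \<open>A = 1 - T\<close>, then \<open>(1 - Y)\<^sup>2 = T\<close> says that \<open>Y = (A + Y\<^sup>2) / 2\<close>. The iteration of this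
fixed point equation is dominated in operator norm by the same iteration for numbers with \<open>A\<close> replaced by 1.\<close>

definition sqrt_step :: "('h::real_normed_vector \<Rightarrow>\<^sub>L 'h) \<Rightarrow> ('h \<Rightarrow>\<^sub>L 'h) \<Rightarrow> ('h \<Rightarrow>\<^sub>L 'h)" where
  "sqrt_step A Y = (1/2) *\<^sub>R (A + (Y o\<^sub>L Y))"

definition sqrt_iter :: "('h::real_normed_vector \<Rightarrow>\<^sub>L 'h) \<Rightarrow> nat \<Rightarrow> ('h \<Rightarrow>\<^sub>L 'h)" where
  "sqrt_iter A n = (sqrt_step A ^^ n) 0"

definition scalar_iter :: "nat \<Rightarrow> real" where
  "scalar_iter n = ((\<lambda>y. (1 + y\<^sup>2) / 2) ^^ n) 0"

lemma scalar_iter_bounds: "0 \<le> scalar_iter n \<and> scalar_iter n \<le> 1"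
proof (induction n)
  case (Suc n)
  then have "(scalar_iter n)\<^sup>2 \<le> 1" by (simp add: power_le_one)
  then show ?case by (simp add: scalar_iter_def)
qed (simp add: scalar_iter_def)

text \<open>The induction rests on \<open>Z\<^sup>2 - Y\<^sup>2 = Z (Z - Y) + (Z - Y) Y\<close>, which holds for noncommuting operators, and whose norm
is at most \<open>z\<^sup>2 - y\<^sup>2\<close> for the dominating numbers. The increments are therefore summable even
when \<open>\<parallel>A\<parallel> = 1\<close>, where the step is not a contraction.\<close>

lemma sqrt_iter_bounds:
  assumes "norm A \<le> 1"
  shows "norm (sqrt_iter A n) \<le> scalar_iter n \<and>
    norm (sqrt_iter A (Suc n) - sqrt_iter A n) \<le> scalar_iter (Suc n) - scalar_iter n"
proof (induction n)
  case 0
  then show ?case using assms by (simp add: sqrt_iter_def scalar_iter_def sqrt_step_def)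
next
  case (Suc n)
  let ?Y = "sqrt_iter A n" and ?Z = "sqrt_iter A (Suc n)"
  let ?y = "scalar_iter n" and ?z = "scalar_iter (Suc n)"
  have Z: "norm ?Z \<le> ?z"
    using Suc norm_triangle_ineq[of ?Y "?Z - ?Y"] by simp
  have step: "sqrt_iter A (Suc (Suc n)) - ?Z = (1/2) *\<^sub>R ((?Z o\<^sub>L (?Z - ?Y)) + ((?Z - ?Y) o\<^sub>L ?Y))"
    by (simp add: sqrt_iter_def sqrt_step_def bounded_bilinear.diff_left[OF bounded_bilinear_blinfun_compose]
        bounded_bilinear.diff_right[OF bounded_bilinear_blinfun_compose] flip: scaleR_diff_right)
  have "norm (?Z o\<^sub>L (?Z - ?Y)) \<le> ?z * (?z - ?y)"
    by (rule order_trans[OF norm_blinfun_compose]) (use Suc Z scalar_iter_bounds in \<open>auto intro!: mult_mono\<close>)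
  moreover have "norm ((?Z - ?Y) o\<^sub>L ?Y) \<le> (?z - ?y) * ?y"
    by (rule order_trans[OF norm_blinfun_compose])
       (use Suc scalar_iter_bounds[of n] order_trans[OF norm_ge_zero Suc.IH[THEN conjunct2]] in \<open>auto intro!: mult_mono\<close>)
  ultimately have "norm (sqrt_iter A (Suc (Suc n)) - ?Z) \<le> (1/2) * (?z * (?z - ?y) + (?z - ?y) * ?y)"
    unfolding step using norm_triangle_ineq[of "?Z o\<^sub>L (?Z - ?Y)" "(?Z - ?Y) o\<^sub>L ?Y"] by simp
  also have "\<dots> = scalar_iter (Suc (Suc n)) - ?z"
  proof -
    have "?z * (?z - ?y) + (?z - ?y) * ?y = ?z\<^sup>2 - ?y\<^sup>2"
      by (simp add: algebra_simps power2_eq_square)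
    have "2 * scalar_iter (Suc (Suc n)) = 1 + ?z\<^sup>2" "2 * ?z = 1 + ?y\<^sup>2"
      by (simp_all add: scalar_iter_def)
    then show ?thesis unfolding \<open>?z * (?z - ?y) + (?z - ?y) * ?y = ?z\<^sup>2 - ?y\<^sup>2\<close> by (simp add: field_simps)
  qed
  finally show ?case using Z by simp
qed

lemma sqrt_iter_converges:
  fixes A :: "'h::banach \<Rightarrow>\<^sub>L 'h"
  assumes "norm A \<le> 1"
  obtains Y where "sqrt_iter A \<longlonglongrightarrow> Y" "norm Y \<le> 1" "Y = sqrt_step A Y"
proof -
  note b = sqrt_iter_bounds[OF assms]
  have "summable (\<lambda>n. norm (sqrt_iter A (Suc n) - sqrt_iter A n))"
  proof (rule bounded_imp_summable)
    fix n
    have "(\<Sum>i\<le>n. norm (sqrt_iter A (Suc i) - sqrt_iter A i)) \<le> (\<Sum>i\<le>n. scalar_iter (Suc i) - scalar_iter i)"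
      using b by (intro sum_mono) simp
    also have "\<dots> = scalar_iter (Suc n) - scalar_iter 0" 
      unfolding lessThan_Suc_atMost[symmetric] by (rule sum_lessThan_telescope)
    also have "\<dots> \<le> 1" using scalar_iter_bounds[of "Suc n"] scalar_iter_bounds[of 0] by linarith
    finally show "(\<Sum>i\<le>n. norm (sqrt_iter A (Suc i) - sqrt_iter A i)) \<le> 1" .
  qed simp
  then have "summable (\<lambda>n. sqrt_iter A (Suc n) - sqrt_iter A n)" by (rule summable_norm_cancel)
  then have "convergent (\<lambda>n. \<Sum>i<n. sqrt_iter A (Suc i) - sqrt_iter A i)"
    by (simp add: summable_iff_convergent)
  moreover have "(\<Sum>i<n. sqrt_iter A (Suc i) - sqrt_iter A i) = sqrt_iter A n" for n
    by (subst sum_lessThan_telescope) (simp add: sqrt_iter_def)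
  ultimately obtain Y where Y: "sqrt_iter A \<longlonglongrightarrow> Y" by (auto simp: convergent_def)
  moreover have "norm Y \<le> 1"
    using b scalar_iter_bounds by (intro LIMSEQ_le_const2[OF tendsto_norm[OF Y]]) (meson order_trans)
  moreover have "(\<lambda>n. sqrt_iter A (Suc n)) \<longlonglongrightarrow> sqrt_step A Y"
  proof -
    have "sqrt_iter A (Suc n) = sqrt_step A (sqrt_iter A n)" for n by (simp add: sqrt_iter_def)
    then show ?thesis unfolding sqrt_step_def
      by (simp only:) (intro tendsto_intros Y bounded_bilinear.tendsto[OF bounded_bilinear_blinfun_compose])
  qed
  then have "Y = sqrt_step A Y"
    using LIMSEQ_unique[OF LIMSEQ_Suc[OF Y]] by blast
  ultimately show thesis by (rule that)
qed

text \<open>After scaling \<open>T\<close> to norm at most 1 the operator \<open>1 - T\<close> has norm at most 1, by \<open>nonneg_operator_norm_bound\<close>, and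
\<open>1 - Y\<close> is a nonnegative square root for the limit \<open>Y\<close> of the iteration.\<close>

theorem nonneg_operator_sqrt_exists:
  fixes T :: "'a::euclidean_space L2 \<Rightarrow> 'a L2"
  assumes T: "nonneg_operator T"
  shows "\<exists>S. nonneg_operator S \<and> S \<circ> S = T"
proof -
  obtain K where K: "K > 0" "\<And>\<psi>. norm (T \<psi>) \<le> norm \<psi> * K"
    using bounded_linear.pos_bounded[OF nonneg_operatorD(1)[OF T]] by blast
  define T' where "T' \<psi> = (1 / K) *\<^sub>R T \<psi>" for \<psi>
  have T': "nonneg_operator T'"
    unfolding T'_def using K(1) by (intro nonneg_operator_scale T) simp
  have T'_le: "norm (T' \<psi>) \<le> 1 * norm \<psi>" for \<psi>
    using K(1) K(2)[of \<psi>] by (simp add: T'_def divide_le_eq)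
  interpret T': bounded_linear T' using nonneg_operatorD[OF T'] by blast
  define A where "A = Blinfun (\<lambda>\<psi>. \<psi> - T' \<psi>)"
  have A: "blinfun_apply A \<psi> = \<psi> - T' \<psi>" for \<psi>
    unfolding A_def
    by (subst bounded_linear_Blinfun_apply) (intro bounded_linear_intros T'.bounded_linear_axioms, simp)
  have "norm (A \<psi>) \<le> 1 * norm \<psi>" for \<psi>
  proof -
    have "(norm (A \<psi>))\<^sup>2 = (norm \<psi>)\<^sup>2 - 2 * inner \<psi> (T' \<psi>) + (norm (T' \<psi>))\<^sup>2"
      by (simp add: A power2_norm_eq_inner inner_diff_left inner_diff_right inner_commute)
    also have "\<dots> \<le> (norm \<psi>)\<^sup>2"
      using nonneg_operator_norm_bound[OF T' T'_le, of \<psi>] nonneg_operatorD(4)[OF T', of \<psi>] by (simp add: Re_cinner)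
    finally show ?thesis by (simp add: power2_le_iff_abs_le)
  qed
  then have "norm A \<le> 1" by (intro norm_blinfun_bound) auto
  then obtain Y where Y: "sqrt_iter A \<longlonglongrightarrow> Y" "norm Y \<le> 1" "Y = sqrt_step A Y"
    by (rule sqrt_iter_converges)
  have A_herm: "cinner \<phi> (A \<psi>) = cinner (A \<phi>) \<psi>" for \<phi> \<psi>
    unfolding A by (simp add: cinner_diff_right cinner_diff_left nonneg_operatorD(3)[OF T'])
  have iter_herm: "cinner \<phi> (sqrt_iter A n \<psi>) = cinner (sqrt_iter A n \<phi>) \<psi>" for n \<phi> \<psi>
  proof (induction n arbitrary: \<phi> \<psi>)
    case 0
    then show ?case by (simp add: sqrt_iter_def)
  next
    case (Suc n)
    have "sqrt_iter A (Suc n) \<eta> = (1/2) *\<^sub>R (A \<eta> + sqrt_iter A n (sqrt_iter A n \<eta>))" for \<eta>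
      by (simp add: sqrt_iter_def sqrt_step_def blinfun.add_left blinfun.scaleR_left)
    then show ?case
      by (simp add: A_herm Suc.IH cinner_add_left cinner_add_right)
  qed
  have Y_lim: "(\<lambda>n. sqrt_iter A n \<psi>) \<longlonglongrightarrow> Y \<psi>" for \<psi>
    by (intro blinfun.tendsto Y tendsto_const)
  have Y_herm: "cinner \<phi> (Y \<psi>) = cinner (Y \<phi>) \<psi>" for \<phi> \<psi>
  proof (rule LIMSEQ_unique)
    show "(\<lambda>n. cinner \<phi> (sqrt_iter A n \<psi>)) \<longlonglongrightarrow> cinner \<phi> (Y \<psi>)" by (intro tendsto_intros Y_lim)
    show "(\<lambda>n. cinner \<phi> (sqrt_iter A n \<psi>)) \<longlonglongrightarrow> cinner (Y \<phi>) \<psi>"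
      unfolding iter_herm by (intro tendsto_intros Y_lim)
  qed
  have Y_le: "norm (Y \<psi>) \<le> norm \<psi>" for \<psi>
    using norm_blinfun[of Y \<psi>] Y(2) mult_right_mono[OF Y(2) norm_ge_zero[of \<psi>]] by simp
  have YY: "Y \<psi> + Y \<psi> = A \<psi> + Y (Y \<psi>)" for \<psi>
  proof -
    have "Y \<psi> = (1/2) *\<^sub>R (A \<psi> + Y (Y \<psi>))"
      using arg_cong[OF Y(3), of "\<lambda>Z. Z \<psi>"] by (simp add: sqrt_step_def blinfun.add_left blinfun.scaleR_left)
    then have "2 *\<^sub>R Y \<psi> = A \<psi> + Y (Y \<psi>)" by (metis scaleR_half_double scaleR_scaleR scaleR_left.diff div_by_1 scaleR_2 scaleR_right_distrib)
    then show ?thesis by (simp add: scaleR_2)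
  qed
  define S where "S \<psi> = \<psi> - Y \<psi>" for \<psi>
  have "nonneg_operator S"
  proof (rule nonneg_operatorI)
    show "cinner \<phi> (S \<psi>) = cinner (S \<phi>) \<psi>" for \<phi> \<psi>
      by (simp add: S_def cinner_diff_left cinner_diff_right Y_herm)
    show "0 \<le> Re (cinner \<psi> (S \<psi>))" for \<psi>
    proof -
      have "inner \<psi> (Y \<psi>) \<le> norm \<psi> * norm \<psi>"
        using norm_cauchy_schwarz[of \<psi> "Y \<psi>"] mult_left_mono[OF Y_le norm_ge_zero, of \<psi> \<psi>] by linarith
      then show ?thesis
        by (simp add: S_def Re_cinner inner_diff_right power2_norm_eq_inner[symmetric] power2_eq_square)
    qed
    show "norm (S \<psi>) \<le> norm \<psi> * 2" for \<psi>
      using norm_triangle_ineq4[of \<psi> "Y \<psi>"] Y_le[of \<psi>] by (simp add: S_def)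
  qed
  moreover have SS: "S (S \<psi>) = T' \<psi>" for \<psi>
    using YY[of \<psi>] by (simp add: S_def A blinfun.diff_right algebra_simps)
  ultimately have "nonneg_operator (\<lambda>\<psi>. sqrt K *\<^sub>R S \<psi>)"
    using K(1) by (intro nonneg_operator_scale) auto
  moreover have "(\<lambda>\<psi>. sqrt K *\<^sub>R S \<psi>) \<circ> (\<lambda>\<psi>. sqrt K *\<^sub>R S \<psi>) = T"
  proof
    fix \<psi>
    have "S (sqrt K *\<^sub>R S \<psi>) = sqrt K *\<^sub>R S (S \<psi>)"
      by (simp add: S_def blinfun.scaleR_right blinfun.diff_right scaleR_diff_right)
    then show "((\<lambda>\<psi>. sqrt K *\<^sub>R S \<psi>) \<circ> (\<lambda>\<psi>. sqrt K *\<^sub>R S \<psi>)) \<psi> = T \<psi>"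
      using K(1) by (simp add: SS T'_def)
  qed
  ultimately show ?thesis by blast
qed

lemma op_sqrt:
  assumes "nonneg_operator T"
  shows "nonneg_operator (op_sqrt T)" "op_sqrt T (op_sqrt T \<psi>) = T \<psi>"
  using someI_ex[OF nonneg_operator_sqrt_exists[OF assms]]
  unfolding op_sqrt_def[symmetric] by (auto simp: fun_eq_iff)

lemma norm_op_sqrt:
  assumes "nonneg_operator T"
  shows "(norm (op_sqrt T \<psi>))\<^sup>2 = Re (cinner \<psi> (T \<psi>))"
  using nonneg_operatorD(3)[OF op_sqrt(1)[OF assms], of \<psi> "op_sqrt T \<psi>"]
  by (simp add: op_sqrt(2)[OF assms] cinner_norm)

lemma op_trace_nn_integral: "op_trace T = (\<integral>\<^sup>+e. ennreal (Re (cinner e (T e))) \<partial>count_space L2_basis)"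
  unfolding op_trace_def by (rule infsum_ennreal_eq_nn_integral[OF countable_basis_L2])

lemma form_trace_nn_integral: "form_trace q T = (\<integral>\<^sup>+e. q (op_sqrt T e) \<partial>count_space L2_basis)"
  unfolding form_trace_def by (rule infsum_ennreal_eq_nn_integral[OF countable_basis_L2])

lemma parseval_nn_integral:
  "(\<integral>\<^sup>+e. ennreal ((cmod (cinner e \<psi>))\<^sup>2) \<partial>count_space L2_basis) = ennreal ((norm \<psi>)\<^sup>2)"
  using parseval[of \<psi>] by (simp add: infsum_ennreal_eq_nn_integral[OF countable_basis_L2])

lemma op_trace_sqrt:
  assumes "nonneg_operator T"
  shows "(\<integral>\<^sup>+e. ennreal ((norm (op_sqrt T e))\<^sup>2) \<partial>count_space L2_basis) = op_trace T"
  unfolding op_trace_nn_integral norm_op_sqrt[OF assms] ..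

lemma op_trace_scale:
  assumes "0 \<le> r"
  shows "op_trace (\<lambda>\<psi>. r *\<^sub>R T \<psi>) = ennreal r * op_trace T"
  unfolding op_trace_nn_integral using assms by (simp add: ennreal_mult' nn_integral_cmult)

text \<open>Both sides are the squared Hilbert--Schmidt norm of \<open>C T\<^sup>1\<^sup>/\<^sup>2\<close>, computed from this operator on the left and
from its adjoint on the right. The right-hand side is linear in \<open>T\<close>.\<close>

lemma trace_sqrt_conjugation:
  assumes T: "nonneg_operator T" and C: "nonneg_operator C"
  shows "(\<integral>\<^sup>+e. ennreal ((norm (C (op_sqrt T e)))\<^sup>2) \<partial>count_space L2_basis) =
    (\<integral>\<^sup>+e. ennreal (Re (cinner (C e) (T (C e)))) \<partial>count_space L2_basis)"
proof -
  have swap: "cmod (cinner k (C (op_sqrt T e))) = cmod (cinner e (op_sqrt T (C k)))" for k e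
  proof -
    have "cinner k (C (op_sqrt T e)) = cinner (op_sqrt T (C k)) e"
      by (simp add: nonneg_operatorD(3)[OF C, of k] nonneg_operatorD(3)[OF op_sqrt(1)[OF T], of "C k"])
    then show ?thesis by (simp add: cinner_commute[of "op_sqrt T (C k)" e])
  qed
  have "(\<integral>\<^sup>+e. ennreal ((norm (C (op_sqrt T e)))\<^sup>2) \<partial>count_space L2_basis) =
      (\<integral>\<^sup>+e. \<integral>\<^sup>+k. ennreal ((cmod (cinner e (op_sqrt T (C k))))\<^sup>2) \<partial>count_space L2_basis \<partial>count_space L2_basis)"
    by (simp only: parseval_nn_integral[symmetric] swap)
  also have "\<dots> = (\<integral>\<^sup>+k. \<integral>\<^sup>+e. ennreal ((cmod (cinner e (op_sqrt T (C k))))\<^sup>2) \<partial>count_space L2_basis \<partial>count_space L2_basis)"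
    by (rule nn_integral_count_space_nn_integral[OF countable_basis_L2]) simp
  also have "\<dots> = (\<integral>\<^sup>+k. ennreal (Re (cinner (C k) (T (C k)))) \<partial>count_space L2_basis)"
    by (simp only: parseval_nn_integral norm_op_sqrt[OF T])
  finally show ?thesis .
qed

text \<open>The operator norm of \<open>T\<close> is at most its trace, since the Hilbert--Schmidt norm of \<open>T\<^sup>1\<^sup>/\<^sup>2\<close> dominates its operator norm.\<close>

lemma nonneg_operator_trace_bound:
  assumes T: "nonneg_operator T"
  shows "ennreal (cmod (cinner \<phi> (T \<psi>))) \<le> op_trace T * ennreal (norm \<phi> * norm \<psi>)"
proof -
  let ?S = "op_sqrt T"
  note S = op_sqrt[OF T]
  have bound: "ennreal ((norm (?S \<eta>))\<^sup>2) \<le> op_trace T * ennreal ((norm \<eta>)\<^sup>2)" for \<eta>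
  proof -
    have "ennreal ((norm (?S \<eta>))\<^sup>2) = (\<integral>\<^sup>+e. ennreal ((cmod (cinner (?S e) \<eta>))\<^sup>2) \<partial>count_space L2_basis)"
      by (simp only: parseval_nn_integral[symmetric] nonneg_operatorD(3)[OF S(1)])
    also have "\<dots> \<le> (\<integral>\<^sup>+e. ennreal ((norm (?S e))\<^sup>2) * ennreal ((norm \<eta>)\<^sup>2) \<partial>count_space L2_basis)"
      using power_mono[OF cinner_bound norm_ge_zero, of _ \<eta> 2]
      by (intro nn_integral_mono) (simp add: power_mult_distrib flip: ennreal_mult)
    also have "\<dots> = op_trace T * ennreal ((norm \<eta>)\<^sup>2)"
      by (simp add: nn_integral_multc op_trace_sqrt[OF T])
    finally show ?thesis .
  qed
  show ?thesis
  proof (cases "op_trace T = \<infinity> \<or> norm \<phi> * norm \<psi> = 0")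
    case True
    then show ?thesis
      using cinner_bound[of \<phi> "T \<psi>"] nonneg_operatorD(1)[OF T]
      by (auto simp: ennreal_top_mult linear_simps(3) ennreal_eq_0_iff mult_le_0_iff)
  next
    case False
    then obtain t where t: "op_trace T = ennreal t" "t \<ge> 0" by (cases "op_trace T") auto
    have b: "norm (?S \<eta>) \<le> sqrt t * norm \<eta>" for \<eta>
    proof -
      have "(norm (?S \<eta>))\<^sup>2 \<le> t * (norm \<eta>)\<^sup>2"
        using bound[of \<eta>] t by (simp flip: ennreal_mult)
      also have "\<dots> = (sqrt t * norm \<eta>)\<^sup>2" using t by (simp add: power_mult_distrib)
      finally show ?thesis by (rule power2_le_imp_le) (use t in simp)
    qed
    have "cmod (cinner \<phi> (T \<psi>)) = cmod (cinner (?S \<phi>) (?S \<psi>))"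
      by (simp add: S(2) nonneg_operatorD(3)[OF S(1), symmetric])
    also have "\<dots> \<le> norm (?S \<phi>) * norm (?S \<psi>)" by (rule cinner_bound)
    also have "\<dots> \<le> (sqrt t * norm \<phi>) * (sqrt t * norm \<psi>)" by (intro mult_mono b) (use t in auto)
    also have "\<dots> = t * (norm \<phi> * norm \<psi>)" using t by (simp add: mult_ac flip: real_sqrt_mult)
    finally show ?thesis using t by (simp flip: ennreal_mult)
  qed
qed

section \<open>Bounded approximation of the form of a closed operator\<close>

text \<open>The graphs of closed complex-linear operators are of this kind.\<close>

definition closed_linear_relation :: "'a::euclidean_space unbounded_operator \<Rightarrow> bool" where
  "closed_linear_relation A \<longleftrightarrow> closed A \<and> (0, 0) \<in> A \<and>
     (\<forall>\<phi> \<eta> \<phi>' \<eta>'. (\<phi>, \<eta>) \<in> A \<longrightarrow> (\<phi>', \<eta>') \<in> A \<longrightarrow> (\<phi> + \<phi>', \<eta> + \<eta>') \<in> A) \<and>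
     (\<forall>c \<phi> \<eta>. (\<phi>, \<eta>) \<in> A \<longrightarrow> (c *\<^sub>C \<phi>, c *\<^sub>C \<eta>) \<in> A)"

lemma closed_linear_relationD:
  assumes "closed_linear_relation A"
  shows "closed A" "(0, 0) \<in> A"
    "(\<phi>, \<eta>) \<in> A \<Longrightarrow> (\<phi>', \<eta>') \<in> A \<Longrightarrow> (\<phi> + \<phi>', \<eta> + \<eta>') \<in> A"
    "(\<phi>, \<eta>) \<in> A \<Longrightarrow> (c *\<^sub>C \<phi>, c *\<^sub>C \<eta>) \<in> A"
    "(\<phi>, \<eta>) \<in> A \<Longrightarrow> (r *\<^sub>R \<phi>, r *\<^sub>R \<eta>) \<in> A"
    "(\<phi>, \<eta>) \<in> A \<Longrightarrow> (\<phi>', \<eta>') \<in> A \<Longrightarrow> (\<phi> - \<phi>', \<eta> - \<eta>') \<in> A"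
proof -
  show 1: "closed A" "(0, 0) \<in> A"
    "\<And>\<phi> \<eta> \<phi>' \<eta>'. (\<phi>, \<eta>) \<in> A \<Longrightarrow> (\<phi>', \<eta>') \<in> A \<Longrightarrow> (\<phi> + \<phi>', \<eta> + \<eta>') \<in> A"
    "\<And>\<phi> \<eta> c. (\<phi>, \<eta>) \<in> A \<Longrightarrow> (c *\<^sub>C \<phi>, c *\<^sub>C \<eta>) \<in> A"
    using assms by (auto simp: closed_linear_relation_def)
  show 2: "(r *\<^sub>R \<phi>, r *\<^sub>R \<eta>) \<in> A" if "(\<phi>, \<eta>) \<in> A" for \<phi> \<eta> r
    using 1(4)[OF that, of "complex_of_real r"] by (simp add: scaleR_L2_def)
  show "(\<phi>, \<eta>) \<in> A \<Longrightarrow> (\<phi>', \<eta>') \<in> A \<Longrightarrow> (\<phi> - \<phi>', \<eta> - \<eta>') \<in> A"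
    using 1(3)[OF _ 2[of \<phi>' \<eta>' "-1"], of \<phi> \<eta>] by simp
qed

text \<open>The Euler--Lagrange equation of the minimization of \<open>\<parallel>\<eta>\<parallel>\<^sup>2 + s \<parallel>\<psi> - \<phi>\<parallel>\<^sup>2\<close> over all \<open>(\<phi>, \<eta>)\<close> in the graph \<open>A\<close>.
The minimum is Moreau's envelope of the form of \<open>A\<close>.\<close>

definition envelope_point :: "'a::euclidean_space unbounded_operator \<Rightarrow> real \<Rightarrow> 'a L2 \<Rightarrow> 'a L2 \<Rightarrow> 'a L2 \<Rightarrow> bool" where
  "envelope_point A s \<psi> \<phi> \<eta> \<longleftrightarrow> (\<phi>, \<eta>) \<in> A \<and>
     (\<forall>\<phi>' \<eta>'. (\<phi>', \<eta>') \<in> A \<longrightarrow> s * cinner \<phi> \<phi>' + cinner \<eta> \<eta>' = s * cinner \<psi> \<phi>')"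

text \<open>The minimizer is the orthogonal projection of \<open>(\<psi>, 0)\<close> onto the graph, with the first component weighted by \<open>s\<close>.\<close>

lemma envelope_point_exists:
  assumes A: "closed_linear_relation A" and s: "s > 0"
  shows "\<exists>\<phi> \<eta>. envelope_point A s \<psi> \<phi> \<eta>"
proof -
  note AD = closed_linear_relationD[OF A]
  \<comment> \<open>Rescaling the first component turns the weighted inner product into the standard one of the product space.\<close>
  define U where "U = (\<lambda>(\<zeta>, \<eta>). ((1 / sqrt s) *\<^sub>R \<zeta>, \<eta>)) -` A"
  have U_iff: "(\<zeta>, \<eta>) \<in> U \<longleftrightarrow> ((1 / sqrt s) *\<^sub>R \<zeta>, \<eta>) \<in> A" for \<zeta> \<eta> by (simp add: U_def)
  have U_closed: "closed U"
    unfolding U_def case_prod_beta by (intro continuous_closed_vimage AD(1)) (auto intro!: continuous_intros)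
  have U_sub: "subspace U"
  proof (rule subspaceI)
    show "0 \<in> U" using AD(2) by (simp add: zero_prod_def U_iff)
    show "x + y \<in> U" if "x \<in> U" "y \<in> U" for x y
      using AD(3)[of "(1 / sqrt s) *\<^sub>R fst x" "snd x" "(1 / sqrt s) *\<^sub>R fst y" "snd y"] that
      by (cases x; cases y) (simp add: U_iff scaleR_right_distrib)
    show "r *\<^sub>R x \<in> U" if "x \<in> U" for r x
      using AD(5)[of "(1 / sqrt s) *\<^sub>R fst x" "snd x" r] that
      by (cases x) (simp add: U_iff mult.commute)
  qed
  obtain x where "x \<in> closure U" and x: "\<And>u. u \<in> U \<Longrightarrow> inner x u = inner (sqrt s *\<^sub>R \<psi>, 0) u"
    using riesz_on_subspace[OF U_sub bounded_linear_inner_right[of "(sqrt s *\<^sub>R \<psi>, 0)"]] by blast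
  then have xU: "x \<in> U" using U_closed by simp
  obtain \<zeta> \<eta> where x_eq: "x = (\<zeta>, \<eta>)" by (cases x)
  define \<phi> where "\<phi> = (1 / sqrt s) *\<^sub>R \<zeta>"
  have \<zeta>: "\<zeta> = sqrt s *\<^sub>R \<phi>" using s by (simp add: \<phi>_def)
  have mem: "(\<phi>, \<eta>) \<in> A" using xU by (simp add: x_eq U_iff \<phi>_def)
  have re: "s * inner \<phi> \<phi>' + inner \<eta> \<eta>' = s * inner \<psi> \<phi>'" if "(\<phi>', \<eta>') \<in> A" for \<phi>' \<eta>'
  proof -
    have "(sqrt s *\<^sub>R \<phi>', \<eta>') \<in> U" using that s by (simp add: U_iff)
    from x[OF this] show ?thesis using s by (simp add: x_eq \<zeta> inner_Pair mult.assoc[symmetric])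
  qed
  \<comment> \<open>The graph is stable under multiplication by \<open>\<i>\<close>, which supplies the imaginary part.\<close>
  have "s * cinner \<phi> \<phi>' + cinner \<eta> \<eta>' = s * cinner \<psi> \<phi>'" if "(\<phi>', \<eta>') \<in> A" for \<phi>' \<eta>'
    using re[OF that] re[OF AD(4)[OF that, of \<i>]]
    by (simp add: complex_eq_iff inner_L2_def cinner_scaleC_right)
  then show ?thesis using mem by (auto simp: envelope_point_def)
qed

text \<open>The excess of any competitor over the minimum is its squared weighted distance to the minimizer.\<close>

lemma envelope_pythagoras:
  assumes A: "closed_linear_relation A" and m: "envelope_point A s \<psi> \<phi> \<eta>" and mem: "(\<phi>', \<eta>') \<in> A"
  shows "(norm \<eta>')\<^sup>2 + s * (norm (\<psi> - \<phi>'))\<^sup>2 =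
    (norm \<eta>)\<^sup>2 + s * (norm (\<psi> - \<phi>))\<^sup>2 + (norm (\<eta>' - \<eta>))\<^sup>2 + s * (norm (\<phi>' - \<phi>))\<^sup>2"
proof -
  have m': "s * inner \<phi> \<alpha> + inner \<eta> \<beta> = s * inner \<psi> \<alpha>" if "(\<alpha>, \<beta>) \<in> A" for \<alpha> \<beta>
  proof -
    have "s * cinner \<phi> \<alpha> + cinner \<eta> \<beta> = s * cinner \<psi> \<alpha>"
      using m that unfolding envelope_point_def by blast
    from arg_cong[OF this, of Re] show ?thesis by (simp add: inner_L2_def)
  qed
  have "(\<phi>' - \<phi>, \<eta>' - \<eta>) \<in> A"
    using closed_linear_relationD(6)[OF A mem] m by (auto simp: envelope_point_def)
  from m'[OF this] show ?thesis
    by (simp add: power2_norm_eq_inner inner_diff_left inner_diff_right inner_commute algebra_simps)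
qed

text \<open>The minimum is a bounded nonnegative quadratic form of \<open>\<psi>\<close>, with operator \<open>s (1 - J)\<close> where \<open>J\<close> sends \<open>\<psi>\<close> to the
first component of the minimizer; \<open>C\<close> is its square root.\<close>

lemma envelope_operator:
  fixes A :: "'a::euclidean_space unbounded_operator"
  assumes A: "closed_linear_relation A" and s: "s > 0"
  shows "\<exists>C. nonneg_operator C \<and> (\<forall>\<psi>. \<exists>\<phi> \<eta>. envelope_point A s \<psi> \<phi> \<eta> \<and>
     (norm (C \<psi>))\<^sup>2 = (norm \<eta>)\<^sup>2 + s * (norm (\<psi> - \<phi>))\<^sup>2)"
proof -
  obtain J Y where m: "\<And>\<psi>. envelope_point A s \<psi> (J \<psi>) (Y \<psi>)"
    using envelope_point_exists[OF A s] by metis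
  have mem: "(J \<psi>, Y \<psi>) \<in> A" for \<psi> using m by (auto simp: envelope_point_def)
  have eq: "s * cinner (J \<psi>) \<phi>' + cinner (Y \<psi>) \<eta>' = s * cinner \<psi> \<phi>'" if "(\<phi>', \<eta>') \<in> A" for \<psi> \<phi>' \<eta>'
    using m[of \<psi>] that by (auto simp: envelope_point_def)
  have J_herm: "cinner \<phi> (J \<psi>) = cinner (J \<phi>) \<psi>" for \<phi> \<psi>
  proof -
    have "s * cinner \<phi> (J \<psi>) = s * cinner (J \<phi>) (J \<psi>) + cinner (Y \<phi>) (Y \<psi>)" using eq[OF mem] by simp
    also have "\<dots> = cnj (s * cinner (J \<psi>) (J \<phi>) + cinner (Y \<psi>) (Y \<phi>))"
      by (simp add: cinner_commute[of "J \<phi>" "J \<psi>"] cinner_commute[of "Y \<phi>" "Y \<psi>"])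
    also have "\<dots> = s * cinner (J \<phi>) \<psi>"
      unfolding eq[OF mem] by (simp add: cinner_commute[of "J \<phi>" \<psi>])
    finally show ?thesis using s by simp
  qed
  have J: "inner \<psi> (J \<psi>) = (norm (J \<psi>))\<^sup>2 + (norm (Y \<psi>))\<^sup>2 / s" for \<psi>
  proof -
    have "s * inner \<psi> (J \<psi>) = s * (norm (J \<psi>))\<^sup>2 + (norm (Y \<psi>))\<^sup>2"
      using arg_cong[OF eq[OF mem[of \<psi>], of \<psi>], of Re] by (simp add: inner_L2_def cinner_norm)
    then show ?thesis using s by (simp add: field_simps)
  qed
  have energy: "inner \<psi> (\<psi> - J \<psi>) = (norm (Y \<psi>))\<^sup>2 / s + (norm (\<psi> - J \<psi>))\<^sup>2" for \<psi>
    using J[of \<psi>] by (simp add: power2_norm_eq_inner inner_diff_left inner_diff_right inner_commute)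
  define B where "B \<psi> = s *\<^sub>R (\<psi> - J \<psi>)" for \<psi>
  have B_energy: "inner \<psi> (B \<psi>) = (norm (Y \<psi>))\<^sup>2 + s * (norm (\<psi> - J \<psi>))\<^sup>2" for \<psi>
    using s by (simp add: B_def energy distrib_left)
  have B: "nonneg_operator B"
  proof (rule nonneg_operatorI)
    show "cinner \<phi> (B \<psi>) = cinner (B \<phi>) \<psi>" for \<phi> \<psi>
      by (simp add: B_def cinner_diff_left cinner_diff_right J_herm)
    show "0 \<le> Re (cinner \<psi> (B \<psi>))" for \<psi>
      using s by (simp add: Re_cinner B_energy)
    show "norm (B \<psi>) \<le> norm \<psi> * s" for \<psi>
    proof -
      have "(norm (\<psi> - J \<psi>))\<^sup>2 \<le> inner \<psi> (\<psi> - J \<psi>)" unfolding energy using s by simp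
      also have "\<dots> \<le> norm \<psi> * norm (\<psi> - J \<psi>)" by (rule norm_cauchy_schwarz)
      finally have "norm (\<psi> - J \<psi>) \<le> norm \<psi>"
        by (cases "\<psi> - J \<psi> = 0") (auto simp: power2_eq_square)
      then show ?thesis using s by (simp add: B_def mult.commute mult_right_mono)
    qed
  qed
  have "(norm (op_sqrt B \<psi>))\<^sup>2 = (norm (Y \<psi>))\<^sup>2 + s * (norm (\<psi> - J \<psi>))\<^sup>2" for \<psi>
    unfolding norm_op_sqrt[OF B] Re_cinner by (rule B_energy)
  with m op_sqrt(1)[OF B] show ?thesis by blast
qed

text \<open>The envelopes with \<open>s = n + 1\<close> increase in \<open>n\<close> and stay below the form, as \<open>(\<psi>, \<eta>)\<close> itself competes. Where they
stay bounded, Pythagoras makes the minimizers Cauchy; the limit has first component \<open>\<psi>\<close>, and closedness puts it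
into the graph.\<close>

theorem square_form_approximation:
  fixes A :: "'a::euclidean_space unbounded_operator"
  assumes A: "closed_linear_relation A"
  obtains C :: "nat \<Rightarrow> 'a L2 \<Rightarrow> 'a L2" where
    "\<And>n. nonneg_operator (C n)" "\<And>\<psi>. incseq (\<lambda>n. (norm (C n \<psi>))\<^sup>2)"
    "\<And>\<psi>. square_form A \<psi> = (SUP n. ennreal ((norm (C n \<psi>))\<^sup>2))"
proof -
  have "\<forall>n. \<exists>C. nonneg_operator C \<and> (\<forall>\<psi>. \<exists>\<phi> \<eta>. envelope_point A (real (Suc n)) \<psi> \<phi> \<eta> \<and>
     (norm (C \<psi>))\<^sup>2 = (norm \<eta>)\<^sup>2 + real (Suc n) * (norm (\<psi> - \<phi>))\<^sup>2)"
    using envelope_operator[OF A] by simp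
  then obtain C where C: "\<And>n. nonneg_operator (C n)"
    and ex: "\<And>n \<psi>. \<exists>\<phi> \<eta>. envelope_point A (real (Suc n)) \<psi> \<phi> \<eta> \<and>
     (norm (C n \<psi>))\<^sup>2 = (norm \<eta>)\<^sup>2 + real (Suc n) * (norm (\<psi> - \<phi>))\<^sup>2" by metis
  obtain J Y where m: "\<And>n \<psi>. envelope_point A (real (Suc n)) \<psi> (J n \<psi>) (Y n \<psi>)"
    and E: "\<And>n \<psi>. (norm (C n \<psi>))\<^sup>2 = (norm (Y n \<psi>))\<^sup>2 + real (Suc n) * (norm (\<psi> - J n \<psi>))\<^sup>2"
    using ex by metis
  have mem: "(J n \<psi>, Y n \<psi>) \<in> A" for n \<psi> using m by (auto simp: envelope_point_def)
  have gap: "(norm (C n \<psi>))\<^sup>2 + (norm (Y k \<psi> - Y n \<psi>))\<^sup>2 \<le> (norm (C k \<psi>))\<^sup>2" if "n \<le> k" for n k \<psi>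
  proof -
    have "(norm (C n \<psi>))\<^sup>2 + (norm (Y k \<psi> - Y n \<psi>))\<^sup>2 \<le>
        (norm (Y k \<psi>))\<^sup>2 + real (Suc n) * (norm (\<psi> - J k \<psi>))\<^sup>2"
      unfolding E[of n] envelope_pythagoras[OF A m[of n \<psi>] mem[of k \<psi>]] by simp
    also have "\<dots> \<le> (norm (C k \<psi>))\<^sup>2" unfolding E[of k] using that by (intro add_left_mono mult_right_mono) auto
    finally show ?thesis .
  qed
  have inc: "incseq (\<lambda>n. (norm (C n \<psi>))\<^sup>2)" for \<psi>
  proof (rule incseq_SucI)
    show "(norm (C n \<psi>))\<^sup>2 \<le> (norm (C (Suc n) \<psi>))\<^sup>2" for n
      using gap[of n "Suc n" \<psi>] zero_le_power2[of "norm (Y (Suc n) \<psi> - Y n \<psi>)"] by linarith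
  qed
  have "square_form A \<psi> = (SUP n. ennreal ((norm (C n \<psi>))\<^sup>2))" for \<psi>
  proof (rule antisym)
    show "(SUP n. ennreal ((norm (C n \<psi>))\<^sup>2)) \<le> square_form A \<psi>"
      unfolding square_form_def
    proof (intro SUP_least INF_greatest ennreal_leI)
      fix n \<eta> assume "\<eta> \<in> {\<eta>. (\<psi>, \<eta>) \<in> A}"
      then have "(\<psi>, \<eta>) \<in> A" by simp
      from envelope_pythagoras[OF A m[of n \<psi>] this]
      have "(norm \<eta>)\<^sup>2 = (norm (C n \<psi>))\<^sup>2 + (norm (\<eta> - Y n \<psi>))\<^sup>2 + real (Suc n) * (norm (\<psi> - J n \<psi>))\<^sup>2"
        unfolding E by simp
      moreover have "0 \<le> real (Suc n) * (norm (\<psi> - J n \<psi>))\<^sup>2" by simp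
      ultimately show "(norm (C n \<psi>))\<^sup>2 \<le> (norm \<eta>)\<^sup>2"
        using zero_le_power2[of "norm (\<eta> - Y n \<psi>)"] by linarith
    qed
    show "square_form A \<psi> \<le> (SUP n. ennreal ((norm (C n \<psi>))\<^sup>2))"
    proof (cases "(SUP n. ennreal ((norm (C n \<psi>))\<^sup>2)) = \<infinity>")
      case True
      show ?thesis unfolding True by simp
    next
      case False
      then obtain L where L: "(SUP n. ennreal ((norm (C n \<psi>))\<^sup>2)) = ennreal L" "0 \<le> L"
        by (cases "SUP n. ennreal ((norm (C n \<psi>))\<^sup>2)") auto
      have E_le: "(norm (C n \<psi>))\<^sup>2 \<le> L" for n
      proof -
        have "ennreal ((norm (C n \<psi>))\<^sup>2) \<le> ennreal L" unfolding L(1)[symmetric] by (rule SUP_upper) simp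
        then show ?thesis using L(2) by simp
      qed
      have E_Cauchy: "Cauchy (\<lambda>n. (norm (C n \<psi>))\<^sup>2)"
        using inc[of \<psi>] E_le by (intro convergent_Cauchy) (auto intro: incseq_convergent simp: convergent_def)
      have "Cauchy (\<lambda>n. Y n \<psi>)"
      proof (rule metric_CauchyI)
        fix e :: real assume "e > 0"
        then obtain N where N: "\<And>i j. i \<ge> N \<Longrightarrow> j \<ge> N \<Longrightarrow> \<bar>(norm (C i \<psi>))\<^sup>2 - (norm (C j \<psi>))\<^sup>2\<bar> < e\<^sup>2"
          using CauchyD[OF E_Cauchy, of "e\<^sup>2"] by (auto simp: real_norm_def)
        have "dist (Y i \<psi>) (Y j \<psi>) < e" if "i \<ge> N" "j \<ge> N" for i j
        proof -
          have "(norm (Y i \<psi> - Y j \<psi>))\<^sup>2 \<le> \<bar>(norm (C i \<psi>))\<^sup>2 - (norm (C j \<psi>))\<^sup>2\<bar>"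
            using gap[of i j \<psi>] gap[of j i \<psi>] by (cases "i \<le> j") (auto simp: norm_minus_commute)
          also have "\<dots> < e\<^sup>2" using N that by blast
          finally show ?thesis using \<open>e > 0\<close> by (simp add: dist_norm power2_less_imp_less)
        qed
        then show "\<exists>M. \<forall>i\<ge>M. \<forall>j\<ge>M. dist (Y i \<psi>) (Y j \<psi>) < e" by blast
      qed
      then obtain \<eta> where \<eta>: "(\<lambda>n. Y n \<psi>) \<longlonglongrightarrow> \<eta>" by (auto simp: Cauchy_convergent_iff convergent_def)
      have J_near: "(norm (J n \<psi> - \<psi>))\<^sup>2 \<le> L * inverse (real (Suc n))" for n
      proof -
        have "real (Suc n) * (norm (\<psi> - J n \<psi>))\<^sup>2 \<le> L" using E_le[of n] unfolding E using zero_le_power2[of "norm (Y n \<psi>)"] by linarith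
        then show ?thesis by (simp add: field_simps norm_minus_commute)
      qed
      have "(\<lambda>n. (norm (J n \<psi> - \<psi>))\<^sup>2) \<longlonglongrightarrow> 0"
      proof (rule tendsto_sandwich[OF _ _ tendsto_const])
        show "(\<lambda>n. L * inverse (real (Suc n))) \<longlonglongrightarrow> 0"
          using tendsto_mult[OF tendsto_const LIMSEQ_inverse_real_of_nat, of L] by simp
      qed (use J_near in auto)
      then have "(\<lambda>n. sqrt ((norm (J n \<psi> - \<psi>))\<^sup>2)) \<longlonglongrightarrow> sqrt 0" by (rule tendsto_real_sqrt)
      then have "(\<lambda>n. J n \<psi> - \<psi>) \<longlonglongrightarrow> 0" by (simp add: tendsto_norm_zero_iff)
      then have J: "(\<lambda>n. J n \<psi>) \<longlonglongrightarrow> \<psi>" by (rule LIM_zero_cancel)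
      have "(\<psi>, \<eta>) \<in> A"
        by (rule closed_sequentially[OF closed_linear_relationD(1)[OF A] _ tendsto_Pair[OF J \<eta>]]) (rule mem)
      then have "square_form A \<psi> \<le> ennreal ((norm \<eta>)\<^sup>2)"
        unfolding square_form_def by (intro INF_lower) simp
      also have "(norm \<eta>)\<^sup>2 \<le> L"
      proof (rule LIMSEQ_le_const2)
        show "(\<lambda>n. (norm (Y n \<psi>))\<^sup>2) \<longlonglongrightarrow> (norm \<eta>)\<^sup>2" by (intro tendsto_intros \<eta>)
        have "(norm (Y n \<psi>))\<^sup>2 \<le> L" for n
        proof -
          have "0 \<le> real (Suc n) * (norm (\<psi> - J n \<psi>))\<^sup>2" by simp
          then show ?thesis using E_le[of n] unfolding E by linarith
        qed
        then show "\<exists>N. \<forall>n\<ge>N. (norm (Y n \<psi>))\<^sup>2 \<le> L" by blast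
      qed
      finally show ?thesis unfolding L(1) by (simp add: ennreal_leI)
    qed
  qed
  with C inc show thesis by (rule that)
qed

lemma form_trace_approximation:
  fixes A :: "'a::euclidean_space unbounded_operator"
  assumes A: "closed_linear_relation A"
  obtains a :: "nat \<Rightarrow> 'a L2 \<Rightarrow> 'a L2" where
    "\<And>T. nonneg_operator T \<Longrightarrow> form_trace (square_form A) T =
       (SUP n. \<integral>\<^sup>+e. ennreal (Re (cinner (a n e) (T (a n e)))) \<partial>count_space L2_basis)"
proof -
  obtain C :: "nat \<Rightarrow> 'a L2 \<Rightarrow> 'a L2" where C: "\<And>n. nonneg_operator (C n)"
    and inc: "\<And>\<psi>. incseq (\<lambda>n. (norm (C n \<psi>))\<^sup>2)"
    and sup: "\<And>\<psi>. square_form A \<psi> = (SUP n. ennreal ((norm (C n \<psi>))\<^sup>2))"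
    by (rule square_form_approximation[OF A]) blast
  show thesis
  proof (rule that)
    fix T :: "'a L2 \<Rightarrow> 'a L2" assume T: "nonneg_operator T"
    have "form_trace (square_form A) T =
        (\<integral>\<^sup>+e. (SUP n. ennreal ((norm (C n (op_sqrt T e)))\<^sup>2)) \<partial>count_space L2_basis)"
      unfolding form_trace_nn_integral sup ..
    also have "\<dots> = (SUP n. \<integral>\<^sup>+e. ennreal ((norm (C n (op_sqrt T e)))\<^sup>2) \<partial>count_space L2_basis)"
      using inc by (intro nn_integral_monotone_convergence_SUP)
        (auto simp: incseq_def le_fun_def intro!: ennreal_leI)
    finally show "form_trace (square_form A) T =
       (SUP n. \<integral>\<^sup>+e. ennreal (Re (cinner (C n e) (T (C n e)))) \<partial>count_space L2_basis)"
      by (simp only: trace_sqrt_conjugation[OF T C])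
  qed
qed

lemma measurable_form_trace:
  fixes Q :: "'z \<Rightarrow> 'a::euclidean_space L2 \<Rightarrow> 'a L2"
  assumes A: "closed_linear_relation A"
    and Q: "\<And>z. nonneg_operator (Q z)" "\<And>\<phi> \<psi>. (\<lambda>z. cinner \<phi> (Q z \<psi>)) \<in> borel_measurable M"
  shows "(\<lambda>z. form_trace (square_form A) (Q z)) \<in> borel_measurable M"
proof -
  note [measurable] = Q(2)
  obtain a :: "nat \<Rightarrow> 'a L2 \<Rightarrow> 'a L2" where
    a: "\<And>T. nonneg_operator T \<Longrightarrow> form_trace (square_form A) T =
       (SUP n. \<integral>\<^sup>+e. ennreal (Re (cinner (a n e) (T (a n e)))) \<partial>count_space L2_basis)"
    by (rule form_trace_approximation[OF A]) blast
  show ?thesis unfolding a[OF Q(1)]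
    by (intro borel_measurable_SUP borel_measurable_nn_integral_count_space countable_basis_L2) auto
qed

text \<open>For each bounded approximant the trace is linear in the operator, hence commutes with the integral; the
supremum over the approximants is taken last.\<close>

lemma form_trace_weak_integral_le:
  fixes Q :: "'z \<Rightarrow> 'a::euclidean_space L2 \<Rightarrow> 'a L2"
  assumes A: "closed_linear_relation A" and T: "nonneg_operator T"
    and Q: "\<And>z. nonneg_operator (Q z)" "\<And>\<phi> \<psi>. (\<lambda>z. cinner \<phi> (Q z \<psi>)) \<in> borel_measurable M"
    and w [measurable]: "w \<in> borel_measurable M"
    and TQ: "\<And>\<psi>. ennreal (Re (cinner \<psi> (T \<psi>))) = (\<integral>\<^sup>+z. w z * ennreal (Re (cinner \<psi> (Q z \<psi>))) \<partial>M)"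
  shows "form_trace (square_form A) T \<le> (\<integral>\<^sup>+z. w z * form_trace (square_form A) (Q z) \<partial>M)"
proof -
  note [measurable] = Q(2)
  obtain a :: "nat \<Rightarrow> 'a L2 \<Rightarrow> 'a L2" where
    a: "\<And>T. nonneg_operator T \<Longrightarrow> form_trace (square_form A) T =
       (SUP n. \<integral>\<^sup>+e. ennreal (Re (cinner (a n e) (T (a n e)))) \<partial>count_space L2_basis)"
    by (rule form_trace_approximation[OF A]) blast
  show ?thesis unfolding a[OF T]
  proof (rule SUP_least)
    fix n
    have "(\<integral>\<^sup>+e. ennreal (Re (cinner (a n e) (T (a n e)))) \<partial>count_space L2_basis) =
        (\<integral>\<^sup>+z. \<integral>\<^sup>+e. w z * ennreal (Re (cinner (a n e) (Q z (a n e)))) \<partial>count_space L2_basis \<partial>M)"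
      unfolding TQ by (rule nn_integral_count_space_nn_integral[OF countable_basis_L2, symmetric]) measurable
    also have "\<dots> = (\<integral>\<^sup>+z. w z * (\<integral>\<^sup>+e. ennreal (Re (cinner (a n e) (Q z (a n e)))) \<partial>count_space L2_basis) \<partial>M)"
      by (simp add: nn_integral_cmult)
    also have "\<dots> \<le> (\<integral>\<^sup>+z. w z * form_trace (square_form A) (Q z) \<partial>M)"
      unfolding a[OF Q(1)] by (intro nn_integral_mono mult_left_mono SUP_upper) auto
    finally show "(\<integral>\<^sup>+e. ennreal (Re (cinner (a n e) (T (a n e)))) \<partial>count_space L2_basis) \<le>
        (\<integral>\<^sup>+z. w z * form_trace (square_form A) (Q z) \<partial>M)" .
  qed
qed

lemma op_trace_weak_integral:
  fixes Q :: "'z \<Rightarrow> 'a::euclidean_space L2 \<Rightarrow> 'a L2"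
  assumes Q: "\<And>\<phi> \<psi>. (\<lambda>z. cinner \<phi> (Q z \<psi>)) \<in> borel_measurable M"
    and w [measurable]: "w \<in> borel_measurable M"
    and TQ: "\<And>\<psi>. ennreal (Re (cinner \<psi> (T \<psi>))) = (\<integral>\<^sup>+z. w z * ennreal (Re (cinner \<psi> (Q z \<psi>))) \<partial>M)"
  shows "op_trace T = (\<integral>\<^sup>+z. w z * op_trace (Q z) \<partial>M)"
proof -
  note [measurable] = Q
  have "op_trace T = (\<integral>\<^sup>+z. \<integral>\<^sup>+e. w z * ennreal (Re (cinner e (Q z e))) \<partial>count_space L2_basis \<partial>M)"
    unfolding op_trace_nn_integral TQ
    by (rule nn_integral_count_space_nn_integral[OF countable_basis_L2, symmetric]) measurable
  also have "\<dots> = (\<integral>\<^sup>+z. w z * op_trace (Q z) \<partial>M)"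
    by (simp add: nn_integral_cmult op_trace_nn_integral)
  finally show ?thesis .
qed

lemma measurable_op_trace:
  assumes [measurable]: "\<And>\<phi> \<psi>. (\<lambda>z. cinner \<phi> (Q z \<psi>)) \<in> borel_measurable M"
  shows "(\<lambda>z. op_trace (Q z)) \<in> borel_measurable M"
  unfolding op_trace_nn_integral
  by (intro borel_measurable_nn_integral_count_space countable_basis_L2) auto

section \<open>Position and momentum have closed graphs\<close>

lemma is_multiple_iff: "is_multiple m \<psi> \<eta> \<longleftrightarrow> (AE y in lborel. rep_L2 \<eta> y = complex_of_real (m y) * rep_L2 \<psi> y)"
  by (simp add: is_multiple_def)

lemma closed_mult_operator:
  fixes m :: "'a::euclidean_space \<Rightarrow> real"
  shows "closed_linear_relation (mult_operator m)"
  unfolding closed_linear_relation_def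
proof (intro conjI allI impI)
  show "closed (mult_operator m)"
    unfolding closed_sequential_limits
  proof (intro allI impI, elim conjE)
    fix X :: "nat \<Rightarrow> 'a L2 \<times> 'a L2" and l
    assume mem: "\<forall>n. X n \<in> mult_operator m" and lim: "X \<longlonglongrightarrow> l"
    obtain r where r: "strict_mono r"
      and r_lim: "AE x in lborel. (\<lambda>n. rep_L2 (fst (X (r n))) x) \<longlonglongrightarrow> rep_L2 (fst l) x"
      using L2_tendsto_AE_subseq[OF tendsto_fst[OF lim]] by blast
    have "(\<lambda>n. snd (X (r n))) \<longlonglongrightarrow> snd l"
      using LIMSEQ_subseq_LIMSEQ[OF tendsto_snd[OF lim] r] by (simp add: o_def)
    then obtain s where s: "strict_mono s"
      and s_lim: "AE x in lborel. (\<lambda>n. rep_L2 (snd (X (r (s n)))) x) \<longlonglongrightarrow> rep_L2 (snd l) x"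
      using L2_tendsto_AE_subseq by blast
    have "AE x in lborel. \<forall>n. rep_L2 (snd (X n)) x = complex_of_real (m x) * rep_L2 (fst (X n)) x"
      unfolding AE_all_countable using mem by (simp add: mult_operator_def is_multiple_iff case_prod_beta)
    then have "AE x in lborel. rep_L2 (snd l) x = complex_of_real (m x) * rep_L2 (fst l) x"
      using r_lim s_lim
    proof eventually_elim
      case (elim x)
      have "(\<lambda>n. rep_L2 (fst (X (r (s n)))) x) \<longlonglongrightarrow> rep_L2 (fst l) x"
        using LIMSEQ_subseq_LIMSEQ[OF elim(2) s] by (simp add: o_def)
      then have "(\<lambda>n. rep_L2 (snd (X (r (s n)))) x) \<longlonglongrightarrow> complex_of_real (m x) * rep_L2 (fst l) x"
        unfolding elim(1)[rule_format] by (intro tendsto_intros)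
      then show ?case by (rule LIMSEQ_unique[OF elim(3)])
    qed
    then show "l \<in> mult_operator m" by (cases l) (simp add: mult_operator_def is_multiple_iff)
  qed
  have "AE y in lborel. rep_L2 (0 :: 'a L2) y = complex_of_real (m y) * rep_L2 (0 :: 'a L2) y"
    using rep_L2_zero by eventually_elim simp
  then show "(0, 0) \<in> mult_operator m" by (simp add: mult_operator_def is_multiple_iff)
next
  fix \<phi> \<eta> \<phi>' \<eta>' :: "'a L2"
  assume "(\<phi>, \<eta>) \<in> mult_operator m" "(\<phi>', \<eta>') \<in> mult_operator m"
  then have 1: "AE y in lborel. rep_L2 \<eta> y = complex_of_real (m y) * rep_L2 \<phi> y"
    and 2: "AE y in lborel. rep_L2 \<eta>' y = complex_of_real (m y) * rep_L2 \<phi>' y"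
    by (auto simp: mult_operator_def is_multiple_iff)
  have "AE y in lborel. rep_L2 (\<eta> + \<eta>') y = complex_of_real (m y) * rep_L2 (\<phi> + \<phi>') y"
    using 1 2 rep_L2_plus[of \<eta> \<eta>'] rep_L2_plus[of \<phi> \<phi>'] by eventually_elim (simp add: distrib_left)
  then show "(\<phi> + \<phi>', \<eta> + \<eta>') \<in> mult_operator m" by (simp add: mult_operator_def is_multiple_iff)
next
  fix c and \<phi> \<eta> :: "'a L2"
  assume "(\<phi>, \<eta>) \<in> mult_operator m"
  then have 1: "AE y in lborel. rep_L2 \<eta> y = complex_of_real (m y) * rep_L2 \<phi> y"
    by (auto simp: mult_operator_def is_multiple_iff)
  have "AE y in lborel. rep_L2 (c *\<^sub>C \<eta>) y = complex_of_real (m y) * rep_L2 (c *\<^sub>C \<phi>) y"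
    using 1 rep_L2_scaleC[of c \<eta>] rep_L2_scaleC[of c \<phi>] by eventually_elim simp
  then show "(c *\<^sub>C \<phi>, c *\<^sub>C \<eta>) \<in> mult_operator m" by (simp add: mult_operator_def is_multiple_iff)
qed

lemma square_integrable_compact_support:
  fixes f :: "'a::euclidean_space \<Rightarrow> real"
  assumes f: "continuous_on UNIV f" and K: "compact K" "\<And>y. y \<notin> K \<Longrightarrow> f y = 0"
  shows "square_integrable (\<lambda>y. complex_of_real (f y))"
proof (rule square_integrableI_nn)
  have [measurable]: "f \<in> borel_measurable borel" using f by (rule borel_measurable_continuous_onI)
  show "(\<lambda>y. complex_of_real (f y)) \<in> borel_measurable borel" by measurable
  have [measurable]: "K \<in> sets borel" using K(1) by (rule borel_compact)
  have "compact (f ` K)" using f K(1) by (intro compact_continuous_image) (auto intro: continuous_on_subset)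
  then obtain B where "\<forall>x\<in>f ` K. norm x \<le> B" using compact_imp_bounded bounded_iff by blast
  then have B: "\<bar>f y\<bar> \<le> B" if "y \<in> K" for y using that by simp
  have "(\<integral>\<^sup>+y. ennreal ((cmod (complex_of_real (f y)))\<^sup>2) \<partial>lborel) \<le> (\<integral>\<^sup>+y. ennreal (B\<^sup>2) * indicator K y \<partial>lborel)"
  proof (intro nn_integral_mono)
    fix y
    show "ennreal ((cmod (complex_of_real (f y)))\<^sup>2) \<le> ennreal (B\<^sup>2) * indicator K y"
      using B[of y] K(2)[of y] by (cases "y \<in> K") (auto intro!: ennreal_leI simp: abs_le_square_iff[symmetric])
  qed
  also have "\<dots> = ennreal (B\<^sup>2) * emeasure lborel K" by (simp add: nn_integral_cmult)
  also have "\<dots> < \<infinity>" using emeasure_compact_finite[OF K(1)] by (simp add: ennreal_mult_less_top)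
  finally show "(\<integral>\<^sup>+y. ennreal ((cmod (complex_of_real (f y)))\<^sup>2) \<partial>lborel) < \<infinity>" .
qed

lemma test_function_square_integrable:
  fixes \<phi> :: "'a::euclidean_space \<Rightarrow> real"
  assumes t: "test_function \<phi> D"
  shows "square_integrable (\<lambda>y. complex_of_real (\<phi> y))" "square_integrable (\<lambda>y. complex_of_real (D y b))"
proof -
  obtain K where K: "compact K" "\<And>y. y \<notin> K \<Longrightarrow> \<phi> y = 0" using t by (auto simp: test_function_def)
  have der: "(\<phi> has_derivative D y) (at y)" for y using t by (auto simp: test_function_def)
  have "continuous_on UNIV \<phi>"
    using der has_derivative_continuous by (blast intro: continuous_at_imp_continuous_on)
  then show "square_integrable (\<lambda>y. complex_of_real (\<phi> y))" using K by (rule square_integrable_compact_support)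
  have "D y b = 0" if "y \<notin> K" for y
  proof -
    have "((\<lambda>_. 0) has_derivative D y) (at y)"
      by (rule has_derivative_transform_within_open[OF der, of "- K"])
         (use that K in \<open>auto simp: compact_imp_closed open_Compl\<close>)
    then have "D y = (\<lambda>_. 0)" using has_derivative_const by (rule has_derivative_unique)
    then show ?thesis by simp
  qed
  moreover have "continuous_on UNIV (\<lambda>y. D y b)" using t by (auto simp: test_function_def)
  ultimately show "square_integrable (\<lambda>y. complex_of_real (D y b))"
    using K(1) by (intro square_integrable_compact_support)
qed

text \<open>In this form the weak derivative is a family of equations between continuous functionals, so that its graph is
visibly linear and closed.\<close>

lemma weak_partial_iff:
  "weak_partial b \<psi> \<eta> \<longleftrightarrow> (\<forall>\<phi> D. test_function \<phi> D \<longrightarrow>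
     cinner (abs_L2 (\<lambda>y. complex_of_real (D y b))) \<psi> = - cinner (abs_L2 (\<lambda>y. complex_of_real (\<phi> y))) \<eta>)"
proof -
  have "cinner (abs_L2 (\<lambda>y. complex_of_real (u y))) \<zeta> = (LINT y|lborel. complex_of_real (u y) * rep_L2 \<zeta> y)"
    if "square_integrable (\<lambda>y. complex_of_real (u y))" for u :: "'a \<Rightarrow> real" and \<zeta>
    using cinner_abs_L2[OF that square_integrable_rep_L2[of \<zeta>]] by simp
  then show ?thesis
    by (simp add: weak_partial_def test_function_square_integrable cong: imp_cong)
qed

lemma closed_weak_partial:
  fixes X Y :: "nat \<Rightarrow> 'a::euclidean_space L2"
  assumes "\<And>n. weak_partial b (X n) (Y n)" "X \<longlonglongrightarrow> \<psi>" "Y \<longlonglongrightarrow> \<eta>"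
  shows "weak_partial b \<psi> \<eta>"
  unfolding weak_partial_iff
proof (intro allI impI)
  fix \<phi> :: "'a \<Rightarrow> real" and D assume t: "test_function \<phi> D"
  let ?d = "abs_L2 (\<lambda>y. complex_of_real (D y b))" and ?p = "abs_L2 (\<lambda>y. complex_of_real (\<phi> y))"
  have "(\<lambda>n. cinner ?d (X n)) \<longlonglongrightarrow> cinner ?d \<psi>" by (intro tendsto_intros assms)
  moreover have "(\<lambda>n. - cinner ?p (Y n)) \<longlonglongrightarrow> - cinner ?p \<eta>" by (intro tendsto_intros assms)
  moreover have "cinner ?d (X n) = - cinner ?p (Y n)" for n
    using assms(1)[of n] t unfolding weak_partial_iff by blast
  ultimately show "cinner ?d \<psi> = - cinner ?p \<eta>" by (simp add: LIMSEQ_unique)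
qed

lemma closed_shifted_momentum:
  fixes b :: "'a::euclidean_space"
  assumes "h \<noteq> 0"
  shows "closed_linear_relation (shifted_momentum h s b)"
proof -
  let ?k = "\<i> * complex_of_real h" and ?s = "complex_of_real s"
  have k: "?k \<noteq> 0" using assms by simp
  have iff: "(\<psi>, \<zeta>) \<in> shifted_momentum h s b \<longleftrightarrow> weak_partial b \<psi> ((1 / ?k) *\<^sub>C (\<zeta> - ?s *\<^sub>C \<psi>))" for \<psi> \<zeta>
  proof
    assume "(\<psi>, \<zeta>) \<in> shifted_momentum h s b"
    then obtain \<eta> where "\<zeta> = ?s *\<^sub>C \<psi> + ?k *\<^sub>C \<eta>" "weak_partial b \<psi> \<eta>" by (auto simp: shifted_momentum_def)
    then show "weak_partial b \<psi> ((1 / ?k) *\<^sub>C (\<zeta> - ?s *\<^sub>C \<psi>))"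
      using k by (simp add: scaleC_scaleC scaleC_one)
  next
    assume w: "weak_partial b \<psi> ((1 / ?k) *\<^sub>C (\<zeta> - ?s *\<^sub>C \<psi>))"
    have "\<zeta> = ?s *\<^sub>C \<psi> + ?k *\<^sub>C (1 / ?k) *\<^sub>C (\<zeta> - ?s *\<^sub>C \<psi>)"
      using k by (simp only: scaleC_scaleC) (simp add: scaleC_one)
    then show "(\<psi>, \<zeta>) \<in> shifted_momentum h s b"
      unfolding shifted_momentum_def using w by blast
  qed
  show ?thesis
    unfolding closed_linear_relation_def
  proof (intro conjI allI impI)
    show "closed (shifted_momentum h s b)"
      unfolding closed_sequential_limits
    proof (intro allI impI, elim conjE)
      fix X :: "nat \<Rightarrow> 'a L2 \<times> 'a L2" and l
      assume mem: "\<forall>n. X n \<in> shifted_momentum h s b" and lim: "X \<longlonglongrightarrow> l"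
      have "weak_partial b (fst l) ((1 / ?k) *\<^sub>C (snd l - ?s *\<^sub>C fst l))"
      proof (rule closed_weak_partial)
        show "weak_partial b (fst (X n)) ((1 / ?k) *\<^sub>C (snd (X n) - ?s *\<^sub>C fst (X n)))" for n
          using mem iff[of "fst (X n)" "snd (X n)"] by simp
        show "(\<lambda>n. fst (X n)) \<longlonglongrightarrow> fst l" by (intro tendsto_intros lim)
        show "(\<lambda>n. (1 / ?k) *\<^sub>C (snd (X n) - ?s *\<^sub>C fst (X n))) \<longlonglongrightarrow> (1 / ?k) *\<^sub>C (snd l - ?s *\<^sub>C fst l)"
          by (intro tendsto_scaleC tendsto_intros lim)
      qed
      then show "l \<in> shifted_momentum h s b" using iff[of "fst l" "snd l"] by simp
    qed
    have "weak_partial b (0 :: 'a L2) 0" by (simp add: weak_partial_iff)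
    moreover have "(0 :: 'a L2) = ?s *\<^sub>C 0 + ?k *\<^sub>C 0" by (simp add: scaleC_zero_right)
    ultimately show "(0, 0) \<in> shifted_momentum h s b" unfolding shifted_momentum_def by blast
  next
    fix \<phi> \<zeta> \<phi>' \<zeta>' :: "'a L2"
    assume "(\<phi>, \<zeta>) \<in> shifted_momentum h s b" "(\<phi>', \<zeta>') \<in> shifted_momentum h s b"
    then obtain \<eta> \<eta>' where "\<zeta> = ?s *\<^sub>C \<phi> + ?k *\<^sub>C \<eta>" "\<zeta>' = ?s *\<^sub>C \<phi>' + ?k *\<^sub>C \<eta>'"
      and w: "weak_partial b \<phi> \<eta>" "weak_partial b \<phi>' \<eta>'"
      by (auto simp: shifted_momentum_def)
    then have "\<zeta> + \<zeta>' = ?s *\<^sub>C (\<phi> + \<phi>') + ?k *\<^sub>C (\<eta> + \<eta>')"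
      by (simp add: scaleC_add_right add_ac)
    moreover have "weak_partial b (\<phi> + \<phi>') (\<eta> + \<eta>')"
      using w by (simp add: weak_partial_iff cinner_add_right)
    ultimately show "(\<phi> + \<phi>', \<zeta> + \<zeta>') \<in> shifted_momentum h s b"
      unfolding shifted_momentum_def by blast
  next
    fix c and \<phi> \<zeta> :: "'a L2"
    assume "(\<phi>, \<zeta>) \<in> shifted_momentum h s b"
    then obtain \<eta> where "\<zeta> = ?s *\<^sub>C \<phi> + ?k *\<^sub>C \<eta>" and w: "weak_partial b \<phi> \<eta>"
      by (auto simp: shifted_momentum_def)
    then have "c *\<^sub>C \<zeta> = ?s *\<^sub>C (c *\<^sub>C \<phi>) + ?k *\<^sub>C (c *\<^sub>C \<eta>)"
      by (simp add: scaleC_add_right scaleC_scaleC mult_ac)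
    moreover have "weak_partial b (c *\<^sub>C \<phi>) (c *\<^sub>C \<eta>)"
      using w by (simp add: weak_partial_iff cinner_scaleC_right)
    ultimately show "(c *\<^sub>C \<phi>, c *\<^sub>C \<zeta>) \<in> shifted_momentum h s b"
      unfolding shifted_momentum_def by blast
  qed
qed

section \<open>Dependence of the cost on the phase-space point\<close>

text \<open>Adding \<open>r\<close> to an operator changes \<open>\<parallel>A \<psi>\<parallel>\<close> by at most \<open>\<bar>r\<bar> \<parallel>\<psi>\<parallel>\<close>, and
\<open>(x + y)\<^sup>2 \<le> (1 + t) x\<^sup>2 + (1 + 1/t) y\<^sup>2\<close>.\<close>

lemma square_form_shift:
  assumes shift: "\<And>\<eta>. (\<psi>, \<eta>) \<in> A \<Longrightarrow> (\<psi>, \<eta> + complex_of_real r *\<^sub>C \<psi>) \<in> A'" and t: "t > 0"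
  shows "square_form A' \<psi> \<le> ennreal (1 + t) * square_form A \<psi> + ennreal ((1 + 1 / t) * r\<^sup>2 * (norm \<psi>)\<^sup>2)"
proof (cases "{\<eta>. (\<psi>, \<eta>) \<in> A} = {}")
  case True
  then show ?thesis using t by (simp add: square_form_def ennreal_mult_top)
next
  case False
  have "square_form A' \<psi> \<le> ennreal (1 + t) * ennreal ((norm \<eta>)\<^sup>2) + ennreal ((1 + 1 / t) * r\<^sup>2 * (norm \<psi>)\<^sup>2)"
    if "(\<psi>, \<eta>) \<in> A" for \<eta>
  proof -
    have "square_form A' \<psi> \<le> ennreal ((norm (\<eta> + complex_of_real r *\<^sub>C \<psi>))\<^sup>2)"
      unfolding square_form_def using shift[OF that] by (intro INF_lower) simp
    also have "\<dots> \<le> ennreal ((1 + t) * (norm \<eta>)\<^sup>2 + (1 + 1 / t) * r\<^sup>2 * (norm \<psi>)\<^sup>2)"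
    proof (rule ennreal_leI)
      define x where "x = norm \<eta>"
      define y where "y = \<bar>r\<bar> * norm \<psi>"
      have "norm (\<eta> + complex_of_real r *\<^sub>C \<psi>) \<le> x + y"
        using norm_triangle_ineq[of \<eta> "complex_of_real r *\<^sub>C \<psi>"] by (simp add: x_def y_def)
      then have "(norm (\<eta> + complex_of_real r *\<^sub>C \<psi>))\<^sup>2 \<le> (x + y)\<^sup>2" by (intro power_mono) auto
      also have "\<dots> \<le> (1 + t) * x\<^sup>2 + (1 + 1 / t) * y\<^sup>2"
      proof -
        have "0 \<le> (t * x - y)\<^sup>2 / t" using t by simp
        also have "\<dots> = t * x\<^sup>2 - 2 * x * y + y\<^sup>2 / t"
          using t by (simp add: power2_diff field_simps power2_eq_square)
        finally show ?thesis by (simp add: power2_sum algebra_simps)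
      qed
      also have "y\<^sup>2 = r\<^sup>2 * (norm \<psi>)\<^sup>2" by (simp add: y_def power_mult_distrib)
      finally show "(norm (\<eta> + complex_of_real r *\<^sub>C \<psi>))\<^sup>2 \<le> (1 + t) * (norm \<eta>)\<^sup>2 + (1 + 1 / t) * r\<^sup>2 * (norm \<psi>)\<^sup>2"
        by (simp add: x_def mult.assoc)
    qed
    finally show ?thesis using t by (simp add: ennreal_mult ennreal_plus)
  qed
  note step = this
  define c where "c = ennreal ((1 + 1 / t) * r\<^sup>2 * (norm \<psi>)\<^sup>2)"
  let ?S = "(\<lambda>\<eta>. ennreal ((norm \<eta>)\<^sup>2)) ` {\<eta>. (\<psi>, \<eta>) \<in> A}"
  have "square_form A' \<psi> \<le> (INF x\<in>?S. ennreal (1 + t) * x + c)"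
    using step by (intro INF_greatest) (auto simp: c_def)
  also have "\<dots> = ennreal (1 + t) * Inf ?S + c"
  proof (rule continuous_at_Inf_mono[symmetric])
    show "mono (\<lambda>x. ennreal (1 + t) * x + c)" by (intro monoI add_right_mono mult_left_mono) auto
    show "continuous (at_right (Inf ?S)) (\<lambda>x. ennreal (1 + t) * x + c)"
      unfolding continuous_within by (intro tendsto_add ennreal_tendsto_cmult tendsto_ident_at tendsto_const) simp
  qed (use False in auto)
  finally show ?thesis by (simp add: square_form_def c_def)
qed

lemma mult_operator_shift:
  assumes "(\<psi>, \<eta>) \<in> mult_operator m"
  shows "(\<psi>, \<eta> + complex_of_real r *\<^sub>C \<psi>) \<in> mult_operator (\<lambda>y. m y + r)"
proof -
  have "AE y in lborel. rep_L2 \<eta> y = complex_of_real (m y) * rep_L2 \<psi> y"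
    using assms by (simp add: mult_operator_def is_multiple_iff)
  then have "AE y in lborel. rep_L2 (\<eta> + complex_of_real r *\<^sub>C \<psi>) y = complex_of_real (m y + r) * rep_L2 \<psi> y"
    using rep_L2_plus[of \<eta> "complex_of_real r *\<^sub>C \<psi>"] rep_L2_scaleC[of "complex_of_real r" \<psi>]
    by eventually_elim (simp add: distrib_right)
  then show ?thesis by (simp add: mult_operator_def is_multiple_iff)
qed

lemma shifted_momentum_shift:
  assumes "(\<psi>, \<zeta>) \<in> shifted_momentum h s b"
  shows "(\<psi>, \<zeta> + complex_of_real r *\<^sub>C \<psi>) \<in> shifted_momentum h (s + r) b"
proof -
  obtain \<eta> where \<zeta>: "\<zeta> = complex_of_real s *\<^sub>C \<psi> + (\<i> * complex_of_real h) *\<^sub>C \<eta>" and w: "weak_partial b \<psi> \<eta>"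
    using assms by (auto simp: shifted_momentum_def)
  have "\<zeta> + complex_of_real r *\<^sub>C \<psi> =
      complex_of_real (s + r) *\<^sub>C \<psi> + (\<i> * complex_of_real h) *\<^sub>C \<eta>"
    unfolding \<zeta> by (simp add: scaleC_add_left add_ac)
  then show ?thesis unfolding shifted_momentum_def using w by blast
qed

lemma cost_form_shift:
  fixes x \<xi> x' \<xi>' :: "'a::euclidean_space"
  assumes t: "t > 0"
  shows "cost_form h x \<xi> \<psi> \<le> ennreal (1 + t) * cost_form h x' \<xi>' \<psi> +
     ennreal ((1 + 1 / t) * (dist (x, \<xi>) (x', \<xi>'))\<^sup>2) * (ennreal (1/2) * ennreal ((norm \<psi>)\<^sup>2))"
proof -
  let ?M = "\<lambda>x b. square_form (mult_operator (\<lambda>y. x \<bullet> b - y \<bullet> b)) \<psi>"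
  let ?P = "\<lambda>\<xi> b. square_form (shifted_momentum h (\<xi> \<bullet> b) b) \<psi>"
  let ?r = "\<lambda>u b. ennreal ((1 + 1 / t) * (u \<bullet> b)\<^sup>2 * (norm \<psi>)\<^sup>2)"
  have M: "?M x b \<le> ennreal (1 + t) * ?M x' b + ?r (x - x') b" for b :: 'a
  proof (rule square_form_shift[OF _ t])
    show "(\<psi>, \<eta> + complex_of_real ((x - x') \<bullet> b) *\<^sub>C \<psi>) \<in> mult_operator (\<lambda>y. x \<bullet> b - y \<bullet> b)"
      if "(\<psi>, \<eta>) \<in> mult_operator (\<lambda>y. x' \<bullet> b - y \<bullet> b)" for \<eta>
      using mult_operator_shift[OF that, of "(x - x') \<bullet> b"] by (simp add: inner_diff_left)
  qed
  have P: "?P \<xi> b \<le> ennreal (1 + t) * ?P \<xi>' b + ?r (\<xi> - \<xi>') b" for b :: 'a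
  proof (rule square_form_shift[OF _ t])
    show "(\<psi>, \<eta> + complex_of_real ((\<xi> - \<xi>') \<bullet> b) *\<^sub>C \<psi>) \<in> shifted_momentum h (\<xi> \<bullet> b) b"
      if "(\<psi>, \<eta>) \<in> shifted_momentum h (\<xi>' \<bullet> b) b" for \<eta>
      using shifted_momentum_shift[OF that, of "(\<xi> - \<xi>') \<bullet> b"] by (simp add: inner_diff_left)
  qed
  have sq: "(\<Sum>b\<in>Basis. (u \<bullet> b)\<^sup>2) = (norm u)\<^sup>2" for u :: 'a
    unfolding power2_norm_eq_inner euclidean_inner[of u u] by (simp only: power2_eq_square)
  have "(\<Sum>b\<in>Basis. ?r (x - x') b + ?r (\<xi> - \<xi>') b) =
      ennreal (\<Sum>b\<in>Basis. (1 + 1 / t) * (norm \<psi>)\<^sup>2 * (((x - x') \<bullet> b)\<^sup>2 + ((\<xi> - \<xi>') \<bullet> b)\<^sup>2))"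
    using t by (subst sum_ennreal[symmetric]) (auto simp: algebra_simps simp flip: ennreal_plus)
  also have "\<dots> = ennreal ((1 + 1 / t) * (dist (x, \<xi>) (x', \<xi>'))\<^sup>2 * (norm \<psi>)\<^sup>2)"
    unfolding sum_distrib_left[symmetric] sum.distrib sq
    by (simp add: dist_prod_def dist_norm mult_ac)
  finally have r: "(\<Sum>b\<in>Basis. ?r (x - x') b + ?r (\<xi> - \<xi>') b) =
      ennreal ((1 + 1 / t) * (dist (x, \<xi>) (x', \<xi>'))\<^sup>2) * ennreal ((norm \<psi>)\<^sup>2)"
    using t by (simp flip: ennreal_mult)
  have "(\<Sum>b\<in>Basis. ?M x b + ?P \<xi> b) \<le>
      (\<Sum>b\<in>Basis. (ennreal (1 + t) * ?M x' b + ?r (x - x') b) + (ennreal (1 + t) * ?P \<xi>' b + ?r (\<xi> - \<xi>') b))"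
    by (intro sum_mono add_mono M P)
  also have "\<dots> = ennreal (1 + t) * (\<Sum>b\<in>Basis. ?M x' b + ?P \<xi>' b) + (\<Sum>b\<in>Basis. ?r (x - x') b + ?r (\<xi> - \<xi>') b)"
    unfolding sum_distrib_left sum.distrib distrib_left by (simp add: add_ac)
  finally have "ennreal (1/2) * (\<Sum>b\<in>Basis. ?M x b + ?P \<xi> b) \<le> ennreal (1/2) * \<dots>"
    by (intro mult_left_mono) auto
  then show ?thesis unfolding cost_form_def r by (simp only: distrib_left mult_ac)
qed

lemma form_trace_cost_shift:
  fixes z z' :: "'a::euclidean_space \<times> 'a"
  assumes T: "nonneg_operator T" and t: "t > 0"
  shows "form_trace (cost_form h (fst z) (snd z)) T \<le>
     ennreal (1 + t) * form_trace (cost_form h (fst z') (snd z')) T +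
     ennreal ((1 + 1 / t) * (dist z z')\<^sup>2) * (ennreal (1/2) * op_trace T)"
proof -
  let ?c = "\<lambda>z. cost_form h (fst z) (snd z)"
  have "form_trace (?c z) T \<le> (\<integral>\<^sup>+e. ennreal (1 + t) * ?c z' (op_sqrt T e) +
      ennreal ((1 + 1 / t) * (dist z z')\<^sup>2) * (ennreal (1/2) * ennreal ((norm (op_sqrt T e))\<^sup>2)) \<partial>count_space L2_basis)"
    unfolding form_trace_nn_integral
    using cost_form_shift[OF t, of h "fst z" "snd z" _ "fst z'" "snd z'"] by (intro nn_integral_mono) simp
  also have "\<dots> = ennreal (1 + t) * form_trace (?c z') T +
     ennreal ((1 + 1 / t) * (dist z z')\<^sup>2) * (ennreal (1/2) * op_trace T)"
    unfolding op_trace_sqrt[OF T, symmetric] form_trace_nn_integral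
    by (simp add: nn_integral_add nn_integral_cmult)
  finally show ?thesis .
qed

lemma form_trace_cost:
  "form_trace (cost_form h x \<xi>) T = ennreal (1/2) *
     (\<Sum>b\<in>Basis. form_trace (square_form (mult_operator (\<lambda>y. x \<bullet> b - y \<bullet> b))) T +
                form_trace (square_form (shifted_momentum h (\<xi> \<bullet> b) b)) T)"
  unfolding form_trace_nn_integral cost_form_def
  by (simp add: nn_integral_cmult nn_integral_sum nn_integral_add)

lemma measurable_form_trace_fixed_cost:
  assumes h: "h \<noteq> 0" and Q: "\<And>z. nonneg_operator (Q z)" "\<And>\<phi> \<psi>. (\<lambda>z. cinner \<phi> (Q z \<psi>)) \<in> borel_measurable M"
  shows "(\<lambda>z. form_trace (cost_form h x \<xi>) (Q z)) \<in> borel_measurable M"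
  unfolding form_trace_cost
  by (intro borel_measurable_times_ennreal borel_measurable_const borel_measurable_sum borel_measurable_add
      measurable_form_trace closed_mult_operator closed_shifted_momentum h Q)

lemma form_trace_cost_weak_integral_le:
  assumes h: "h \<noteq> 0" and T: "nonneg_operator T"
    and Q: "\<And>z. nonneg_operator (Q z)" "\<And>\<phi> \<psi>. (\<lambda>z. cinner \<phi> (Q z \<psi>)) \<in> borel_measurable M"
    and w [measurable]: "w \<in> borel_measurable M"
    and TQ: "\<And>\<psi>. ennreal (Re (cinner \<psi> (T \<psi>))) = (\<integral>\<^sup>+z. w z * ennreal (Re (cinner \<psi> (Q z \<psi>))) \<partial>M)"
  shows "form_trace (cost_form h x \<xi>) T \<le> (\<integral>\<^sup>+z. w z * form_trace (cost_form h x \<xi>) (Q z) \<partial>M)"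
proof -
  let ?M = "\<lambda>b. square_form (mult_operator (\<lambda>y. x \<bullet> b - y \<bullet> b))"
  let ?P = "\<lambda>b. square_form (shifted_momentum h (\<xi> \<bullet> b) b)"
  note clM = closed_mult_operator and clP = closed_shifted_momentum[OF h]
  have [measurable]: "(\<lambda>z. form_trace (?M b) (Q z)) \<in> borel_measurable M"
    "(\<lambda>z. form_trace (?P b) (Q z)) \<in> borel_measurable M" for b
    by (intro measurable_form_trace clM clP Q)+
  have "form_trace (cost_form h x \<xi>) T \<le> ennreal (1/2) *
      (\<Sum>b\<in>Basis. (\<integral>\<^sup>+z. w z * form_trace (?M b) (Q z) \<partial>M) + (\<integral>\<^sup>+z. w z * form_trace (?P b) (Q z) \<partial>M))"
    unfolding form_trace_cost
    by (intro mult_left_mono sum_mono add_mono form_trace_weak_integral_le[OF clM T Q w TQ]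
        form_trace_weak_integral_le[OF clP T Q w TQ]) auto
  also have "\<dots> = (\<integral>\<^sup>+z. w z * form_trace (cost_form h x \<xi>) (Q z) \<partial>M)"
    unfolding form_trace_cost
    by (simp add: nn_integral_add[symmetric] nn_integral_sum[symmetric] nn_integral_cmult[symmetric]
        sum_distrib_left distrib_left mult_ac)
  finally show ?thesis .
qed

text \<open>The assumption makes \<open>N\<close> either infinite everywhere or continuous. The explicit infimum over a countable dense set
is used for joint measurability: it expresses \<open>N z\<close> by values of \<open>N\<close> at points that do not vary with \<open>z\<close>.\<close>

lemma INF_dense_eq:
  fixes N :: "'z::metric_space \<Rightarrow> ennreal"
  assumes N: "\<And>z w t. t > 0 \<Longrightarrow> N z \<le> ennreal (1 + t) * N w + ennreal ((1 + 1 / t) * (dist z w)\<^sup>2) * ennreal K"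
    and K: "0 \<le> K" and D: "\<And>z r. r > 0 \<Longrightarrow> \<exists>d\<in>D. dist z d < r"
  shows "N z = (INF p\<in>D \<times> UNIV. ennreal (1 + 1 / real (Suc (snd p))) * N (fst p) +
    ennreal ((1 + real (Suc (snd p))) * (dist z (fst p))\<^sup>2) * ennreal K)" (is "_ = ?I")
proof (rule antisym)
  show "N z \<le> ?I"
  proof (rule INF_greatest)
    fix p :: "'z \<times> nat"
    show "N z \<le> ennreal (1 + 1 / real (Suc (snd p))) * N (fst p) +
        ennreal ((1 + real (Suc (snd p))) * (dist z (fst p))\<^sup>2) * ennreal K"
      using N[of "1 / real (Suc (snd p))" z "fst p"] by simp
  qed
  show "?I \<le> N z"
  proof (cases "N z")
    case top
    then show ?thesis by simp
  next
    case (real a)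
    show ?thesis
    proof (rule ennreal_le_epsilon)
      fix e :: real assume e: "e > 0"
      \<comment> \<open>With \<open>t \<le> 1\<close>, applying the hypothesis in both directions costs at most \<open>3 t a\<close> and three distance terms \<open>c\<close>; \<open>n\<close> and \<open>d\<close> make each contribution at most \<open>e / 2\<close>.\<close>
      obtain n where n: "6 * (a + 1) / e < real n" using reals_Archimedean2 by blast
      define t where "t = 1 / real (Suc n)"
      have t: "0 < t" "t \<le> 1" "1 / t = real (Suc n)" by (auto simp: t_def)
      have "6 * (a + 1) < e * real (Suc n)" using n e by (simp add: field_simps)
      then have "6 * (a + 1) * t < e" by (simp add: t_def field_simps)
      then have "6 * a * t < e" using t by (simp add: algebra_simps)
      define L where "L = 3 * (1 + 1 / t) * K + 1"
      have L: "L \<ge> 1" using t K by (simp add: L_def)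
      obtain d where d: "d \<in> D" "dist z d < sqrt (e / (2 * L))"
        using D[of "sqrt (e / (2 * L))" z] e L by auto
      have dd: "(dist z d)\<^sup>2 * L \<le> e / 2"
      proof -
        have "(dist z d)\<^sup>2 \<le> (sqrt (e / (2 * L)))\<^sup>2" using d(2) by (intro power_mono) auto
        also have "\<dots> = e / (2 * L)" using e L by simp
        finally show ?thesis using L by (simp add: field_simps)
      qed
      define c where "c = (1 + 1 / t) * (dist z d)\<^sup>2 * K"
      have c: "0 \<le> c" "3 * c \<le> e / 2"
      proof -
        show "0 \<le> c" using t K by (simp add: c_def)
        have "3 * c = (dist z d)\<^sup>2 * (L - 1)" by (simp add: c_def L_def)
        also have "\<dots> \<le> (dist z d)\<^sup>2 * L" by (intro mult_left_mono) auto
        finally show "3 * c \<le> e / 2" using dd by simp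
      qed
      have "?I \<le> ennreal (1 + t) * N d + ennreal c"
        using INF_lower[of "(d, n)" "D \<times> UNIV" "\<lambda>p. ennreal (1 + 1 / real (Suc (snd p))) * N (fst p) +
          ennreal ((1 + real (Suc (snd p))) * (dist z (fst p))\<^sup>2) * ennreal K"] d(1) t K
        by (simp add: c_def t_def flip: ennreal_mult)
      also have "\<dots> \<le> ennreal (1 + t) * (ennreal (1 + t) * N z + ennreal c) + ennreal c"
        using N[of t d z] t K
        by (intro add_right_mono mult_left_mono) (auto simp: c_def dist_commute simp flip: ennreal_mult)
      also have "\<dots> = ennreal ((1 + t) * ((1 + t) * a + c) + c)"
        using real t c by (simp flip: ennreal_mult ennreal_plus)
      also have "\<dots> \<le> ennreal (a + e)"
      proof (rule ennreal_leI)
        have "t * t \<le> t * 1" using t by (intro mult_left_mono) auto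
        then have "t * t * a \<le> t * a" using real by (intro mult_right_mono) auto
        moreover have "t * c \<le> 1 * c" using t c by (intro mult_right_mono) auto
        moreover have "(1 + t) * ((1 + t) * a + c) + c = a + 2 * (t * a) + t * t * a + 2 * c + t * c"
          by (simp add: algebra_simps)
        ultimately show "(1 + t) * ((1 + t) * a + c) + c \<le> a + e"
          using c(2) \<open>6 * a * t < e\<close> by (simp add: mult.commute mult.left_commute)
      qed
      finally show "?I \<le> N z + ennreal e" using real e by simp
    qed
  qed
qed

text \<open>For a fixed phase-space point in the cost, measurability in \<open>z\<close> follows from that of \<open>Q\<close>; \<open>INF_dense_eq\<close> then allows the
point to move with \<open>z\<close>.\<close>

theorem measurable_form_trace_cost:
  fixes Q :: "'a::euclidean_space \<times> 'a \<Rightarrow> 'a L2 \<Rightarrow> 'a L2"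
  assumes h: "h \<noteq> 0" and Q: "\<And>z. nonneg_operator (Q z)" "\<And>\<phi> \<psi>. (\<lambda>z. cinner \<phi> (Q z \<psi>)) \<in> borel_measurable borel"
    and fin: "\<And>z. op_trace (Q z) < \<infinity>"
  shows "(\<lambda>z. form_trace (cost_form h (fst z) (snd z)) (Q z)) \<in> borel_measurable borel"
proof -
  obtain D :: "('a \<times> 'a) set" where D: "countable D" "\<And>X. open X \<Longrightarrow> X \<noteq> {} \<Longrightarrow> \<exists>d\<in>D. d \<in> X"
    using countable_dense_setE by blast
  have dense: "\<exists>d\<in>D. dist z d < r" if "r > 0" for z r
    using D(2)[of "ball z r"] that by auto
  note [measurable] = measurable_op_trace[OF Q(2)] measurable_form_trace_fixed_cost[OF h Q]
  have "form_trace (cost_form h (fst z) (snd z)) (Q z) = (INF p\<in>D \<times> UNIV.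
      ennreal (1 + 1 / real (Suc (snd p))) * form_trace (cost_form h (fst (fst p)) (snd (fst p))) (Q z) +
      ennreal ((1 + real (Suc (snd p))) * (dist z (fst p))\<^sup>2) * (ennreal (1/2) * op_trace (Q z)))" for z
  proof -
    obtain r where r: "0 \<le> r" "op_trace (Q z) = ennreal r"
      using fin[of z] by (cases "op_trace (Q z)") auto
    define K where "K = 1/2 * r"
    have K: "0 \<le> K" "ennreal (1/2) * op_trace (Q z) = ennreal K"
      unfolding K_def r(2) using r(1) by (simp, intro ennreal_mult[symmetric]) simp_all
    show ?thesis unfolding K(2)
      by (rule INF_dense_eq[OF _ K(1) dense]) (use form_trace_cost_shift[OF Q(1)] in \<open>simp only: K(2)[symmetric]\<close>)
  qed
  moreover have "countable (D \<times> (UNIV :: nat set))" using D(1) by simp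
  ultimately show ?thesis
    by (simp only:) (intro borel_measurable_INF, auto)
qed

section \<open>Weak integrals of operator-valued functions\<close>

text \<open>The integrated matrix elements form a bounded sesquilinear form, because the trace dominates every matrix element.\<close>

lemma weak_integral_exists:
  fixes Q :: "'z \<Rightarrow> 'a::euclidean_space L2 \<Rightarrow> 'a L2"
  assumes Q: "\<And>z. nonneg_operator (Q z)" "\<And>\<phi> \<psi>. (\<lambda>z. cinner \<phi> (Q z \<psi>)) \<in> borel_measurable M"
    and w: "w \<in> borel_measurable M" "\<And>z. 0 \<le> w z"
    and fin: "(\<integral>\<^sup>+z. ennreal (w z) * op_trace (Q z) \<partial>M) < \<infinity>"
  shows "\<exists>T. nonneg_operator T \<and>
    (\<forall>\<phi> \<psi>. has_bochner_integral M (\<lambda>z. w z *\<^sub>R cinner \<phi> (Q z \<psi>)) (cinner \<phi> (T \<psi>)))"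
proof -
  note [measurable] = w(1) Q(2) measurable_op_trace[OF Q(2)]
  obtain \<tau> where \<tau>: "0 \<le> \<tau>" "(\<integral>\<^sup>+z. ennreal (w z) * op_trace (Q z) \<partial>M) = ennreal \<tau>"
    using fin by (cases "\<integral>\<^sup>+z. ennreal (w z) * op_trace (Q z) \<partial>M") auto
  define t where "t \<phi> \<psi> = (LINT z|M. w z *\<^sub>R cinner \<phi> (Q z \<psi>))" for \<phi> \<psi>
  have nn: "(\<integral>\<^sup>+z. ennreal (norm (w z *\<^sub>R cinner \<phi> (Q z \<psi>))) \<partial>M) \<le> ennreal (\<tau> * (norm \<phi> * norm \<psi>))" for \<phi> \<psi>
  proof -
    have "(\<integral>\<^sup>+z. ennreal (norm (w z *\<^sub>R cinner \<phi> (Q z \<psi>))) \<partial>M) \<le>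
        (\<integral>\<^sup>+z. (ennreal (w z) * op_trace (Q z)) * ennreal (norm \<phi> * norm \<psi>) \<partial>M)"
    proof (intro nn_integral_mono)
      fix z
      have "ennreal (norm (w z *\<^sub>R cinner \<phi> (Q z \<psi>))) = ennreal (w z) * ennreal (cmod (cinner \<phi> (Q z \<psi>)))"
        using w(2)[of z] by (simp add: ennreal_mult)
      also have "\<dots> \<le> ennreal (w z) * (op_trace (Q z) * ennreal (norm \<phi> * norm \<psi>))"
        by (intro mult_left_mono nonneg_operator_trace_bound Q) simp
      finally show "ennreal (norm (w z *\<^sub>R cinner \<phi> (Q z \<psi>))) \<le>
          (ennreal (w z) * op_trace (Q z)) * ennreal (norm \<phi> * norm \<psi>)" by (simp only: mult.assoc)
    qed
    also have "\<dots> = ennreal \<tau> * ennreal (norm \<phi> * norm \<psi>)"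
      by (subst nn_integral_multc) (simp_all add: \<tau>(2))
    finally show ?thesis using \<tau>(1) by (simp add: ennreal_mult)
  qed
  have int: "integrable M (\<lambda>z. w z *\<^sub>R cinner \<phi> (Q z \<psi>))" for \<phi> \<psi>
    by (rule integrableI_bounded) (use nn[of \<phi> \<psi>] in \<open>auto intro: le_less_trans\<close>)
  have t_le: "cmod (t \<phi> \<psi>) \<le> \<tau> * (norm \<phi> * norm \<psi>)" for \<phi> \<psi>
  proof -
    have "ennreal (cmod (t \<phi> \<psi>)) \<le> (\<integral>\<^sup>+z. ennreal (norm (w z *\<^sub>R cinner \<phi> (Q z \<psi>))) \<partial>M)"
      unfolding t_def by (rule integral_norm_bound_ennreal[OF int])
    then have "ennreal (cmod (t \<phi> \<psi>)) \<le> ennreal (\<tau> * (norm \<phi> * norm \<psi>))" using nn order_trans by blast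
    then show ?thesis using \<tau>(1) by (simp add: ennreal_le_iff)
  qed
  have t_add: "t (\<phi> + \<phi>') \<psi> = t \<phi> \<psi> + t \<phi>' \<psi>" for \<phi> \<phi>' \<psi>
    unfolding t_def cinner_add_left scaleR_add_right by (rule Bochner_Integration.integral_add[OF int int])
  have t_scale: "t (c *\<^sub>C \<phi>) \<psi> = cnj c * t \<phi> \<psi>" for c \<phi> \<psi>
    unfolding t_def cinner_scaleC_left by (simp flip: mult_scaleR_right)
  have t_herm: "t \<phi> \<psi> = cnj (t \<psi> \<phi>)" for \<phi> \<psi>
  proof -
    have "cnj (t \<psi> \<phi>) = (LINT z|M. cnj (w z *\<^sub>R cinner \<psi> (Q z \<phi>)))"
      unfolding t_def by (rule Bochner_Integration.integral_cnj[symmetric])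
    also have "\<dots> = t \<phi> \<psi>"
      unfolding t_def
    proof (intro Bochner_Integration.integral_cong refl)
      fix z
      have "cinner \<phi> (Q z \<psi>) = cnj (cinner \<psi> (Q z \<phi>))"
        unfolding nonneg_operatorD(3)[OF Q(1), of \<phi>] by (rule cinner_commute)
      then show "cnj (w z *\<^sub>R cinner \<psi> (Q z \<phi>)) = w z *\<^sub>R cinner \<phi> (Q z \<psi>)" by simp
    qed
    finally show ?thesis ..
  qed
  have "\<exists>\<eta>. \<forall>\<phi>. cinner \<phi> \<eta> = t \<phi> \<psi>" for \<psi>
  proof -
    have bl: "bounded_linear (\<lambda>\<phi>. Re (t \<phi> \<psi>))"
    proof (rule bounded_linear_intro)
      show "norm (Re (t \<phi> \<psi>)) \<le> norm \<phi> * (\<tau> * norm \<psi>)" for \<phi>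
        using abs_Re_le_cmod[of "t \<phi> \<psi>"] t_le[of \<phi> \<psi>] by (simp add: mult_ac)
    qed (simp_all add: t_add scaleR_L2_def t_scale)
    \<comment> \<open>The real part determines the form, because it is antilinear in \<open>\<phi>\<close>.\<close>
    from riesz_representation[OF bl] obtain \<eta> where \<eta>: "\<And>\<phi>. inner \<eta> \<phi> = Re (t \<phi> \<psi>)" by auto
    have "cinner \<phi> \<eta> = t \<phi> \<psi>" for \<phi>
      using \<eta>[of \<phi>] \<eta>[of "\<i> *\<^sub>C \<phi>"]
      by (simp add: complex_eq_iff Re_cinner Im_cinner t_scale inner_commute[of _ \<eta>])
    then show ?thesis by blast
  qed
  then obtain T where T: "\<And>\<phi> \<psi>. cinner \<phi> (T \<psi>) = t \<phi> \<psi>" by metis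
  have "nonneg_operator T"
  proof (rule nonneg_operatorI)
    show "cinner \<phi> (T \<psi>) = cinner (T \<phi>) \<psi>" for \<phi> \<psi>
      using t_herm[of \<phi> \<psi>] cinner_commute[of "T \<phi>" \<psi>] by (simp add: T)
    show "0 \<le> Re (cinner \<psi> (T \<psi>))" for \<psi>
      unfolding T t_def integral_Re[OF int, symmetric]
      using w(2) nonneg_operatorD(4)[OF Q(1)] by (intro Bochner_Integration.integral_nonneg) auto
    show "norm (T \<psi>) \<le> norm \<psi> * \<tau>" for \<psi>
    proof (cases "T \<psi> = 0")
      case False
      have "(norm (T \<psi>))\<^sup>2 = Re (t (T \<psi>) \<psi>)" by (simp add: T[symmetric] cinner_norm)
      also have "\<dots> \<le> cmod (t (T \<psi>) \<psi>)" by (rule complex_Re_le_cmod)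
      also have "\<dots> \<le> \<tau> * (norm (T \<psi>) * norm \<psi>)" by (rule t_le)
      finally show ?thesis using False by (simp add: power2_eq_square mult_ac)
    qed (use \<tau> in simp)
  qed
  moreover have "has_bochner_integral M (\<lambda>z. w z *\<^sub>R cinner \<phi> (Q z \<psi>)) (cinner \<phi> (T \<psi>))" for \<phi> \<psi>
    unfolding T t_def using int by (rule has_bochner_integral_integrable)
  ultimately show ?thesis by blast
qed

lemma weak_integral_diagonal:
  fixes Q :: "'z \<Rightarrow> 'a::euclidean_space L2 \<Rightarrow> 'a L2"
  assumes Q: "\<And>z. nonneg_operator (Q z)" and w: "\<And>z. 0 \<le> w z"
    and T: "has_bochner_integral M (\<lambda>z. w z *\<^sub>R cinner \<psi> (Q z \<psi>)) (cinner \<psi> (T \<psi>))"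
  shows "ennreal (Re (cinner \<psi> (T \<psi>))) = (\<integral>\<^sup>+z. ennreal (w z) * ennreal (Re (cinner \<psi> (Q z \<psi>))) \<partial>M)"
proof -
  have "has_bochner_integral M (\<lambda>z. Re (w z *\<^sub>R cinner \<psi> (Q z \<psi>))) (Re (cinner \<psi> (T \<psi>)))"
    using T by (rule has_bochner_integral_Re)
  then have *: "integrable M (\<lambda>z. w z * Re (cinner \<psi> (Q z \<psi>)))"
    "(LINT z|M. w z * Re (cinner \<psi> (Q z \<psi>))) = Re (cinner \<psi> (T \<psi>))"
    by (auto simp: has_bochner_integral_iff)
  have "(\<integral>\<^sup>+z. ennreal (w z * Re (cinner \<psi> (Q z \<psi>))) \<partial>M) = ennreal (Re (cinner \<psi> (T \<psi>)))"
    unfolding *(2)[symmetric] using *(1) w nonneg_operatorD(4)[OF Q] by (intro nn_integral_eq_integral) auto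
  then show ?thesis using w nonneg_operatorD(4)[OF Q] by (simp add: ennreal_mult)
qed

section \<open>Transport of a coupling along a plan\<close>

text \<open>The cell of \<open>x\<close> is the index of the first point of a countable dense set that is close to \<open>x\<close>.\<close>

lemma small_cells_exist:
  assumes "\<delta> > 0"
  obtains \<iota> :: "'z::{second_countable_topology,metric_space} \<Rightarrow> nat"
  where "\<iota> \<in> measurable borel (count_space UNIV)" "\<And>x y. \<iota> x = \<iota> y \<Longrightarrow> dist x y \<le> \<delta>"
proof -
  obtain D :: "'z set" where D: "countable D" "\<And>X. open X \<Longrightarrow> X \<noteq> {} \<Longrightarrow> \<exists>d\<in>D. d \<in> X"
    using countable_dense_setE by blast
  have "D \<noteq> {}" using D(2)[of UNIV] by auto
  define d where "d = from_nat_into D"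
  define \<iota> where "\<iota> x = (LEAST i. dist (d i) x < \<delta> / 2)" for x
  have ex: "\<exists>i. dist (d i) x < \<delta> / 2" for x
  proof -
    obtain e where "e \<in> D" "e \<in> ball x (\<delta> / 2)" using D(2)[of "ball x (\<delta> / 2)"] assms by auto
    moreover from \<open>e \<in> D\<close> obtain i where "d i = e" unfolding d_def using from_nat_into_surj[OF D(1)] by blast
    ultimately show ?thesis by (auto simp: dist_commute)
  qed
  have near: "dist (d (\<iota> x)) x < \<delta> / 2" for x
    unfolding \<iota>_def by (rule LeastI_ex[OF ex])
  show thesis
  proof (rule that)
    show "\<iota> \<in> measurable borel (count_space UNIV)"
      unfolding \<iota>_def by measurable
    show "dist x y \<le> \<delta>" if "\<iota> x = \<iota> y" for x y
      using near[of x] near[of y] dist_triangle2[of x y "d (\<iota> x)"] that by (simp add: dist_commute)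
  qed
qed

lemma transport_planD:
  assumes "\<gamma> \<in> transport_plans \<mu> \<nu>"
  shows "prob_space \<gamma>" "sets \<gamma> = sets borel" "space \<gamma> = UNIV"
    "k \<in> borel_measurable borel \<Longrightarrow> (\<integral>\<^sup>+p. k (fst p) \<partial>\<gamma>) = (\<integral>\<^sup>+z. k z \<partial>\<mu>)"
    "k \<in> borel_measurable borel \<Longrightarrow> (\<integral>\<^sup>+p. k (snd p) \<partial>\<gamma>) = (\<integral>\<^sup>+z. k z \<partial>\<nu>)"
proof -
  show 1: "prob_space \<gamma>" "sets \<gamma> = sets borel"
    using assms by (auto simp: transport_plans_def)
  show "space \<gamma> = UNIV" using sets_eq_imp_space_eq[OF 1(2)] by simp
  have [measurable]: "fst \<in> measurable \<gamma> borel" "snd \<in> measurable \<gamma> borel"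
    unfolding measurable_cong_sets[OF 1(2) refl] by (auto intro!: borel_measurable_continuous_onI continuous_intros)
  have m: "distr \<gamma> borel fst = \<mu>" "distr \<gamma> borel snd = \<nu>" using assms by (auto simp: transport_plans_def)
  show "(\<integral>\<^sup>+p. k (fst p) \<partial>\<gamma>) = (\<integral>\<^sup>+z. k z \<partial>\<mu>)" if "k \<in> borel_measurable borel"
    unfolding m(1)[symmetric] using that by (subst nn_integral_distr) auto
  show "(\<integral>\<^sup>+p. k (snd p) \<partial>\<gamma>) = (\<integral>\<^sup>+z. k z \<partial>\<nu>)" if "k \<in> borel_measurable borel"
    unfolding m(2)[symmetric] using that by (subst nn_integral_distr) auto
qed

text \<open>In probabilistic terms, \<open>w i x\<close> is the conditional probability that the source lies in cell \<open>i\<close> given that the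
target is \<open>x\<close>. It is the Radon--Nikodym density, relative to the second marginal, of the image of
\<open>\<gamma>\<close> restricted to sources in that cell.\<close>

lemma conditional_weights_exist:
  fixes g :: "'b::euclidean_space \<Rightarrow> real"
  assumes g: "g \<in> borel_measurable borel"
    and \<gamma>: "\<gamma> \<in> transport_plans \<mu> (density lborel (\<lambda>z. ennreal (g z)))"
    and \<iota>: "\<iota> \<in> measurable borel (count_space UNIV)"
  obtains w :: "nat \<Rightarrow> 'b \<Rightarrow> real" where
    "\<And>i. w i \<in> borel_measurable borel" "\<And>i x. 0 \<le> w i x" "\<And>x. (\<Sum>i. ennreal (w i x)) \<le> 1"
    "AE x in lborel. 0 < g x \<longrightarrow> (\<lambda>i. w i x) sums 1"
    "\<And>i k. k \<in> borel_measurable borel \<Longrightarrow>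
      (\<integral>\<^sup>+x. ennreal (w i x) * (k x * ennreal (g x)) \<partial>lborel) = (\<integral>\<^sup>+p. indicator {i} (\<iota> (fst p)) * k (snd p) \<partial>\<gamma>)"
proof -
  let ?G = "density lborel (\<lambda>z. ennreal (g z))"
  note [measurable] = g \<iota>
  note \<gamma>D = transport_planD[OF \<gamma>]
  have proj [measurable]: "fst \<in> measurable \<gamma> borel" "snd \<in> measurable \<gamma> borel"
    unfolding measurable_cong_sets[OF \<gamma>D(2) refl] by (auto intro!: borel_measurable_continuous_onI continuous_intros)
  have cell [measurable]: "(\<lambda>p. indicator {i} (\<iota> (fst p)) :: ennreal) \<in> borel_measurable \<gamma>" for i
    by (rule measurable_compose[OF measurable_compose[OF proj(1) \<iota>]]) simp
  define N where "N i = distr (density \<gamma> (\<lambda>p. indicator {i} (\<iota> (fst p)))) borel snd" for i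
  have N: "(\<integral>\<^sup>+x. k x \<partial>N i) = (\<integral>\<^sup>+p. indicator {i} (\<iota> (fst p)) * k (snd p) \<partial>\<gamma>)"
    if [measurable]: "k \<in> borel_measurable borel" for i k
  proof -
    have [measurable]: "(\<lambda>p. k (snd p)) \<in> borel_measurable \<gamma>" by (rule measurable_compose[OF proj(2) that])
    show ?thesis
      unfolding N_def by (subst nn_integral_distr) (simp_all add: nn_integral_density)
  qed
  have N_le: "(\<integral>\<^sup>+x. k x \<partial>N i) \<le> (\<integral>\<^sup>+x. k x \<partial>?G)" if [measurable]: "k \<in> borel_measurable borel" for i k
    unfolding N[OF that] \<gamma>D(5)[OF that, symmetric]
    by (intro nn_integral_mono) (auto split: split_indicator)
  have G: "sigma_finite_measure ?G"
    by (rule sigma_finite_measure.sigma_finite_iff_density_finite[OF sigma_finite_lborel, THEN iffD2]) auto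
  have RN: "\<exists>u. u \<in> borel_measurable borel \<and> density ?G u = N i" for i
  proof -
    have "absolutely_continuous ?G (N i)"
      unfolding absolutely_continuous_def
    proof
      fix X assume X: "X \<in> null_sets ?G"
      then have [measurable]: "X \<in> sets borel" by auto
      have "emeasure (N i) X \<le> emeasure ?G X"
        using N_le[of "indicator X" i] by (simp add: N_def)
      then show "X \<in> null_sets (N i)" using X by (auto simp: null_sets_def N_def)
    qed
    moreover have "sets (N i) = sets ?G" by (simp add: N_def)
    moreover have "borel_measurable ?G = (borel_measurable borel :: ('b \<Rightarrow> ennreal) set)"
      by (rule measurable_cong_sets) simp_all
    ultimately show ?thesis using sigma_finite_measure.Radon_Nikodym[OF G, of "N i"] by blast
  qed
  define u where "u i = (SOME u. u \<in> borel_measurable borel \<and> density ?G u = N i)" for i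
  have [measurable]: "u i \<in> borel_measurable borel" and u: "density ?G (u i) = N i" for i
    using someI_ex[OF RN[of i]] unfolding u_def by auto
  have ug: "(\<integral>\<^sup>+x. u i x * (k x * ennreal (g x)) \<partial>lborel) = (\<integral>\<^sup>+p. indicator {i} (\<iota> (fst p)) * k (snd p) \<partial>\<gamma>)"
    if [measurable]: "k \<in> borel_measurable borel" for i k
    unfolding N[OF that, symmetric] u[symmetric]
    by (simp add: nn_integral_density mult_ac)
  have one: "(\<Sum>i. indicator {i} (j::nat)) = (1::ennreal)" for j
    by (subst suminf_finite[of "{j}"]) auto
  have "density ?G (\<lambda>x. \<Sum>i. u i x) = density ?G (\<lambda>_. 1)"
  proof (rule measure_eqI)
    fix X assume "X \<in> sets (density ?G (\<lambda>x. \<Sum>i. u i x))"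
    then have [measurable]: "X \<in> sets borel" by simp
    have "emeasure (density ?G (\<lambda>x. \<Sum>i. u i x)) X = (\<integral>\<^sup>+x. (\<Sum>i. u i x * (indicator X x * ennreal (g x))) \<partial>lborel)"
      by (simp add: emeasure_density nn_integral_density mult_ac flip: ennreal_suminf_cmult)
    also have "\<dots> = (\<Sum>i. \<integral>\<^sup>+p. indicator {i} (\<iota> (fst p)) * indicator X (snd p) \<partial>\<gamma>)"
      by (subst nn_integral_suminf) (simp_all add: ug)
    also have "\<dots> = (\<integral>\<^sup>+p. (\<Sum>i. indicator {i} (\<iota> (fst p))) * indicator X (snd p) \<partial>\<gamma>)"
      by (subst nn_integral_suminf[symmetric]) (simp_all flip: ennreal_suminf_multc)
    also have "\<dots> = emeasure ?G X" unfolding one using \<gamma>D(5)[of "indicator X"] by simp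
    finally show "emeasure (density ?G (\<lambda>x. \<Sum>i. u i x)) X = emeasure (density ?G (\<lambda>_. 1)) X"
      by (simp add: density_1)
  qed simp
  then have "AE x in ?G. (\<Sum>i. u i x) = 1"
    by (intro sigma_finite_measure.density_unique[OF G]) auto
  then have sum1: "AE x in lborel. 0 < g x \<longrightarrow> (\<Sum>i. u i x) = 1"
    by (simp add: AE_density)
  \<comment> \<open>The densities are corrected on a set that the second marginal does not charge, so that their sum is at most 1 at every point.\<close>
  define w where "w i x = (if (\<Sum>i. u i x) = 1 \<and> 0 < g x then enn2real (u i x) else 0)" for i x
  have [measurable]: "w i \<in> borel_measurable borel" for i unfolding w_def by measurable
  have u_fin: "u i x \<le> 1" if "(\<Sum>i. u i x) = 1" for i x
    using sum_le_suminf[of "\<lambda>i. u i x" "{i}"] that by simp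
  have w_u: "ennreal (w i x) = u i x" if "(\<Sum>i. u i x) = 1" "0 < g x" for i x
    using u_fin[OF that(1), of i] that by (auto simp: w_def ennreal_enn2real_if top_unique)
  show thesis
  proof (rule that)
    show "w i \<in> borel_measurable borel" for i by measurable
    show "0 \<le> w i x" for i x by (simp add: w_def)
    show "(\<Sum>i. ennreal (w i x)) \<le> 1" for x
    proof (cases "(\<Sum>i. u i x) = 1 \<and> 0 < g x")
      case True
      then show ?thesis by (simp add: w_u)
    next
      case False
      then have "w i x = 0" for i by (auto simp: w_def)
      then show ?thesis by simp
    qed
    show "AE x in lborel. 0 < g x \<longrightarrow> (\<lambda>i. w i x) sums 1"
      using sum1
    proof eventually_elim
      case (elim x)
      show ?case
      proof
        assume "0 < g x"
        then have eq: "(\<Sum>i. ennreal (w i x)) = ennreal 1" using elim by (simp add: w_u)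
        have "(\<lambda>i. ennreal (w i x)) sums (\<Sum>i. ennreal (w i x))" by (rule summable_sums[OF summableI])
        then have "(\<lambda>i. ennreal (w i x)) sums ennreal 1" unfolding eq .
        then show "(\<lambda>i. w i x) sums 1"
          by (rule sums_ennreal[THEN iffD1, rotated 2]) (simp_all add: w_def)
      qed
    qed
    show "(\<integral>\<^sup>+x. ennreal (w i x) * (k x * ennreal (g x)) \<partial>lborel) = (\<integral>\<^sup>+p. indicator {i} (\<iota> (fst p)) * k (snd p) \<partial>\<gamma>)"
      if k: "k \<in> borel_measurable borel" for i k
      unfolding ug[OF k, symmetric]
    proof (intro nn_integral_cong_AE, use sum1 in eventually_elim)
      case (elim x)
      show ?case
      proof (cases "0 < g x")
        case True
        then have "(\<Sum>i. u i x) = 1" using elim by blast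
        then show ?thesis using True by (simp only: w_u)
      next
        case False
        then have "ennreal (g x) = 0" by (intro ennreal_neg) simp
        then show ?thesis by simp
      qed
    qed
  qed
qed

text \<open>This recovers the integral of a coupling from the operators attached to the cells.\<close>

lemma sums_weighted_integrals:
  fixes q :: "'z \<Rightarrow> complex" and w :: "nat \<Rightarrow> 'z \<Rightarrow> real"
  assumes q: "integrable M q" and w: "\<And>i. w i \<in> borel_measurable M" "\<And>i x. 0 \<le> w i x"
    and sum_le: "\<And>x. (\<Sum>i. ennreal (w i x)) \<le> 1"
    and sum_one: "AE x in M. q x \<noteq> 0 \<longrightarrow> (\<lambda>i. w i x) sums 1"
  shows "summable (\<lambda>i. norm (LINT x|M. w i x *\<^sub>R q x))"
    "(\<lambda>i. LINT x|M. w i x *\<^sub>R q x) sums (LINT x|M. q x)"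
proof -
  note [measurable] = w(1) borel_measurable_integrable[OF q]
  have w_le: "w i x \<le> 1" for i x
  proof -
    have "ennreal (w i x) \<le> (\<Sum>i. ennreal (w i x))" using sum_le_suminf[of "\<lambda>i. ennreal (w i x)" "{i}"] by simp
    also note sum_le[of x]
    finally show ?thesis by simp
  qed
  have int: "integrable M (\<lambda>x. w i x *\<^sub>R q x)" for i
  proof (rule Bochner_Integration.integrable_bound[OF q])
    show "AE x in M. norm (w i x *\<^sub>R q x) \<le> norm (q x)"
      using w(2) w_le by (auto intro!: mult_left_le_one_le)
  qed measurable
  have w_summable: "summable (\<lambda>i. w i x)" for x
    using sum_le[of x] w(2) by (intro summable_suminf_not_top) (auto simp: top_unique)
  then have ptw: "AE x in M. summable (\<lambda>i. norm (w i x *\<^sub>R q x))"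
    using w(2) by (auto intro!: summable_mult2)
  have "(\<Sum>i. ennreal (LINT x|M. norm (w i x *\<^sub>R q x))) = (\<Sum>i. \<integral>\<^sup>+x. ennreal (norm (w i x *\<^sub>R q x)) \<partial>M)"
    by (intro suminf_cong nn_integral_eq_integral[symmetric] integrable_norm int) auto
  also have "\<dots> = (\<integral>\<^sup>+x. (\<Sum>i. ennreal (w i x)) * ennreal (norm (q x)) \<partial>M)"
    using w(2) by (subst nn_integral_suminf[symmetric]) (simp_all add: ennreal_mult)
  also have "\<dots> \<le> (\<integral>\<^sup>+x. 1 * ennreal (norm (q x)) \<partial>M)"
    by (intro nn_integral_mono mult_right_mono sum_le) simp
  also have "\<dots> < \<infinity>" using q by (simp add: integrable_iff_bounded)
  finally have norms: "summable (\<lambda>i. LINT x|M. norm (w i x *\<^sub>R q x))"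
    by (intro summable_suminf_not_top) auto
  show "summable (\<lambda>i. norm (LINT x|M. w i x *\<^sub>R q x))"
    by (rule summable_comparison_test'[OF norms, of 0]) (simp only: real_norm_def abs_norm_cancel integral_norm_bound)
  have "(\<lambda>i. LINT x|M. w i x *\<^sub>R q x) sums (LINT x|M. (\<Sum>i. w i x *\<^sub>R q x))"
    by (rule sums_integral[OF int ptw norms])
  also have "(LINT x|M. (\<Sum>i. w i x *\<^sub>R q x)) = (LINT x|M. q x)"
  proof (rule integral_cong_AE)
    show "AE x in M. (\<Sum>i. w i x *\<^sub>R q x) = q x"
      using sum_one
    proof eventually_elim
      case (elim x)
      show ?case
      proof (cases "q x = 0")
        case False
        then have "(\<lambda>i. w i x *\<^sub>R q x) sums (1 *\<^sub>R q x)"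
          using elim by (intro bounded_linear.sums[OF bounded_linear_scaleR_left]) auto
        then show ?thesis by (simp add: sums_iff)
      qed simp
    qed
  qed measurable
  finally show "(\<lambda>i. LINT x|M. w i x *\<^sub>R q x) sums (LINT x|M. q x)" .
qed

text \<open>In \<open>coupling_transfer\<close> the mass \<open>m i\<close> is 1, or 0 on cells that \<open>f\<close> does not charge, where \<open>c i\<close> vanishes too;
the first condition on \<open>c\<close> covers both cases.\<close>

lemma has_bochner_integral_cellwise_constant:
  fixes c :: "nat \<Rightarrow> complex" and r :: "'z \<Rightarrow> real"
  assumes \<iota>: "\<iota> \<in> measurable M (count_space UNIV)" and r: "r \<in> borel_measurable M" "\<And>z. 0 \<le> r z"
    and mass: "\<And>i. (\<integral>\<^sup>+z. indicator {i} (\<iota> z) * ennreal (r z) \<partial>M) = ennreal (m i)" "\<And>i. 0 \<le> m i"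
    and c: "\<And>i. m i *\<^sub>R c i = c i" "summable (\<lambda>i. norm (c i))" "c sums s"
  shows "has_bochner_integral M (\<lambda>z. r z *\<^sub>R c (\<iota> z)) s"
proof -
  note [measurable] = \<iota> r(1)
  define u where "u i z = indicator {i} (\<iota> z) * r z" for i z
  have [measurable]: "u i \<in> borel_measurable M" for i
    unfolding u_def by (intro borel_measurable_times measurable_compose[OF \<iota>] r(1)) simp
  have u: "has_bochner_integral M (u i) (m i)" for i
  proof (rule has_bochner_integral_nn_integral)
    have "(\<integral>\<^sup>+z. ennreal (u i z) \<partial>M) = (\<integral>\<^sup>+z. indicator {i} (\<iota> z) * ennreal (r z) \<partial>M)"
      unfolding u_def by (intro nn_integral_cong) (auto split: split_indicator)
    then show "(\<integral>\<^sup>+z. ennreal (u i z) \<partial>M) = ennreal (m i)" by (simp add: mass)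
    show "u i \<in> borel_measurable M" by measurable
  qed (use mass(2) r(2) in \<open>simp_all add: u_def\<close>)
  then have U: "integrable M (u i)" "(LINT z|M. u i z) = m i" for i
    by (auto simp: has_bochner_integral_iff)
  have int: "integrable M (\<lambda>z. u i z *\<^sub>R c i)" for i using U(1) by simp
  have I: "(LINT z|M. u i z *\<^sub>R c i) = c i" for i using U(2)[of i] c(1)[of i] U(1)[of i] by simp
  have single: "(\<lambda>i. if i = \<iota> z then x else 0) sums x" for z and x :: "'y::real_normed_vector"
    using sums_single[of "\<iota> z" "\<lambda>_. x"] by simp
  have ptw: "(\<lambda>i. u i z *\<^sub>R c i) = (\<lambda>i. if i = \<iota> z then r z *\<^sub>R c (\<iota> z) else 0)" for z
    by (auto simp: u_def)
  have ptw_norm: "(\<lambda>i. norm (u i z *\<^sub>R c i)) = (\<lambda>i. if i = \<iota> z then norm (r z *\<^sub>R c (\<iota> z)) else 0)" for z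
    by (auto simp: u_def)
  have sum_AE: "AE z in M. summable (\<lambda>i. norm (u i z *\<^sub>R c i))"
    unfolding ptw_norm using single by (auto simp: summable_def)
  have "(LINT z|M. norm (u i z *\<^sub>R c i)) = norm (c i)" for i
  proof -
    have "norm (u i z *\<^sub>R c i) = u i z *\<^sub>R norm (c i)" for z using r(2) by (simp add: u_def)
    then have "(LINT z|M. norm (u i z *\<^sub>R c i)) = (LINT z|M. u i z *\<^sub>R norm (c i))" by (simp only:)
    also have "\<dots> = m i * norm (c i)" using U by simp
    also have "m i * norm (c i) = norm (m i *\<^sub>R c i)" using mass(2) by simp
    finally show ?thesis by (simp only: c(1))
  qed
  then have sum_norm: "summable (\<lambda>i. LINT z|M. norm (u i z *\<^sub>R c i))" using c(2) by (simp only:)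
  have limit: "(\<Sum>i. u i z *\<^sub>R c i) = r z *\<^sub>R c (\<iota> z)" for z
    unfolding ptw using single by (rule sums_unique[symmetric])
  have "integrable M (\<lambda>z. \<Sum>i. u i z *\<^sub>R c i)" by (rule integrable_suminf[OF int sum_AE sum_norm])
  moreover have "(LINT z|M. (\<Sum>i. u i z *\<^sub>R c i)) = s"
    using sums_integral[OF int sum_AE sum_norm] c(3) unfolding I by (rule sums_unique2)
  ultimately show ?thesis by (simp add: limit has_bochner_integral_iff)
qed

text \<open>The exceptional null set is removed because the lemmas on measurability and weak integrals ask for a nonnegative
operator at every point.\<close>

lemma qc_coupling_regular_version:
  fixes g :: "'a::euclidean_space \<times> 'a \<Rightarrow> real"
  assumes "Q \<in> qc_couplings g R"
  obtains Q' where "\<And>z. nonneg_operator (Q' z)" "\<And>z. op_trace (Q' z) < \<infinity>"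
    "\<And>\<phi> \<psi>. (\<lambda>z. cinner \<phi> (Q' z \<psi>)) \<in> borel_measurable borel"
    "AE z in lborel. op_trace (Q' z) = ennreal (g z)"
    "\<And>\<phi> \<psi>. has_bochner_integral lborel (\<lambda>z. cinner \<phi> (Q' z \<psi>)) (cinner \<phi> (R \<psi>))"
    "AE z in lborel. Q' z = Q z"
proof -
  have Q: "\<And>\<phi> \<psi>. (\<lambda>z. cinner \<phi> (Q z \<psi>)) \<in> borel_measurable lborel"
    "AE z in lborel. nonneg_trace_class (Q z)" "AE z in lborel. op_trace (Q z) = ennreal (g z)"
    "\<And>\<phi> \<psi>. has_bochner_integral lborel (\<lambda>z. cinner \<phi> (Q z \<psi>)) (cinner \<phi> (R \<psi>))"
    using assms by (auto simp: qc_couplings_def)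
  obtain N where N: "N \<in> null_sets lborel" "{z \<in> space lborel. \<not> nonneg_trace_class (Q z)} \<subseteq> N"
    using Q(2) by (auto simp: eventually_ae_filter)
  define Q' where "Q' z = (if z \<in> N then (\<lambda>_. 0) else Q z)" for z
  have [measurable]: "N \<in> sets borel" using N(1) by auto
  note [measurable] = Q(1)
  have zero: "nonneg_trace_class (\<lambda>_::'a L2. 0 :: 'a L2)"
    unfolding nonneg_trace_class_def by (auto simp: op_trace_nn_integral intro!: nonneg_operatorI[where K = 0])
  have nt: "nonneg_trace_class (Q' z)" for z using N(2) zero by (auto simp: Q'_def)
  have meas: "(\<lambda>z. cinner \<phi> (Q' z \<psi>)) \<in> borel_measurable borel" for \<phi> \<psi>
  proof -
    have "(\<lambda>z. cinner \<phi> (Q' z \<psi>)) = (\<lambda>z. if z \<in> N then 0 else cinner \<phi> (Q z \<psi>))" by (auto simp: Q'_def)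
    moreover have "(\<lambda>z. if z \<in> N then 0 else cinner \<phi> (Q z \<psi>)) \<in> borel_measurable lborel" by measurable
    ultimately show ?thesis by simp
  qed
  have eq: "AE z in lborel. Q' z = Q z"
    using AE_not_in[OF N(1)] by eventually_elim (simp add: Q'_def)
  show thesis
  proof (rule that[OF _ _ meas _ _ eq])
    show "nonneg_operator (Q' z)" "op_trace (Q' z) < \<infinity>" for z using nt[of z] by (auto simp: nonneg_trace_class_def)
    show "AE z in lborel. op_trace (Q' z) = ennreal (g z)" using eq Q(3) by eventually_elim simp
    show "has_bochner_integral lborel (\<lambda>z. cinner \<phi> (Q' z \<psi>)) (cinner \<phi> (R \<psi>))" for \<phi> \<psi>
    proof (rule has_bochner_integral_cong_AE[THEN iffD1, OF _ _ _ Q(4)])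
      show "AE z in lborel. cinner \<phi> (Q z \<psi>) = cinner \<phi> (Q' z \<psi>)" using eq by eventually_elim simp
    qed (use meas Q(1) in auto)
  qed
qed

text \<open>The new coupling is \<open>P z = (f z / m i) T i\<close> on cell \<open>i\<close>, where \<open>T i\<close> is the weak integral of \<open>w i Q\<close> and
\<open>m i = trace (T i)\<close> is the mass of the cell. Since \<open>P z\<close> is itself a weak integral of \<open>Q\<close>, its cost at \<open>z\<close> is at
most the corresponding integral of the cost of \<open>Q x\<close> at \<open>z\<close>, which \<open>form_trace_cost_shift\<close> compares with the cost
at \<open>x\<close>. The distance from \<open>z\<close> to \<open>x\<close> is compared with that from the actual source \<open>fst p\<close>, which lies in the
same cell as \<open>z\<close>; as the resulting bound depends on \<open>z\<close> only through its cell, it may be integrated against \<open>f\<close> cell by cell.\<close>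

lemma coupling_transfer:
  fixes h :: real and f g :: "'a::euclidean_space \<times> 'a \<Rightarrow> real" and Q :: "'a \<times> 'a \<Rightarrow> 'a L2 \<Rightarrow> 'a L2"
  defines "c \<equiv> \<lambda>z. cost_form h (fst z) (snd z)"
  assumes h: "h \<noteq> 0" and t: "t > 0" and \<delta>: "\<delta> > 0"
    and f: "probability_density f" and g: "probability_density g"
    and \<gamma>: "\<gamma> \<in> transport_plans (density lborel (\<lambda>z. ennreal (f z))) (density lborel (\<lambda>z. ennreal (g z)))"
    and Q: "\<And>z. nonneg_operator (Q z)" "\<And>\<phi> \<psi>. (\<lambda>z. cinner \<phi> (Q z \<psi>)) \<in> borel_measurable borel"
    and fin: "\<And>z. op_trace (Q z) < \<infinity>"
    and tr: "AE z in lborel. op_trace (Q z) = ennreal (g z)"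
    and QR: "\<And>\<phi> \<psi>. has_bochner_integral lborel (\<lambda>z. cinner \<phi> (Q z \<psi>)) (cinner \<phi> (R \<psi>))"
  shows "\<exists>P\<in>qc_couplings f R. (\<integral>\<^sup>+z. form_trace (c z) (P z) \<partial>lborel) \<le>
     ennreal (1 + t) * (\<integral>\<^sup>+z. form_trace (c z) (Q z) \<partial>lborel) +
     ennreal (1 + 1 / t) * ((\<integral>\<^sup>+p. ennreal ((dist (fst p) (snd p))\<^sup>2) \<partial>\<gamma>) + ennreal (\<delta>\<^sup>2))"
proof -
  have [measurable]: "f \<in> borel_measurable borel" "g \<in> borel_measurable borel"
    using f g by (auto simp: probability_density_def)
  note \<gamma>D = transport_planD[OF \<gamma>]
  interpret \<gamma>: prob_space \<gamma> by (rule \<gamma>D(1))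
  have proj [measurable]: "fst \<in> measurable \<gamma> borel" "snd \<in> measurable \<gamma> borel"
    unfolding measurable_cong_sets[OF \<gamma>D(2) refl] by (auto intro!: borel_measurable_continuous_onI continuous_intros)
  obtain \<iota> :: "'a \<times> 'a \<Rightarrow> nat" where \<iota> [measurable]: "\<iota> \<in> measurable borel (count_space UNIV)"
    and \<iota>_near: "\<And>x y. \<iota> x = \<iota> y \<Longrightarrow> dist x y \<le> \<delta>"
    using small_cells_exist[OF \<delta>] by blast
  have cell [measurable]: "(\<lambda>p. indicator {i} (\<iota> (fst p)) :: ennreal) \<in> borel_measurable \<gamma>" for i
    by (rule measurable_compose[OF measurable_compose[OF proj(1) \<iota>]]) simp
  have one: "(\<Sum>i. indicator {i} (j::nat)) = (1::ennreal)" for j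
    by (subst suminf_finite[of "{j}"]) auto
  obtain w :: "nat \<Rightarrow> 'a \<times> 'a \<Rightarrow> real" where w: "\<And>i. w i \<in> borel_measurable borel" "\<And>i x. 0 \<le> w i x"
    and w_sum: "\<And>x. (\<Sum>i. ennreal (w i x)) \<le> 1" "AE x in lborel. 0 < g x \<longrightarrow> (\<lambda>i. w i x) sums 1"
    and w_\<gamma>: "\<And>i k. k \<in> borel_measurable borel \<Longrightarrow>
      (\<integral>\<^sup>+x. ennreal (w i x) * (k x * ennreal (g x)) \<partial>lborel) = (\<integral>\<^sup>+p. indicator {i} (\<iota> (fst p)) * k (snd p) \<partial>\<gamma>)"
    using conditional_weights_exist[OF \<open>g \<in> borel_measurable borel\<close> \<gamma> \<iota>] by blast
  note [measurable] = w(1) measurable_op_trace[OF Q(2)] Q(2)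
  have wg: "(\<integral>\<^sup>+x. ennreal (w i x) * (k x * op_trace (Q x)) \<partial>lborel) =
      (\<integral>\<^sup>+p. indicator {i} (\<iota> (fst p)) * k (snd p) \<partial>\<gamma>)" if k: "k \<in> borel_measurable borel" for i k
    unfolding w_\<gamma>[OF k, symmetric] by (intro nn_integral_cong_AE) (use tr in eventually_elim, simp)
  define m where "m i = enn2real (\<integral>\<^sup>+p. indicator {i} (\<iota> (fst p)) \<partial>\<gamma>)" for i
  have m0: "0 \<le> m i" for i by (simp add: m_def)
  have m: "(\<integral>\<^sup>+p. indicator {i} (\<iota> (fst p)) \<partial>\<gamma>) = ennreal (m i)" for i
  proof -
    have "(\<integral>\<^sup>+p. indicator {i} (\<iota> (fst p)) \<partial>\<gamma>) \<le> (\<integral>\<^sup>+p. 1 \<partial>\<gamma>)"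
      by (intro nn_integral_mono) (auto split: split_indicator)
    also have "\<dots> = 1" by (simp add: \<gamma>.emeasure_space_1)
    finally show ?thesis by (auto simp: m_def ennreal_enn2real_if top_unique)
  qed
  \<comment> \<open>The density may be negative on a null set, whereas \<open>P z\<close> has to be nonnegative.\<close>
  define fp where "fp z = max 0 (f z)" for z
  have [measurable]: "fp \<in> borel_measurable borel" unfolding fp_def by measurable
  have fp: "0 \<le> fp z" "ennreal (fp z) = ennreal (f z)" for z by (auto simp: fp_def max_def ennreal_neg)
  have f_mass: "(\<integral>\<^sup>+z. indicator {i} (\<iota> z) * ennreal (fp z) \<partial>lborel) = ennreal (m i)" for i
  proof -
    have [measurable]: "(\<lambda>z. indicator {i} (\<iota> z) :: ennreal) \<in> borel_measurable borel"
      by (rule measurable_compose[OF \<iota>]) simp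
    have "ennreal (m i) = (\<integral>\<^sup>+z. indicator {i} (\<iota> z) \<partial>density lborel (\<lambda>z. ennreal (f z)))"
      unfolding m[symmetric] using \<gamma>D(4)[of "\<lambda>z. indicator {i} (\<iota> z)"] by simp
    then show ?thesis by (simp add: nn_integral_density fp(2) mult.commute)
  qed
  have w_mass: "(\<integral>\<^sup>+x. ennreal (w i x) * op_trace (Q x) \<partial>lborel) = ennreal (m i)" for i
    using wg[of "\<lambda>_. 1" i] m[of i] by simp
  have "\<exists>T. nonneg_operator T \<and>
      (\<forall>\<phi> \<psi>. has_bochner_integral lborel (\<lambda>z. w i z *\<^sub>R cinner \<phi> (Q z \<psi>)) (cinner \<phi> (T \<psi>)))" for i
    by (rule weak_integral_exists) (use Q w w_mass in auto)
  then obtain T where T: "\<And>i. nonneg_operator (T i)"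
    and TQ: "\<And>i \<phi> \<psi>. has_bochner_integral lborel (\<lambda>z. w i z *\<^sub>R cinner \<phi> (Q z \<psi>)) (cinner \<phi> (T i \<psi>))"
    by metis
  have T_diag: "ennreal (Re (cinner \<psi> (T i \<psi>))) = (\<integral>\<^sup>+z. ennreal (w i z) * ennreal (Re (cinner \<psi> (Q z \<psi>))) \<partial>lborel)"
    for i \<psi> by (rule weak_integral_diagonal[OF Q(1) w(2) TQ])
  have T_trace: "op_trace (T i) = ennreal (m i)" for i
    unfolding w_mass[symmetric] by (rule op_trace_weak_integral) (use T_diag in auto)
  have T_zero: "cinner \<phi> (T i \<psi>) = 0" if "m i = 0" for i \<phi> \<psi>
    using nonneg_operator_trace_bound[OF T, of \<phi> i \<psi>] that by (simp add: T_trace)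
  define r where "r z = fp z / m (\<iota> z)" for z
  have r0: "0 \<le> r z" for z using fp m0 by (simp add: r_def)
  have [measurable]: "r \<in> borel_measurable borel" unfolding r_def by measurable
  \<comment> \<open>The value is 0 for a cell without mass, by the convention \<open>x / 0 = 0\<close>, and 1 otherwise.\<close>
  have r_mass: "(\<integral>\<^sup>+z. indicator {i} (\<iota> z) * ennreal (r z) \<partial>lborel) = ennreal (m i / m i)" for i
  proof -
    have [measurable]: "(\<lambda>z. indicator {i} (\<iota> z) :: ennreal) \<in> borel_measurable borel"
      by (rule measurable_compose[OF \<iota>]) simp
    have "(\<integral>\<^sup>+z. indicator {i} (\<iota> z) * ennreal (r z) \<partial>lborel) =
        (\<integral>\<^sup>+z. ennreal (1 / m i) * (indicator {i} (\<iota> z) * ennreal (fp z)) \<partial>lborel)"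
      using fp(1) m0 by (intro nn_integral_cong) (auto simp: r_def ennreal_mult[symmetric] split: split_indicator)
    also have "\<dots> = ennreal (1 / m i) * ennreal (m i)" by (simp add: nn_integral_cmult f_mass)
    finally show ?thesis using m0 by (simp add: ennreal_mult[symmetric])
  qed
  define P where "P z \<psi> = r z *\<^sub>R T (\<iota> z) \<psi>" for z \<psi>
  have P: "nonneg_operator (P z)" for z unfolding P_def by (rule nonneg_operator_scale[OF T r0])
  have P_trace: "op_trace (P z) = ennreal (r z * m (\<iota> z))" for z
    unfolding P_def op_trace_scale[OF r0] T_trace using r0 m0 by (simp add: ennreal_mult)
  have P_coupling: "P \<in> qc_couplings f R"
    unfolding qc_couplings_def
  proof (intro CollectI conjI allI)
    fix \<phi> \<psi> :: "'a L2"
    have "(\<lambda>z. r z *\<^sub>R cinner \<phi> (T (\<iota> z) \<psi>)) \<in> borel_measurable borel" by measurable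
    then show "(\<lambda>z. cinner \<phi> (P z \<psi>)) \<in> borel_measurable lborel" by (simp add: P_def)
    have q: "integrable lborel (\<lambda>z. cinner \<phi> (Q z \<psi>))" "(LINT z|lborel. cinner \<phi> (Q z \<psi>)) = cinner \<phi> (R \<psi>)"
      using QR[of \<phi> \<psi>] by (auto simp: has_bochner_integral_iff)
    have "AE x in lborel. cinner \<phi> (Q x \<psi>) \<noteq> 0 \<longrightarrow> (\<lambda>i. w i x) sums 1"
      using w_sum(2) tr
    proof eventually_elim
      case (elim x)
      have "g x > 0" if "cinner \<phi> (Q x \<psi>) \<noteq> 0"
      proof (rule ccontr)
        assume "\<not> g x > 0"
        then have "op_trace (Q x) = 0" using elim by (simp add: ennreal_neg)
        then show False using nonneg_operator_trace_bound[OF Q(1), of \<phi> x \<psi>] that by simp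
      qed
      then show ?case using elim by blast
    qed
    note W = sums_weighted_integrals[OF q(1) _ w(2) w_sum(1) this]
    have T_int: "(LINT z|lborel. w i z *\<^sub>R cinner \<phi> (Q z \<psi>)) = cinner \<phi> (T i \<psi>)" for i
      using TQ[of i \<phi> \<psi>] by (simp add: has_bochner_integral_iff)
    have "has_bochner_integral lborel (\<lambda>z. r z *\<^sub>R cinner \<phi> (T (\<iota> z) \<psi>)) (cinner \<phi> (R \<psi>))"
    proof (rule has_bochner_integral_cellwise_constant[where m = "\<lambda>i. m i / m i"])
      show "(m i / m i) *\<^sub>R cinner \<phi> (T i \<psi>) = cinner \<phi> (T i \<psi>)" for i
        by (cases "m i = 0") (simp_all add: T_zero)
      show "summable (\<lambda>i. norm (cinner \<phi> (T i \<psi>)))" using W(1) by (simp add: T_int)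
      show "(\<lambda>i. cinner \<phi> (T i \<psi>)) sums cinner \<phi> (R \<psi>)" using W(2) by (simp add: T_int q(2))
    qed (use r0 r_mass m0 in auto)
    then show "has_bochner_integral lborel (\<lambda>z. cinner \<phi> (P z \<psi>)) (cinner \<phi> (R \<psi>))" by (simp add: P_def)
  next
    show "AE z in lborel. nonneg_trace_class (P z)"
      using P P_trace by (simp add: nonneg_trace_class_def)
    have "AE z in lborel. m (\<iota> z) = 0 \<longrightarrow> ennreal (fp z) = 0"
    proof -
      have [measurable]: "(\<lambda>z. indicator {i} (\<iota> z) :: ennreal) \<in> borel_measurable borel" for i
        by (rule measurable_compose[OF \<iota>]) simp
      have "AE z in lborel. m i = 0 \<longrightarrow> indicator {i} (\<iota> z) * ennreal (fp z) = 0" for i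
      proof (cases "m i = 0")
        case True
        then have "(\<integral>\<^sup>+z. indicator {i} (\<iota> z) * ennreal (fp z) \<partial>lborel) = 0" by (simp add: f_mass)
        then show ?thesis by (subst (asm) nn_integral_0_iff_AE) auto
      qed simp
      then have "AE z in lborel. \<forall>i. m i = 0 \<longrightarrow> indicator {i} (\<iota> z) * ennreal (fp z) = 0"
        by (simp add: AE_all_countable)
      then show ?thesis by eventually_elim (metis indicator_simps(1) insertI1 mult_1)
    qed
    then show "AE z in lborel. op_trace (P z) = ennreal (f z)"
    proof eventually_elim
      case (elim z)
      show ?case
      proof (cases "m (\<iota> z) = 0")
        case True
        then show ?thesis using elim by (simp add: P_trace fp(2))
      next
        case False
        then show ?thesis by (simp add: P_trace r_def fp(2))
      qed
    qed
  qed
  have F [measurable]: "(\<lambda>z. form_trace (c z) (Q z)) \<in> borel_measurable borel"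
    unfolding c_def by (rule measurable_form_trace_cost[OF h Q fin])
  define L where "L i = (\<integral>\<^sup>+x. ennreal (w i x) * form_trace (c x) (Q x) \<partial>lborel)" for i
  define D where "D p = ennreal ((dist (fst p) (snd p))\<^sup>2) + ennreal (\<delta>\<^sup>2)" for p :: "('a \<times> 'a) \<times> ('a \<times> 'a)"
  have D_meas [measurable]: "D \<in> borel_measurable \<gamma>" unfolding D_def by measurable
  define K where "K i = (\<integral>\<^sup>+p. indicator {i} (\<iota> (fst p)) * D p \<partial>\<gamma>)" for i
  define A where "A i = ennreal (1 + t) * L i + ennreal (1 + 1 / t) * K i" for i
  have P_cost: "form_trace (c z) (P z) \<le> ennreal (r z) * A (\<iota> z)" for z
  proof -
    let ?i = "\<iota> z"
    have P_diag: "ennreal (Re (cinner \<psi> (P z \<psi>))) =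
        (\<integral>\<^sup>+x. (ennreal (r z) * ennreal (w ?i x)) * ennreal (Re (cinner \<psi> (Q x \<psi>))) \<partial>lborel)" for \<psi>
      using r0[of z] by (simp add: P_def ennreal_mult' T_diag mult.assoc nn_integral_cmult)
    have "form_trace (c z) (P z) \<le> (\<integral>\<^sup>+x. (ennreal (r z) * ennreal (w ?i x)) * form_trace (c z) (Q x) \<partial>lborel)"
      unfolding c_def by (rule form_trace_cost_weak_integral_le[OF h P Q(1) _ _ P_diag]) measurable
    also have "\<dots> \<le> (\<integral>\<^sup>+x. ennreal (r z) * (ennreal (1 + t) * (ennreal (w ?i x) * form_trace (c x) (Q x)) +
        ennreal (1 + 1 / t) * (ennreal (w ?i x) * (ennreal ((dist z x)\<^sup>2 / 2) * op_trace (Q x)))) \<partial>lborel)"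
    proof (intro nn_integral_mono)
      fix x
      have "form_trace (c z) (Q x) \<le> ennreal (1 + t) * form_trace (c x) (Q x) +
          ennreal ((1 + 1 / t) * (dist z x)\<^sup>2) * (ennreal (1/2) * op_trace (Q x))"
        unfolding c_def by (rule form_trace_cost_shift[OF Q(1) t])
      also have "ennreal ((1 + 1 / t) * (dist z x)\<^sup>2) * (ennreal (1/2) * op_trace (Q x)) =
          ennreal (1 + 1 / t) * (ennreal ((dist z x)\<^sup>2 / 2) * op_trace (Q x))"
      proof -
        have "ennreal ((1 + 1 / t) * (dist z x)\<^sup>2) * ennreal (1/2) = ennreal ((1 + 1 / t) * (dist z x)\<^sup>2 * (1/2))"
          by (rule ennreal_mult[symmetric]) (use t in simp_all)
        moreover have "ennreal (1 + 1 / t) * ennreal ((dist z x)\<^sup>2 / 2) = ennreal ((1 + 1 / t) * ((dist z x)\<^sup>2 / 2))"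
          by (rule ennreal_mult[symmetric]) (use t in simp_all)
        moreover have "(1 + 1 / t) * (dist z x)\<^sup>2 * (1/2) = (1 + 1 / t) * ((dist z x)\<^sup>2 / 2)" by simp
        ultimately show ?thesis unfolding mult.assoc[symmetric, of _ _ "op_trace (Q x)"] by (simp only:)
      qed
      finally have "(ennreal (r z) * ennreal (w ?i x)) * form_trace (c z) (Q x) \<le>
          (ennreal (r z) * ennreal (w ?i x)) * (ennreal (1 + t) * form_trace (c x) (Q x) +
            ennreal (1 + 1 / t) * (ennreal ((dist z x)\<^sup>2 / 2) * op_trace (Q x)))"
        by (intro mult_left_mono) auto
      then show "(ennreal (r z) * ennreal (w ?i x)) * form_trace (c z) (Q x) \<le>
          ennreal (r z) * (ennreal (1 + t) * (ennreal (w ?i x) * form_trace (c x) (Q x)) +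
          ennreal (1 + 1 / t) * (ennreal (w ?i x) * (ennreal ((dist z x)\<^sup>2 / 2) * op_trace (Q x))))"
        by (simp only: distrib_left mult_ac)
    qed
    also have "\<dots> = ennreal (r z) * (ennreal (1 + t) * L ?i + ennreal (1 + 1 / t) *
        (\<integral>\<^sup>+x. ennreal (w ?i x) * (ennreal ((dist z x)\<^sup>2 / 2) * op_trace (Q x)) \<partial>lborel))"
      by (simp add: nn_integral_cmult nn_integral_add L_def)
    also have "(\<integral>\<^sup>+x. ennreal (w ?i x) * (ennreal ((dist z x)\<^sup>2 / 2) * op_trace (Q x)) \<partial>lborel) =
        (\<integral>\<^sup>+p. indicator {?i} (\<iota> (fst p)) * ennreal ((dist z (snd p))\<^sup>2 / 2) \<partial>\<gamma>)"
      by (rule wg) measurable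
    also have "\<dots> \<le> K ?i"
      unfolding K_def
    proof (intro nn_integral_mono)
      fix p :: "('a \<times> 'a) \<times> ('a \<times> 'a)"
      show "indicator {?i} (\<iota> (fst p)) * ennreal ((dist z (snd p))\<^sup>2 / 2) \<le> indicator {?i} (\<iota> (fst p)) * D p"
      proof (cases "\<iota> (fst p) = ?i")
        case True
        let ?d = "dist (fst p) (snd p)"
        have "dist z (snd p) \<le> \<delta> + ?d"
          using \<iota>_near[of z "fst p"] dist_triangle[of z "snd p" "fst p"] True by simp
        then have "(dist z (snd p))\<^sup>2 \<le> (\<delta> + ?d)\<^sup>2" by (intro power_mono) auto
        also have "\<dots> \<le> 2 * (?d\<^sup>2 + \<delta>\<^sup>2)" using sum_squares_bound[of \<delta> ?d] by (simp add: power2_sum)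
        finally show ?thesis unfolding D_def by (simp add: mult_left_mono ennreal_leI flip: ennreal_plus)
      qed simp
    qed
    finally show ?thesis by (simp add: A_def add_left_mono mult_left_mono)
  qed
  have "(\<integral>\<^sup>+z. form_trace (c z) (P z) \<partial>lborel) \<le> (\<integral>\<^sup>+z. (\<Sum>i. A i * (indicator {i} (\<iota> z) * ennreal (r z))) \<partial>lborel)"
  proof (intro nn_integral_mono)
    fix z
    have "(\<Sum>i. A i * (indicator {i} (\<iota> z) * ennreal (r z))) = ennreal (r z) * A (\<iota> z)"
      by (subst suminf_finite[of "{\<iota> z}"]) (auto simp: mult.commute)
    then show "form_trace (c z) (P z) \<le> (\<Sum>i. A i * (indicator {i} (\<iota> z) * ennreal (r z)))" using P_cost by simp
  qed
  also have "\<dots> = (\<Sum>i. A i * ennreal (m i / m i))"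
  proof -
    have [measurable]: "(\<lambda>z. indicator {i} (\<iota> z) :: ennreal) \<in> borel_measurable borel" for i
      by (rule measurable_compose[OF \<iota>]) simp
    show ?thesis by (subst nn_integral_suminf) (simp_all add: nn_integral_cmult r_mass)
  qed
  also have "\<dots> \<le> (\<Sum>i. A i * 1)"
    by (intro suminf_le mult_left_mono summableI) (auto simp: divide_self_if)
  also have "\<dots> = ennreal (1 + t) * (\<Sum>i. L i) + ennreal (1 + 1 / t) * (\<Sum>i. K i)"
    unfolding A_def mult_1_right by (simp add: suminf_add[symmetric] ennreal_suminf_cmult)
  also have "(\<Sum>i. L i) \<le> (\<integral>\<^sup>+x. form_trace (c x) (Q x) \<partial>lborel)"
  proof -
    have "(\<Sum>i. L i) = (\<integral>\<^sup>+x. (\<Sum>i. ennreal (w i x)) * form_trace (c x) (Q x) \<partial>lborel)"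
      unfolding L_def by (subst nn_integral_suminf[symmetric]) simp_all
    also have "\<dots> \<le> (\<integral>\<^sup>+x. 1 * form_trace (c x) (Q x) \<partial>lborel)"
      by (intro nn_integral_mono mult_right_mono w_sum) simp
    finally show ?thesis by simp
  qed
  also have "(\<Sum>i. K i) = (\<integral>\<^sup>+p. ennreal ((dist (fst p) (snd p))\<^sup>2) \<partial>\<gamma>) + ennreal (\<delta>\<^sup>2)"
  proof -
    have "(\<Sum>i. K i) = (\<integral>\<^sup>+p. (\<Sum>i. indicator {i} (\<iota> (fst p))) * D p \<partial>\<gamma>)"
      unfolding K_def by (subst nn_integral_suminf[symmetric]) simp_all
    also have "\<dots> = (\<integral>\<^sup>+p. ennreal ((dist (fst p) (snd p))\<^sup>2) \<partial>\<gamma>) + ennreal (\<delta>\<^sup>2)"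
      unfolding one D_def by (simp add: nn_integral_add \<gamma>.emeasure_space_1)
    finally show ?thesis .
  qed
  finally show ?thesis using P_coupling by (auto simp: add_right_mono mult_left_mono)
qed

lemma E_dist_fst_snd:
  "E_dist h p R = ennreal_sqrt
     (INF Q\<in>qc_couplings p R. \<integral>\<^sup>+z. form_trace (cost_form h (fst z) (snd z)) (Q z) \<partial>lborel)"
  unfolding E_dist_def by (simp only: case_prod_unfold prod.collapse)

lemma dist_MK2_fst_snd:
  "dist_MK2 \<mu> \<nu> = ennreal_sqrt
     (INF \<gamma>\<in>transport_plans \<mu> \<nu>. \<integral>\<^sup>+p. ennreal ((dist (fst p) (snd p))\<^sup>2) \<partial>\<gamma>)"
  unfolding dist_MK2_def by (simp only: case_prod_unfold dist_norm)

section \<open>The triangle inequality\<close>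

lemma cost_le_combination:
  fixes f g :: "'a::euclidean_space \<times> 'a \<Rightarrow> real"
  assumes h: "h \<noteq> 0" and t: "t > 0" and \<delta>: "\<delta> > 0"
    and f: "probability_density f" and g: "probability_density g"
    and \<gamma>: "\<gamma> \<in> transport_plans (density lborel (\<lambda>z. ennreal (f z))) (density lborel (\<lambda>z. ennreal (g z)))"
    and Q: "Q \<in> qc_couplings g R"
  shows "(INF P\<in>qc_couplings f R. \<integral>\<^sup>+z. form_trace (cost_form h (fst z) (snd z)) (P z) \<partial>lborel) \<le>
     ennreal (1 + t) * (\<integral>\<^sup>+z. form_trace (cost_form h (fst z) (snd z)) (Q z) \<partial>lborel) +
     ennreal (1 + 1 / t) * ((\<integral>\<^sup>+p. ennreal ((dist (fst p) (snd p))\<^sup>2) \<partial>\<gamma>) + ennreal (\<delta>\<^sup>2))"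
proof (rule qc_coupling_regular_version[OF Q])
  fix Q' :: "'a \<times> 'a \<Rightarrow> 'a L2 \<Rightarrow> 'a L2"
  assume Q': "\<And>z. nonneg_operator (Q' z)" "\<And>z. op_trace (Q' z) < \<infinity>"
    "\<And>\<phi> \<psi>. (\<lambda>z. cinner \<phi> (Q' z \<psi>)) \<in> borel_measurable borel"
    "AE z in lborel. op_trace (Q' z) = ennreal (g z)"
    "\<And>\<phi> \<psi>. has_bochner_integral lborel (\<lambda>z. cinner \<phi> (Q' z \<psi>)) (cinner \<phi> (R \<psi>))"
    and eq: "AE z in lborel. Q' z = Q z"
  have same: "(\<integral>\<^sup>+z. form_trace (cost_form h (fst z) (snd z)) (Q' z) \<partial>lborel) =
      (\<integral>\<^sup>+z. form_trace (cost_form h (fst z) (snd z)) (Q z) \<partial>lborel)"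
    by (intro nn_integral_cong_AE) (use eq in eventually_elim, simp)
  from coupling_transfer[OF h t \<delta> f g \<gamma> Q'(1,3,2,4,5)] show ?thesis
    unfolding same by (auto intro: INF_lower2)
qed

text \<open>With \<open>u > sqrt (Inf X)\<close> and \<open>v > sqrt (Inf Y)\<close> the choice \<open>t = v / u\<close> gives \<open>(1 + t) u\<^sup>2 + (1 + 1/t) v\<^sup>2 = (u + v)\<^sup>2\<close>.
Working with strictly larger \<open>u\<close> and \<open>v\<close> keeps \<open>t\<close> positive and finite and leaves room for \<open>\<delta>\<close>.\<close>

lemma ennreal_sqrt_le_add:
  assumes Z: "\<And>t \<delta> x y. 0 < t \<Longrightarrow> 0 < \<delta> \<Longrightarrow> x \<in> X \<Longrightarrow> y \<in> Y \<Longrightarrow>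
      Z \<le> ennreal (1 + t) * x + ennreal (1 + 1 / t) * (y + ennreal (\<delta>\<^sup>2))"
  shows "ennreal_sqrt Z \<le> ennreal_sqrt (Inf Y) + ennreal_sqrt (Inf X)"
proof (cases "Inf X = \<infinity> \<or> Inf Y = \<infinity>")
  case True
  then show ?thesis by (auto simp: ennreal_sqrt_def)
next
  case False
  then obtain a b where a: "Inf X = ennreal a" "0 \<le> a" and b: "Inf Y = ennreal b" "0 \<le> b"
    by (cases "Inf X"; cases "Inf Y") auto
  have Z_le: "Z \<le> ennreal ((sqrt a + sqrt b + 2 * e)\<^sup>2)" if e: "e > 0" for e
  proof -
    define u where "u = sqrt a + e"
    define v where "v = sqrt b + e"
    have u: "u > 0" and v: "v > 0" using e a b by (auto simp: u_def v_def add_nonneg_pos)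
    have "a < u\<^sup>2"
      using a e power_strict_mono[of "sqrt a" u 2] by (simp add: u_def)
    then have "Inf X < ennreal (u\<^sup>2)" using a by (simp add: ennreal_less_iff)
    then obtain x where x: "x \<in> X" "x < ennreal (u\<^sup>2)" by (auto simp: Inf_less_iff)
    have "b < v\<^sup>2"
      using b e power_strict_mono[of "sqrt b" v 2] by (simp add: v_def)
    then obtain c where c: "b < c" "c < v\<^sup>2" using dense by blast
    then have "Inf Y < ennreal c" using b by (simp add: ennreal_less_iff)
    then obtain y where y: "y \<in> Y" "y < ennreal c" by (auto simp: Inf_less_iff)
    define \<delta> where "\<delta> = sqrt (v\<^sup>2 - c)"
    have \<delta>: "\<delta> > 0" "\<delta>\<^sup>2 = v\<^sup>2 - c" using c by (auto simp: \<delta>_def)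
    define t where "t = v / u"
    have t: "t > 0" using u v by (simp add: t_def)
    have "Z \<le> ennreal (1 + t) * x + ennreal (1 + 1 / t) * (y + ennreal (\<delta>\<^sup>2))"
      by (rule Z[OF t \<delta>(1) x(1) y(1)])
    also have "\<dots> \<le> ennreal (1 + t) * ennreal (u\<^sup>2) + ennreal (1 + 1 / t) * (ennreal c + ennreal (\<delta>\<^sup>2))"
      using x(2) y(2) by (intro add_mono mult_left_mono) auto
    also have "ennreal c + ennreal (\<delta>\<^sup>2) = ennreal (v\<^sup>2)"
      using b c \<delta> by (subst ennreal_plus[symmetric]) auto
    also have "ennreal (1 + t) * ennreal (u\<^sup>2) + ennreal (1 + 1 / t) * ennreal (v\<^sup>2) =
        ennreal ((1 + t) * u\<^sup>2 + (1 + 1 / t) * v\<^sup>2)"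
      using t by (simp add: ennreal_mult ennreal_plus del: ennreal_1 flip: ennreal_1)
    also have "(1 + t) * u\<^sup>2 + (1 + 1 / t) * v\<^sup>2 = (u + v)\<^sup>2"
      using u v by (simp add: t_def field_simps power2_eq_square)
    also have "u + v = sqrt a + sqrt b + 2 * e" by (simp add: u_def v_def)
    finally show ?thesis .
  qed
  have "Z \<le> ennreal ((sqrt a + sqrt b + 2 * 1)\<^sup>2)" by (rule Z_le) simp
  then have "Z \<noteq> \<infinity>" by (auto simp: top_unique)
  then obtain z where z: "Z = ennreal z" "0 \<le> z" by (cases Z) auto
  have "sqrt z \<le> sqrt a + sqrt b + e" if e: "e > 0" for e
  proof -
    have "z \<le> (sqrt a + sqrt b + 2 * (e / 2))\<^sup>2"
      using Z_le[of "e / 2"] e z by (simp add: ennreal_le_iff)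
    then have "sqrt z \<le> sqrt ((sqrt a + sqrt b + e)\<^sup>2)" by (intro real_sqrt_le_mono) simp
    then show ?thesis using a b e by simp
  qed
  then have "sqrt z \<le> sqrt a + sqrt b" by (rule field_le_epsilon)
  then show ?thesis using a b z
    by (simp add: ennreal_sqrt_def add.commute ennreal_leI flip: ennreal_plus)
qed

theorem theorem3p5:
  fixes h :: real
    and f g :: "(real ^ 'd) \<times> (real ^ 'd) \<Rightarrow> real"
    and R :: "(real ^ 'd) L2 \<Rightarrow> (real ^ 'd) L2"
  assumes "h > 0"
    and "probability_density f"
    and "probability_density g"
    and "density_operator R"
    and "(\<integral>\<^sup>+ (p, q). ennreal (((norm p)\<^sup>2 + (norm q)\<^sup>2) * (f (p, q) + g (p, q))) \<partial>lborel) < \<infinity>"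
    and "form_trace (oscillator_form h) R < \<infinity>"
  shows "E_dist h f R \<le> dist_MK2 (density lborel (\<lambda>z. ennreal (f z))) (density lborel (\<lambda>z. ennreal (g z)))
           + E_dist h g R"
  unfolding E_dist_fst_snd dist_MK2_fst_snd
proof (rule ennreal_sqrt_le_add)
  have h: "h \<noteq> 0" using \<open>h > 0\<close> by simp
  fix t \<delta> :: real and x y
  assume "0 < t" "0 < \<delta>"
    and "x \<in> (\<lambda>Q. \<integral>\<^sup>+z. form_trace (cost_form h (fst z) (snd z)) (Q z) \<partial>lborel) ` qc_couplings g R"
    and "y \<in> (\<lambda>\<gamma>. \<integral>\<^sup>+p. ennreal ((dist (fst p) (snd p))\<^sup>2) \<partial>\<gamma>) `
      transport_plans (density lborel (\<lambda>z. ennreal (f z))) (density lborel (\<lambda>z. ennreal (g z)))"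
  then show "(INF P\<in>qc_couplings f R. \<integral>\<^sup>+z. form_trace (cost_form h (fst z) (snd z)) (P z) \<partial>lborel) \<le>
      ennreal (1 + t) * x + ennreal (1 + 1 / t) * (y + ennreal (\<delta>\<^sup>2))"
    using cost_le_combination[OF h _ _ assms(2,3)] by blast
qed

end
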